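(* Let $m\geq 1$ be an integer and let $\eta_{(m)}$ denote the $m$th eigenvalue (without counting multiplicity, numbering starting from $m=0$) of the second fourth-order Steklov problem. (1) Fix $A>0$. Let $\eta_{(m)}(K;A)$ be the $m$th Steklov eigenvalue on a geodesic disk of area $A$ in the space form $M_K^2$, as a function of the curvature $K\in(-\infty,4\pi/A)$. For $m=1$, there exists a $K_1>0$ such that $\eta_{(m)}(K;A)$ is strictly decreasing on $(-\infty,K_1)$ and strictly increasing on $(K_1,4\pi/A)$; for $m=2$, $\eta_{(m)}(K;A)$ is strictly decreasing on $(-\infty,0)$ and strictly increasing on $(0,4\pi/A)$; while for $m\geq 3$, there exists a $K_m<0$ such that $\eta_{(m)}(K;A)$ is strictly decreasing on $(-\infty,K_m)$ and strictly increasing on $(K_m,4\pi/A)$. (2) Fix $\rho>0$. Let $\eta_{(m)}(K;\rho)$ be the $m$th Steklov eigenvalue on a geodesic disk of radius $\rho$ in the space form $M_K^2$, as a function of the curvature $K\in(-\infty,(\pi/\rho)^2)$. For $m=1$, $\eta_{(m)}(K;\rho)$ is strictly decreasing on $(-\infty,0)$ and strictly increasing on $(0,(\pi/\rho)^2)$; while for $m\geq 2$, there exists a $\bar K_m<0$ such that $\eta_{(m)}(K;\rho)$ is strictly decreasing on $(-\infty,\bar K_m)$ and strictly increasing on $(\bar K_m,(\pi/\rho)^2)$.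
   Context: For $K\in\mathbb{R}$, $M_K^2=[0,r_0)\times\mathbb{S}^{1}$ (with $\{0\}\times\mathbb{S}^1$ collapsed to a point) is the $2$-dimensional space form of constant curvature $K$, with metric $dr^2+h_K^2(r)g_{\mathbb{S}^1}$, where $h_K(r)=\frac{1}{\sqrt K}\sin(\sqrt K r)$ and $r_0=\pi/\sqrt K$ if $K>0$; $h_0(r)=r$ and $r_0=+\infty$ if $K=0$; $h_K(r)=\frac{1}{\sqrt{-K}}\sinh(\sqrt{-K}r)$ and $r_0=+\infty$ if $K<0$. Geodesic disks are closed disks $\{r\le R\}$ with $0<R<r_0$; "of area $A$" means $2\pi\int_0^R h_K(r)\,dr=A$. Second fourth-order Steklov problem: on a smooth compact Riemannian manifold $M$ with boundary $\partial M$ and outward unit normal $\nu$, a real number $\eta$ is an eigenvalue if there is a nontrivial $u$ with $$\Delta^2 u=0 \text{ in } M,\qquad u=0,\quad \Delta u=\eta\frac{\partial u}{\partial\nu} \text{ on } \partial M,$$ where $\Delta$ is the Laplace--Beltrami operator ($\Delta=\operatorname{div}\nabla$). The spectrum is discrete, positive and unbounded; the distinct eigenvalues (without counting multiplicity) are listed in increasing order as $0<\eta_{(0)}<\eta_{(1)}<\eta_{(2)}<\cdots$. *)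

theory Defs
  imports "HOL-Analysis.Analysis"
begin

section \<open>Smooth functions\<close>

definition partial_deriv :: "'n::finite \<Rightarrow> (real^'n \<Rightarrow> real) \<Rightarrow> real^'n \<Rightarrow> real" where
  "partial_deriv i f x = frechet_derivative f (at x) (axis i 1)"

primrec Ck_on :: "nat \<Rightarrow> (real^'n::finite) set \<Rightarrow> (real^'n \<Rightarrow> real) \<Rightarrow> bool" where
  "Ck_on 0 U f \<longleftrightarrow> continuous_on U f"
| "Ck_on (Suc k) U f \<longleftrightarrow> f differentiable_on U \<and> (\<forall>i. Ck_on k U (partial_deriv i f))"

text \<open>As usual for subsets of Euclidean space that need not be open, smoothness on \<open>M\<close> means
  smoothness on some open neighbourhood of \<open>M\<close>.  For a closed domain \<open>M\<close> the derivatives at boundary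
  points are then limits of derivatives at interior points, so they depend only on \<open>f\<close> on \<open>M\<close>.\<close>

definition smooth_on :: "(real^'n::finite) set \<Rightarrow> (real^'n \<Rightarrow> real) \<Rightarrow> bool" where
  "smooth_on M f \<longleftrightarrow> (\<exists>U. open U \<and> M \<subseteq> U \<and> (\<forall>k. Ck_on k U f))"

section \<open>The second fourth-order Steklov problem\<close>

text \<open>A Riemannian metric in a single chart is given by its Gram matrix \<open>g x\<close>; the Laplace--Beltrami
  operator is the divergence of the gradient, with gradient \<open>\<Sum>j. g\<^sup>i\<^sup>j \<partial>\<^sub>j u\<close> and divergence
  \<open>(det g)\<^sup>-\<^sup>1\<^sup>/\<^sup>2 \<Sum>i. \<partial>\<^sub>i ((det g)\<^sup>1\<^sup>/\<^sup>2 X\<^sup>i)\<close>.\<close>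

definition riemannian_grad ::
    "(real^'n::finite \<Rightarrow> real^'n^'n) \<Rightarrow> (real^'n \<Rightarrow> real) \<Rightarrow> real^'n \<Rightarrow> real^'n" where
  "riemannian_grad g u x = matrix_inv (g x) *v (\<chi> j. partial_deriv j u x)"

definition riemannian_div ::
    "(real^'n::finite \<Rightarrow> real^'n^'n) \<Rightarrow> (real^'n \<Rightarrow> real^'n) \<Rightarrow> real^'n \<Rightarrow> real" where
  "riemannian_div g X x =
     (\<Sum>i\<in>UNIV. partial_deriv i (\<lambda>y. sqrt (det (g y)) * X y $ i) x) / sqrt (det (g x))"

definition laplace_beltrami ::
    "(real^'n::finite \<Rightarrow> real^'n^'n) \<Rightarrow> (real^'n \<Rightarrow> real) \<Rightarrow> real^'n \<Rightarrow> real" where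
  "laplace_beltrami g u = riemannian_div g (riemannian_grad g u)"

text \<open>\<open>M\<close> is a compact domain, \<open>\<nu>\<close> its outward unit normal field with respect to \<open>g\<close>.\<close>

definition steklov4_eigenvalue ::
    "(real^'n::finite \<Rightarrow> real^'n^'n) \<Rightarrow> (real^'n) set \<Rightarrow> (real^'n \<Rightarrow> real^'n) \<Rightarrow> real \<Rightarrow> bool" where
  "steklov4_eigenvalue g M \<nu> \<eta> \<longleftrightarrow>
     (\<exists>u. smooth_on M u \<and> (\<exists>x\<in>M. u x \<noteq> 0) \<and>
        (\<forall>x\<in>M. laplace_beltrami g (laplace_beltrami g u) x = 0) \<and>
        (\<forall>x\<in>frontier M. u x = 0) \<and>
        (\<forall>x\<in>frontier M. laplace_beltrami g u x = \<eta> * frechet_derivative u (at x) (\<nu> x)))"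

text \<open>The \<open>m\<close>-th element, counted from \<open>0\<close>, of a set of reals listed in increasing order.\<close>

definition nth_smallest :: "real set \<Rightarrow> nat \<Rightarrow> real" where
  "nth_smallest S m = (THE s. s \<in> S \<and> finite {t \<in> S. t < s} \<and> card {t \<in> S. t < s} = m)"

section \<open>Geodesic disks in the two-dimensional space forms\<close>

definition space_form_h :: "real \<Rightarrow> real \<Rightarrow> real" where
  "space_form_h K r =
     (if K > 0 then sin (sqrt K * r) / sqrt K
      else if K = 0 then r
      else sinh (sqrt (- K) * r) / sqrt (- K))"

definition space_form_r0 :: "real \<Rightarrow> ereal" where
  "space_form_r0 K = (if K > 0 then ereal (pi / sqrt K) else \<infinity>)"

text \<open>The metric \<open>dr\<^sup>2 + h\<^sub>K(r)\<^sup>2 d\<theta>\<^sup>2\<close> in the coordinates \<open>x = (r cos \<theta>, r sin \<theta>)\<close> (geodesic normal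
  coordinates at the pole), in which the smooth structure at the pole \<open>x = 0\<close> is the standard one.
  Radial vectors keep their Euclidean length and tangential vectors are scaled by \<open>h\<^sub>K(r) / r\<close>,
  which tends to \<open>1\<close> at the pole.\<close>

definition space_form_metric :: "real \<Rightarrow> real^2 \<Rightarrow> real^2^2" where
  "space_form_metric K x =
     (if x = 0 then mat 1
      else (\<chi> i j. x $ i * x $ j / (norm x)\<^sup>2 +
              (space_form_h K (norm x) / norm x)\<^sup>2 *
                ((if i = j then 1 else 0) - x $ i * x $ j / (norm x)\<^sup>2)))"

lemma norm_polar: "r > 0 \<Longrightarrow> norm (vector [r * cos \<theta>, r * sin \<theta>] :: real^2) = r"
proof -
  assume r: "r > 0"
  have "(r * cos \<theta>)\<^sup>2 + (r * sin \<theta>)\<^sup>2 = r\<^sup>2 * ((cos \<theta>)\<^sup>2 + (sin \<theta>)\<^sup>2)"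
    by (simp only: power_mult_distrib distrib_left)
  then show ?thesis
    using r by (simp add: norm_vec_def L2_set_def sum_2)
qed

text \<open>In polar coordinates, \<open>\<partial>\<^sub>r = (cos \<theta>, sin \<theta>)\<close> and \<open>\<partial>\<^sub>\<theta> = (- r sin \<theta>, r cos \<theta>)\<close> have the
  inner products prescribed by \<open>dr\<^sup>2 + h\<^sub>K(r)\<^sup>2 d\<theta>\<^sup>2\<close>.\<close>

lemma space_form_metric_polar:
  fixes K r \<theta> :: real
  assumes "r > 0"
  defines "x \<equiv> (vector [r * cos \<theta>, r * sin \<theta>] :: real^2)"
    and "dr \<equiv> (vector [cos \<theta>, sin \<theta>] :: real^2)"
    and "dt \<equiv> (vector [- r * sin \<theta>, r * cos \<theta>] :: real^2)"
  shows "dr \<bullet> (space_form_metric K x *v dr) = 1"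
    and "dr \<bullet> (space_form_metric K x *v dt) = 0"
    and "dt \<bullet> (space_form_metric K x *v dt) = (space_form_h K r)\<^sup>2"
proof -
  have nx: "norm x = r"
    using assms norm_polar by simp
  then have x0: "x \<noteq> 0" using assms by auto
  define h where "h = space_form_h K r"
  define c s where "c = cos \<theta>" and "s = sin \<theta>"
  have cs: "c\<^sup>2 = 1 - s\<^sup>2" by (simp add: c_def s_def cos_squared_eq)
  have g: "space_form_metric K x $ 1 $ 1 = c\<^sup>2 + (h / r)\<^sup>2 * s\<^sup>2"
    "space_form_metric K x $ 1 $ 2 = c * s - (h / r)\<^sup>2 * (c * s)"
    "space_form_metric K x $ 2 $ 1 = c * s - (h / r)\<^sup>2 * (c * s)"
    "space_form_metric K x $ 2 $ 2 = s\<^sup>2 + (h / r)\<^sup>2 * c\<^sup>2"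
    using x0 assms(1) cs unfolding space_form_metric_def
    by (simp_all add: nx h_def [symmetric])
       (simp_all add: x_def c_def [symmetric] s_def [symmetric] power2_eq_square)
  note d = dr_def dt_def c_def [symmetric] s_def [symmetric]
  have r: "r \<noteq> 0" using assms(1) by simp
  have c4: "c * c = 1 - s * s" using cs by (simp add: power2_eq_square)
  have "dr \<bullet> (space_form_metric K x *v dr) = (c\<^sup>2 + s\<^sup>2)\<^sup>2"
    unfolding d by (simp add: inner_vec_def matrix_vector_mult_def sum_2 g)
       (simp add: power2_eq_square algebra_simps)
  then show "dr \<bullet> (space_form_metric K x *v dr) = 1" by (simp add: cs)
  show "dr \<bullet> (space_form_metric K x *v dt) = 0"
    unfolding d by (simp add: inner_vec_def matrix_vector_mult_def sum_2 g)
       (simp add: power2_eq_square algebra_simps)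
  have "dt \<bullet> (space_form_metric K x *v dt) = r\<^sup>2 * (h / r)\<^sup>2 * (c\<^sup>2 + s\<^sup>2)\<^sup>2"
    unfolding d by (simp add: inner_vec_def matrix_vector_mult_def sum_2 g)
       (simp add: power2_eq_square algebra_simps)
  then show "dt \<bullet> (space_form_metric K x *v dt) = (space_form_h K r)\<^sup>2"
    using r by (simp add: cs power_divide h_def)
qed

text \<open>By the lemma above, \<open>\<partial>\<^sub>r = x / \<parallel>x\<parallel>\<close> is the outward unit normal of every disk
  \<open>{r \<le> R} = cball 0 R\<close> centred at the pole.\<close>

definition disk_spectrum :: "real \<Rightarrow> real \<Rightarrow> real set" where
  "disk_spectrum K R =
     {\<eta>. steklov4_eigenvalue (space_form_metric K) (cball 0 R) (\<lambda>x. x /\<^sub>R norm x) \<eta>}"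

definition disk_radius :: "real \<Rightarrow> real \<Rightarrow> real" where
  "disk_radius K A =
     (THE R. 0 < R \<and> ereal R < space_form_r0 K \<and> 2 * pi * integral {0..R} (space_form_h K) = A)"

definition eta_radius :: "nat \<Rightarrow> real \<Rightarrow> real \<Rightarrow> real" where
  "eta_radius m \<rho> K = nth_smallest (disk_spectrum K \<rho>) m"

definition eta_area :: "nat \<Rightarrow> real \<Rightarrow> real \<Rightarrow> real" where
  "eta_area m A K = nth_smallest (disk_spectrum K (disk_radius K A)) m"

end

(* Separating variables, a mode of frequency k satisfies Delta u = s^k cos(k t) with u = 0 on the
   boundary, where s = 2 h / (1 + c), c = h', is the conformal radius (s' = s/h, so s^k cos(k t) is
   harmonic).  Integrating (h u' - k u) s^k, whose derivative is h s^k times the k-th mode of Delta u,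
   gives the eigenvalue h(R) s(R)^(2k) / int_0^R h s^(2k), which increases strictly with k.

   The variable y = K s(R)^2 / 4, which runs through (-1, oo), removes the case distinction on the
   sign of K.  With J(y) = int_0^1 t^m / (1 + y t)^2 dt and L(y) = int_0^1 dt / (1 + y t^2), the
   eigenvalue is 2 / (s (1 + y) J) and R = s L, area = pi s^2 / (1 + y).  So the eigenvalue is a
   constant over (1 + y)^(3/2) J for fixed area and over (1 + y) J / L for fixed radius, and in both
   cases K is an increasing function of y.  The sign of the derivative of either function is that of
   t(y) / y for some t with y t' + (m + 1) t = r(y), where r is explicit and changes sign at most once
   on each side of 0 (for fixed radius this takes a second equation of the same kind);
   multiplying by the integrating factor |y|^m shows that t inherits the sign pattern of r, up to the
   value of t near the ends of the interval, which the limits of the functions decide. *)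
theory Submission
  imports Defs
begin

section \<open>Two parametric integrals\<close>

text \<open>Up to positive factors, t is y times the derivative of the profile, divided by the
  positive coefficient of J, so that J enters it only as the summand - J. Since y J' + (m + 1) J = 1
  / (1 + y)^2, the operator y d/dy + (m + 1) removes J altogether. What remains is rational in y for
  fixed area, and rational in y and L for fixed radius; L obeys an equation with exponent 1/2,
  whence the second comparison. The sign of 2 - m separates the cases for fixed area, the comparison
  of m (1 + y) L with 1 those for fixed radius. The equations are singular at y = 0, and this helps:
  |y|^N t vanishes there for N > 0 whatever t(0) is, so no initial value has to be computed. The
  spectral half must exhaust the spectrum. An arbitrary eigenfunction is projected on cos (n t) and
  sin (n t), regularity at the pole discards the singular radial solutions, and Stone-Weierstrass on
  the circle shows that some projection is nonzero. Conversely, smoothness of the separated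
  eigenfunctions at the pole comes from power series in r^2 and harmonic polynomials.\<close>

definition kint :: "nat \<Rightarrow> nat \<Rightarrow> real \<Rightarrow> real" where
  "kint m j y = integral {0..1} (\<lambda>t. t ^ m / (1 + y * t) ^ j)"

text \<open>This is arctan (sqrt y) / sqrt y for y > 0 and artanh (sqrt (- y)) / sqrt (- y) for y <
  0; the integral is smooth across y = 0 and avoids both square roots.\<close>

definition arctan_quot :: "real \<Rightarrow> real" where
  "arctan_quot y = integral {0..1} (\<lambda>t. 1 / (1 + y * t\<^sup>2))"

definition arctan_quot' :: "real \<Rightarrow> real" where
  "arctan_quot' y = - integral {0..1} (\<lambda>t. t\<^sup>2 / (1 + y * t\<^sup>2)\<^sup>2)"

lemma one_add_mult_pos:
  fixes y t :: real
  assumes "-1 < y" "0 \<le> t" "t \<le> 1"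
  shows "0 < 1 + y * t"
proof -
  have "y * t \<ge> - t" using mult_right_mono[of "-1" y t] assms by simp
  moreover have "y * t > -1" if "t = 1" using assms that by simp
  ultimately show ?thesis using assms by (cases "t = 1") auto
qed

lemma one_add_mult_sq_pos:
  fixes y t :: real
  assumes "-1 < y" "0 \<le> t" "t \<le> 1"
  shows "0 < 1 + y * t\<^sup>2"
  using one_add_mult_pos[of y "t\<^sup>2"] assms by (simp add: power_le_one)

lemma integral_fundamental:
  fixes f F :: "real \<Rightarrow> real"
  assumes "a \<le> b" "\<And>t. a \<le> t \<Longrightarrow> t \<le> b \<Longrightarrow> (F has_real_derivative f t) (at t)"
  shows "integral {a..b} f = F b - F a"
proof (rule integral_unique, rule fundamental_theorem_of_calculus[OF assms(1)])
  fix t assume "t \<in> {a..b}"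
  then show "(F has_vector_derivative f t) (at t within {a..b})"
    using assms(2)[of t] has_field_derivative_at_within
    unfolding has_real_derivative_iff_has_vector_derivative[symmetric] by auto
qed

text \<open>A zero integral would force a nonnegative continuous function to vanish identically.
  Positivity is asked at the right endpoint because \<open>t ^ m\<close> may vanish at 0.\<close>

lemma integral_strict_pos:
  fixes f :: "real \<Rightarrow> real"
  assumes "a < b" "continuous_on {a..b} f" "\<And>t. a \<le> t \<Longrightarrow> t \<le> b \<Longrightarrow> 0 \<le> f t" "f b > 0"
  shows "0 < integral {a..b} f"
proof -
  have "integral {a..b} f \<ge> 0"
    by (rule integral_nonneg) (use assms integrable_continuous_interval in auto)
  moreover have "integral {a..b} f \<noteq> 0"
    using integral_eq_0_iff[of a b f] assms by fastforce
  ultimately show ?thesis by simp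
qed

lemma kint_continuous: "-1 < y \<Longrightarrow> continuous_on {0..1} (\<lambda>t. t ^ m / (1 + y * t) ^ j)" for y :: real
  using one_add_mult_pos[of y] by (intro continuous_intros) force

lemma kint_pos: "-1 < y \<Longrightarrow> 0 < kint m j y"
  unfolding kint_def
  by (rule integral_strict_pos) (use kint_continuous one_add_mult_pos[of y] in \<open>auto simp: less_imp_le\<close>)

lemma deriv_inverse_power:
  fixes p :: "real \<Rightarrow> real"
  assumes "(p has_real_derivative p') (at x)" "p x \<noteq> 0"
  shows "((\<lambda>x. 1 / p x ^ j) has_real_derivative - real j * (p' / p x ^ Suc j)) (at x)"
proof -
  have "((\<lambda>x. inverse (p x) ^ j) has_real_derivative - real j * (p' * inverse (p x) ^ Suc j)) (at x)"
    \<comment> \<open>For \<open>j = 0\<close> the claim is the derivative of the constant 1; the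
      truncated \<open>j - 1\<close> matters only for \<open>j > 0\<close>.\<close>
    using DERIV_power_Suc[OF DERIV_inverse_fun[OF assms], of "j - 1"]
    by (cases j) (auto simp: algebra_simps)
  then show ?thesis by (simp add: divide_inverse power_inverse)
qed

text \<open>Differentiation under the integral sign. Both indices rise by one, so the family is
  closed under d/dy.\<close>

lemma kint_deriv:
  assumes "-1 < y"
  shows "(kint m j has_real_derivative - real j * kint (Suc m) (Suc j) y) (at y)"
proof -
  let ?g = "\<lambda>y t. - real j * (t ^ Suc m / (1 + y * t) ^ Suc j)"
  have p: "0 < 1 + x * t" if "x \<in> {-1<..}" "t \<in> cbox 0 1" for x t :: real
    using one_add_mult_pos[of x t] that by auto
  have "((\<lambda>y. integral (cbox 0 1) (\<lambda>t. t ^ m / (1 + y * t) ^ j)) has_field_derivative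
      integral (cbox 0 1) (?g y)) (at y within {-1<..})"
  proof (rule leibniz_rule_field_derivative)
    fix x t :: real assume a: "x \<in> {-1<..}" "t \<in> cbox 0 1"
    have "((\<lambda>x. t ^ m / (1 + x * t) ^ j) has_field_derivative ?g x t) (at x)"
    proof -
      have "((\<lambda>x. 1 + x * t) has_real_derivative t) (at x)"
        by (auto intro!: derivative_eq_intros)
      from DERIV_cmult[OF deriv_inverse_power[OF this, of j], of "t ^ m"] p[OF a]
      show ?thesis by (simp add: mult_ac)
    qed
    then show "((\<lambda>x. t ^ m / (1 + x * t) ^ j) has_field_derivative ?g x t) (at x within {-1<..})"
      by (rule has_field_derivative_at_within)
  next
    fix x :: real assume "x \<in> {-1<..}"
    then show "(\<lambda>t. t ^ m / (1 + x * t) ^ j) integrable_on cbox 0 1"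
      using kint_continuous by (auto intro: integrable_continuous_interval)
  next
    show "continuous_on ({-1<..} \<times> cbox 0 1) (\<lambda>(x, t). ?g x t)"
      unfolding case_prod_unfold
      by (intro continuous_intros) (use p in force)
  qed (use assms in auto)
  then show ?thesis
    using assms unfolding kint_def[abs_def] integral_mult_right
    by (simp add: at_within_open[of y "{-1<..}"])
qed

text \<open>Integrate the t-derivative of \<open>t ^ Suc m / (1 + y * t) ^ j\<close> over [0, 1].
  Together with \<open>kint_deriv\<close> this is a first-order equation for
  \<open>kint m j\<close>, with exponent m + 1.\<close>

lemma kint_ode:
  assumes "-1 < y"
  shows "real (Suc m) * kint m j y - real j * y * kint (Suc m) (Suc j) y = 1 / (1 + y) ^ j"
proof -
  let ?f = "\<lambda>t. real (Suc m) * (t ^ m / (1 + y * t) ^ j) - real j * y * (t ^ Suc m / (1 + y * t) ^ Suc j)"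
  have "integral {0..1} ?f = 1 ^ Suc m / (1 + y * 1) ^ j - 0 ^ Suc m / (1 + y * 0) ^ j"
  proof (rule integral_fundamental)
    fix t :: real assume "0 \<le> t" "t \<le> 1"
    then have "0 < 1 + y * t" using assms one_add_mult_pos by auto
    then have "((\<lambda>t. t ^ Suc m * (1 / (1 + y * t) ^ j)) has_real_derivative
        t ^ Suc m * (- real j * (y / (1 + y * t) ^ Suc j))
          + real (Suc m) * t ^ m * (1 / (1 + y * t) ^ j)) (at t)"
      using DERIV_power_Suc[OF DERIV_ident, of m t UNIV]
      by (intro DERIV_mult' deriv_inverse_power)
         (auto intro!: derivative_eq_intros simp del: power_Suc)
    then show "((\<lambda>t. t ^ Suc m / (1 + y * t) ^ j) has_real_derivative ?f t) (at t)"
      by (simp add: mult_ac)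
  qed simp
  moreover have "integral {0..1} ?f = real (Suc m) * kint m j y - real j * y * kint (Suc m) (Suc j) y"
    unfolding kint_def integral_mult_right[symmetric]
    by (rule integral_diff) (intro integrable_on_mult_right integrable_continuous_interval kint_continuous assms)+
  ultimately show ?thesis by simp
qed

text \<open>Write 1 = (1 + y t) - y t in the numerator of the right-hand side.\<close>

lemma kint_step:
  assumes "-1 < y"
  shows "kint m j y - y * kint (Suc m) (Suc j) y = kint m (Suc j) y"
proof -
  have "kint m j y - y * kint (Suc m) (Suc j) y
      = integral {0..1} (\<lambda>t. t ^ m / (1 + y * t) ^ j - y * (t ^ Suc m / (1 + y * t) ^ Suc j))"
    unfolding kint_def integral_mult_right[symmetric]
    by (rule integral_diff[symmetric])
       (intro integrable_on_mult_right integrable_continuous_interval kint_continuous assms)+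
  also have "\<dots> = kint m (Suc j) y"
    unfolding kint_def
  proof (rule integral_cong)
    fix t :: real assume "t \<in> {0..1}"
    then have "0 < 1 + y * t" using assms one_add_mult_pos by auto
    then have "t ^ m / (1 + y * t) ^ j = (1 + y * t) * t ^ m / (1 + y * t) ^ Suc j"
      by simp
    then show "t ^ m / (1 + y * t) ^ j - y * (t ^ Suc m / (1 + y * t) ^ Suc j) = t ^ m / (1 + y * t) ^ Suc j"
      by (simp only: diff_divide_distrib[symmetric] times_divide_eq_right) (simp add: algebra_simps)
  qed
  finally show ?thesis .
qed

lemma arctan_quot_continuous: "-1 < y \<Longrightarrow> continuous_on {0..1} (\<lambda>t. 1 / (1 + y * t\<^sup>2))" for y :: real
  using one_add_mult_sq_pos[of y] by (intro continuous_intros) force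

lemma arctan_quot'_continuous: "-1 < y \<Longrightarrow> continuous_on {0..1} (\<lambda>t. t\<^sup>2 / (1 + y * t\<^sup>2)\<^sup>2)" for y :: real
  using one_add_mult_sq_pos[of y] by (intro continuous_intros) force

lemma arctan_quot_pos: "-1 < y \<Longrightarrow> 0 < arctan_quot y"
  unfolding arctan_quot_def
  by (rule integral_strict_pos) (use arctan_quot_continuous one_add_mult_sq_pos[of y] in \<open>auto simp: less_imp_le\<close>)

lemma arctan_quot_0: "arctan_quot 0 = 1"
  by (simp add: arctan_quot_def)

lemma arctan_quot_deriv:
  assumes "-1 < y"
  shows "(arctan_quot has_real_derivative arctan_quot' y) (at y)"
proof -
  let ?g = "\<lambda>y t :: real. - (t\<^sup>2 / (1 + y * t\<^sup>2)\<^sup>2)"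
  have p: "0 < 1 + x * t\<^sup>2" if "x \<in> {-1<..}" "t \<in> cbox 0 1" for x t :: real
    using one_add_mult_sq_pos[of x t] that by auto
  have "((\<lambda>y. integral (cbox 0 1) (\<lambda>t. 1 / (1 + y * t\<^sup>2))) has_field_derivative
      integral (cbox 0 1) (?g y)) (at y within {-1<..})"
  proof (rule leibniz_rule_field_derivative)
    fix x t :: real assume a: "x \<in> {-1<..}" "t \<in> cbox 0 1"
    have "((\<lambda>x. 1 / (1 + x * t\<^sup>2)) has_field_derivative ?g x t) (at x)"
      using p[OF a] by (auto intro!: derivative_eq_intros simp: field_simps power2_eq_square)
    then show "((\<lambda>x. 1 / (1 + x * t\<^sup>2)) has_field_derivative ?g x t) (at x within {-1<..})"
      by (rule has_field_derivative_at_within)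
  next
    fix x :: real assume "x \<in> {-1<..}"
    then show "(\<lambda>t. 1 / (1 + x * t\<^sup>2)) integrable_on cbox 0 1"
      using arctan_quot_continuous by (auto intro: integrable_continuous_interval)
  next
    have "1 + fst z * (snd z)\<^sup>2 \<noteq> 0" if "z \<in> {-1<..} \<times> cbox 0 1" for z :: "real \<times> real"
      using p[of "fst z" "snd z"] that by (auto simp: mem_Times_iff)
    then show "continuous_on ({-1<..} \<times> cbox 0 1) (\<lambda>(x, t). ?g x t)"
      unfolding case_prod_unfold
      by (intro continuous_on_minus continuous_on_divide continuous_intros) auto
  qed (use assms in auto)
  then show ?thesis
    using assms unfolding arctan_quot_def[abs_def] arctan_quot'_def
    by (simp add: at_within_open[of y "{-1<..}"])
qed

text \<open>The integral over [0, 1] of the t-derivative of \<open>t / (1 + y * t\<^sup>2)\<close>.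
  The exponent of the resulting equation is 1/2.\<close>

lemma arctan_quot_ode:
  assumes "-1 < y"
  shows "arctan_quot y + 2 * y * arctan_quot' y = 1 / (1 + y)"
proof -
  let ?f = "\<lambda>t. 1 / (1 + y * t\<^sup>2) - 2 * y * (t\<^sup>2 / (1 + y * t\<^sup>2)\<^sup>2)"
  have "integral {0..1} ?f = 1 / (1 + y * 1\<^sup>2) - 0 / (1 + y * 0\<^sup>2)"
  proof (rule integral_fundamental)
    fix t :: real assume "0 \<le> t" "t \<le> 1"
    then have "0 < 1 + y * t\<^sup>2" using assms one_add_mult_sq_pos by auto
    then have z: "1 + y * t\<^sup>2 \<noteq> 0" by simp
    have "((\<lambda>t. t / (1 + y * t\<^sup>2)) has_real_derivative
        (1 * (1 + y * t\<^sup>2) - t * (2 * y * t)) / (1 + y * t\<^sup>2)\<^sup>2) (at t)"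
      using z by (auto intro!: derivative_eq_intros simp: power2_eq_square)
    also have "(1 * (1 + y * t\<^sup>2) - t * (2 * y * t)) / (1 + y * t\<^sup>2)\<^sup>2 = ?f t"
      using z by (simp add: diff_divide_distrib) (simp add: power2_eq_square)
    finally show "((\<lambda>t. t / (1 + y * t\<^sup>2)) has_real_derivative ?f t) (at t)" .
  qed simp
  moreover have "integral {0..1} ?f = arctan_quot y + 2 * y * arctan_quot' y"
  proof -
    have "integral {0..1} ?f = integral {0..1} (\<lambda>t. 1 / (1 + y * t\<^sup>2))
        - integral {0..1} (\<lambda>t. 2 * y * (t\<^sup>2 / (1 + y * t\<^sup>2)\<^sup>2))"
      by (rule integral_diff)
         (intro integrable_on_mult_right integrable_continuous_interval arctan_quot_continuous
            arctan_quot'_continuous assms)+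
    then show ?thesis unfolding arctan_quot_def arctan_quot'_def integral_mult_right by simp
  qed
  ultimately show ?thesis by simp
qed

section \<open>Unimodality, and propagation of signs through y f' + N f = r\<close>

definition unimodal :: "(real \<Rightarrow> real) \<Rightarrow> real \<Rightarrow> bool" where
  "unimodal f a \<longleftrightarrow> strict_mono_on {-1<..<a} f \<and> strict_antimono_on {a<..} f"

text \<open>The sign formulas for the profiles determine y times the derivative and so say nothing
  at y = 0. One exceptional point does no harm: split the interval there.\<close>

lemma deriv_pos_except_imp_less:
  fixes f :: "real \<Rightarrow> real"
  assumes "x < y" "\<And>t. x \<le> t \<Longrightarrow> t \<le> y \<Longrightarrow> (f has_real_derivative f' t) (at t)"
    "\<And>t. x < t \<Longrightarrow> t < y \<Longrightarrow> t \<noteq> z \<Longrightarrow> 0 < f' t"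
  shows "f x < f y"
proof -
  have c: "f u < f v" if "x \<le> u" "u < v" "v \<le> y" "z \<notin> {u<..<v}" for u v
  proof (rule DERIV_pos_imp_increasing_open[OF that(2)])
    fix t assume "u < t" "t < v"
    then show "\<exists>y. (f has_real_derivative y) (at t) \<and> 0 < y"
      using assms(2,3)[of t] that by force
  next
    show "continuous_on {u..v} f"
      by (rule DERIV_atLeastAtMost_imp_continuous_on) (use assms(2) that in \<open>meson order_trans\<close>)
  qed
  show ?thesis
  proof (cases "z \<in> {x<..<y}")
    case True
    then have "f x < f z" "f z < f y" by (auto intro!: c)
    then show ?thesis by simp
  qed (use c assms(1) in simp)
qed

text \<open>The profiles are reciprocal to the eigenvalues, hence increase before they decrease. The
  turning point \<open>a\<close> is left out of both intervals, as in the final statement, and the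
  exempt point 0 may lie on either side of it.\<close>

lemma unimodalI:
  assumes "\<And>y. -1 < y \<Longrightarrow> (f has_real_derivative f' y) (at y)" "-1 < a"
    "\<And>y. -1 < y \<Longrightarrow> y < a \<Longrightarrow> y \<noteq> 0 \<Longrightarrow> 0 < f' y"
    "\<And>y. a < y \<Longrightarrow> y \<noteq> 0 \<Longrightarrow> f' y < 0"
  shows "unimodal f a"
  unfolding unimodal_def
proof
  show "strict_mono_on {-1<..<a} f"
  proof (rule strict_mono_onI)
    fix r s assume "r \<in> {-1<..<a}" "s \<in> {-1<..<a}" "r < s"
    then show "f r < f s"
      using deriv_pos_except_imp_less[of r s f f' 0] assms by auto
  qed
  show "strict_antimono_on {a<..} f"
  proof (rule monotone_onI)
    fix r s assume *: "r \<in> {a<..}" "s \<in> {a<..}" "r < s"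
    have "- f r < - f s"
      by (rule deriv_pos_except_imp_less[where z = 0 and f' = "\<lambda>y. - f' y"])
         (use * assms in \<open>auto intro!: DERIV_minus\<close>)
    then show "f r > f s" by simp
  qed
qed

text \<open>(t^N F)' = t^(N - 1) (t F' + N F) = t^(N - 1) r. The left end may be 0: only continuity
  is used there, and t^N extends by 0 because N > 0.\<close>

lemma euler_ode_mono:
  fixes F r :: "real \<Rightarrow> real"
  assumes "0 \<le> c" "c < d" "0 < N" "continuous_on {c..d} F"
    "\<And>t. c < t \<Longrightarrow> t < d \<Longrightarrow> (F has_real_derivative F' t) (at t)"
    "\<And>t. c < t \<Longrightarrow> t < d \<Longrightarrow> t * F' t + N * F t = r t"
    "\<And>t. c < t \<Longrightarrow> t < d \<Longrightarrow> 0 < r t"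
  shows "c powr N * F c < d powr N * F d"
proof (rule DERIV_pos_imp_increasing_open[OF assms(2)])
  fix t assume t: "c < t" "t < d"
  have "((\<lambda>t. t powr N * F t) has_real_derivative
      t powr N * F' t + (N * t powr (N - 1)) * F t) (at t)"
    using assms(1) t by (intro DERIV_mult' assms(5) has_real_derivative_powr) auto
  also have "t powr N * F' t + (N * t powr (N - 1)) * F t = t powr (N - 1) * r t"
  proof -
    have "t powr N = t * t powr (N - 1)"
      using powr_mult_base[of t "N - 1"] assms(1) t by simp
    then show ?thesis
      by (simp add: assms(6)[OF t, symmetric] algebra_simps)
  qed
  finally show "\<exists>y. ((\<lambda>t. t powr N * F t) has_real_derivative y) (at t) \<and> 0 < y"
    using assms(1,7) t by (intro exI[of _ "t powr (N - 1) * r t"]) auto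
next
  show "continuous_on {c..d} (\<lambda>t. t powr N * F t)"
    using assms by (intro continuous_intros continuous_on_powr') auto
qed

lemma euler_ode_pos:
  fixes F r :: "real \<Rightarrow> real"
  assumes "0 < d" "0 < N" "continuous_on {0..d} F"
    "\<And>t. 0 < t \<Longrightarrow> t < d \<Longrightarrow> (F has_real_derivative F' t) (at t)"
    "\<And>t. 0 < t \<Longrightarrow> t < d \<Longrightarrow> t * F' t + N * F t = r t"
    "\<And>t. 0 < t \<Longrightarrow> t < d \<Longrightarrow> 0 < r t"
  shows "0 < F d"
proof -
  \<comment> \<open>Since \<open>0 powr N\<close> is 0, the left side vanishes whatever
    \<open>F 0\<close> is.\<close>
  have "0 powr N * F 0 < d powr N * F d"
    by (rule euler_ode_mono[where F' = F' and r = r]) (use assms in auto)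
  then show ?thesis using assms(1) by (simp add: zero_less_mult_iff)
qed

text \<open>Up to c the weighted function t^N F falls from 0, so F < 0; beyond c it rises and
  crosses zero at most once, and \<open>t1\<close> guarantees a crossing. \<open>I\<close> is an
  initial segment of the positive axis, to cover both the half-line and the reflected interval (0,
  1).\<close>

lemma euler_ode_sign_change:
  fixes F r :: "real \<Rightarrow> real"
  assumes I: "\<And>t. t \<in> I \<Longrightarrow> 0 < t" "\<And>s t. t \<in> I \<Longrightarrow> 0 < s \<Longrightarrow> s \<le> t \<Longrightarrow> s \<in> I"
    and "0 < c" "0 < N" "continuous_on (insert 0 I) F"
    and D: "\<And>t. t \<in> I \<Longrightarrow> (F has_real_derivative F' t) (at t)"
    and E: "\<And>t. t \<in> I \<Longrightarrow> t * F' t + N * F t = r t"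
    and neg: "\<And>t. t \<in> I \<Longrightarrow> t < c \<Longrightarrow> r t < 0"
    and pos: "\<And>t. t \<in> I \<Longrightarrow> c < t \<Longrightarrow> 0 < r t"
    and t1: "t1 \<in> I" "0 \<le> F t1"
  obtains a where "a \<in> I" "\<And>t. t \<in> I \<Longrightarrow> t < a \<Longrightarrow> F t < 0" "\<And>t. t \<in> I \<Longrightarrow> a < t \<Longrightarrow> 0 < F t"
proof -
  have cont: "continuous_on {0..d} F" if "d \<in> I" for d
  proof (rule continuous_on_subset[OF assms(5)], rule subsetI)
    fix t assume "t \<in> {0..d}"
    then show "t \<in> insert 0 I" using I(2)[OF that, of t] by (cases "t = 0") auto
  qed
  have below: "F t < 0" if "t \<in> I" "t \<le> c" for t
  proof -
    have "0 < - F t"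
    proof (rule euler_ode_pos[where F = "\<lambda>t. - F t" and F' = "\<lambda>t. - F' t" and r = "\<lambda>t. - r t" and N = N])
      fix s assume "0 < s" "s < t"
      then have s: "s \<in> I" "s < c" using that(2) I(2)[OF that(1), of s] by auto
      show "((\<lambda>t. - F t) has_real_derivative - F' s) (at s)" using D s by (auto intro: DERIV_minus)
      show "s * - F' s + N * - F s = - r s" using E[OF s(1)] by simp
      show "0 < - r s" using neg s by simp
    next
      show "continuous_on {0..t} (\<lambda>t. - F t)"
        by (intro continuous_on_minus cont that(1))
    qed (use I(1)[OF that(1)] \<open>0 < N\<close> in auto)
    then show ?thesis by simp
  qed
  have t1c: "c < t1" using below[OF t1(1)] t1(2) by fastforce
  have cI: "c \<in> I" using I(2)[OF t1(1) \<open>0 < c\<close>] t1c by simp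
  have "\<exists>a. c \<le> a \<and> a \<le> t1 \<and> F a = 0"
  proof (rule IVT')
    show "continuous_on {c..t1} F"
      by (rule continuous_on_subset[OF cont[OF t1(1)]]) (use \<open>0 < c\<close> in auto)
  qed (use below[OF cI] t1(2) t1c in auto)
  then obtain a where a: "c \<le> a" "a \<le> t1" "F a = 0" by blast
  have aI: "a \<in> I" using I(2)[OF t1(1)] a \<open>0 < c\<close> by auto
  have mono: "s powr N * F s < t powr N * F t" if "s < t" "c \<le> s" "t \<in> I" for s t
  proof (rule euler_ode_mono[where F' = F' and r = r])
    fix w assume "s < w" "w < t"
    then have w: "w \<in> I" "c < w" using that I(2)[OF that(3), of w] \<open>0 < c\<close> by auto
    show "(F has_real_derivative F' w) (at w)" "w * F' w + N * F w = r w" "0 < r w"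
      using D E pos w by auto
  next
    show "continuous_on {s..t} F"
      by (rule continuous_on_subset[OF cont[OF that(3)]]) (use that(2) \<open>0 < c\<close> in auto)
  qed (use that(1,2) \<open>0 < c\<close> \<open>0 < N\<close> in auto)
  show ?thesis
  proof
    show "a \<in> I" by fact
    show "F t < 0" if "t \<in> I" "t < a" for t
    proof (cases "t \<le> c")
      case False
      then have "t powr N * F t < 0" using mono[of t a] that aI a by simp
      then show ?thesis using I(1)[OF that(1)] by (simp add: mult_less_0_iff)
    qed (use below that in auto)
    show "0 < F t" if "t \<in> I" "a < t" for t
    proof -
      have "0 < t powr N * F t" using mono[of a t] that a by simp
      then show ?thesis using I(1)[OF that(1)] by (simp add: zero_less_mult_iff)
    qed
  qed
qed

text \<open>The derivative stays existential because only the combination y f' + N f is ever used.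
  No initial value is attached.\<close>

definition euler_ode :: "real \<Rightarrow> (real \<Rightarrow> real) \<Rightarrow> (real \<Rightarrow> real) \<Rightarrow> bool" where
  "euler_ode N f r \<longleftrightarrow> 0 < N \<and>
     (\<forall>y>-1. \<exists>f'. (f has_real_derivative f') (at y) \<and> y * f' + N * f y = r y)"

lemma euler_odeE:
  assumes "euler_ode N f r"
  obtains f' where "\<And>y. -1 < y \<Longrightarrow> (f has_real_derivative f' y) (at y)"
    "\<And>y. -1 < y \<Longrightarrow> y * f' y + N * f y = r y" "0 < N"
  using assms unfolding euler_ode_def by metis

lemma euler_ode_uminus:
  assumes "euler_ode N f r" shows "euler_ode N (\<lambda>y. - f y) (\<lambda>y. - r y)"
proof -
  obtain f' where f': "\<And>y. -1 < y \<Longrightarrow> (f has_real_derivative f' y) (at y)"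
    "\<And>y. -1 < y \<Longrightarrow> y * f' y + N * f y = r y" "0 < N"
    using euler_odeE[OF assms] by blast
  have "((\<lambda>y. - f y) has_real_derivative - f' y) (at y) \<and> y * - f' y + N * - f y = - r y" if "-1 < y" for y
    using f'(1)[OF that] f'(2)[OF that] by (auto intro: DERIV_minus)
  then show ?thesis using f'(3) unfolding euler_ode_def by blast
qed

lemma euler_ode_continuous: "euler_ode N f r \<Longrightarrow> continuous_on {-1<..} f"
  unfolding euler_ode_def by (force intro!: continuous_at_imp_continuous_on dest: DERIV_isCont)

lemma DERIV_reflect: "(f has_real_derivative d) (at (- t)) \<Longrightarrow> ((\<lambda>t. f (- t)) has_real_derivative - d) (at t)"
  for t :: real
  by (rule DERIV_cong[OF DERIV_chain2[OF _ DERIV_minus[OF DERIV_ident]]]) auto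

lemma euler_ode_pos_right:
  assumes "euler_ode N f r" "0 < d" "\<And>t. 0 < t \<Longrightarrow> t < d \<Longrightarrow> 0 < r t"
  shows "0 < f d"
proof -
  obtain f' where f': "\<And>y. -1 < y \<Longrightarrow> (f has_real_derivative f' y) (at y)"
    "\<And>y. -1 < y \<Longrightarrow> y * f' y + N * f y = r y" "0 < N"
    using euler_odeE[OF assms(1)] by blast
  show ?thesis
    by (rule euler_ode_pos[where F' = f' and r = r and N = N])
       (use f' assms in \<open>auto intro: continuous_on_subset[OF euler_ode_continuous[OF assms(1)]]\<close>)
qed

text \<open>The operator t d/dt is invariant under t -> - t, so the reflected function solves the
  reflected equation with the same N.\<close>

lemma euler_ode_pos_left:
  assumes "euler_ode N f r" "-1 < d" "d < 0" "\<And>t. d < t \<Longrightarrow> t < 0 \<Longrightarrow> 0 < r t"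
  shows "0 < f d"
proof -
  obtain f' where f': "\<And>y. -1 < y \<Longrightarrow> (f has_real_derivative f' y) (at y)"
    "\<And>y. -1 < y \<Longrightarrow> y * f' y + N * f y = r y" "0 < N"
    using euler_odeE[OF assms(1)] by blast
  have "0 < f (- (- d))"
  proof (rule euler_ode_pos[where F = "\<lambda>t. f (- t)" and F' = "\<lambda>t. - f' (- t)" and r = "\<lambda>t. r (- t)" and N = N])
    show "continuous_on {0..- d} (\<lambda>t. f (- t))"
      by (rule continuous_on_compose2[OF euler_ode_continuous[OF assms(1)]])
         (use assms in \<open>auto intro: continuous_intros\<close>)
  next
    fix t assume "0 < t" "t < - d"
    then show "((\<lambda>t. f (- t)) has_real_derivative - f' (- t)) (at t)"
      "t * - f' (- t) + N * f (- t) = r (- t)" "0 < r (- t)"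
      using f'(1)[of "- t"] f'(2)[of "- t"] assms(2,4) by (auto intro: DERIV_reflect)
  qed (use assms f' in auto)
  then show ?thesis by simp
qed

lemma euler_ode_sign_change_right:
  assumes "euler_ode N f r" "0 < c" "\<And>t. 0 < t \<Longrightarrow> t < c \<Longrightarrow> r t < 0" "\<And>t. c < t \<Longrightarrow> 0 < r t"
    "0 < y1" "0 \<le> f y1"
  obtains a where "0 < a" "\<And>y. 0 < y \<Longrightarrow> y < a \<Longrightarrow> f y < 0" "\<And>y. a < y \<Longrightarrow> 0 < f y"
proof -
  obtain f' where f': "\<And>y. -1 < y \<Longrightarrow> (f has_real_derivative f' y) (at y)"
    "\<And>y. -1 < y \<Longrightarrow> y * f' y + N * f y = r y" "0 < N"
    using euler_odeE[OF assms(1)] by blast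
  show ?thesis
  proof (rule euler_ode_sign_change[where F = f and F' = f' and r = r and N = N and I = "{0<..}" and c = c and ?t1.0 = y1])
    show "continuous_on (insert 0 {0<..}) f"
      by (rule continuous_on_subset[OF euler_ode_continuous[OF assms(1)]]) auto
  next
    fix a :: real
    assume "a \<in> {0<..}" "\<And>t. t \<in> {0<..} \<Longrightarrow> t < a \<Longrightarrow> f t < 0" "\<And>t. t \<in> {0<..} \<Longrightarrow> a < t \<Longrightarrow> 0 < f t"
    then show ?thesis using that[of a] by force
  qed (use f' assms in auto)
qed

text \<open>The same reflection: seen from 0 towards -1, the right-hand side turns from negative to
  positive at c.\<close>

lemma euler_ode_sign_change_left:
  assumes "euler_ode N f r" "c < 0" "\<And>t. -1 < t \<Longrightarrow> t < 0 \<Longrightarrow> c < t \<Longrightarrow> r t < 0"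
    "\<And>t. -1 < t \<Longrightarrow> t < c \<Longrightarrow> 0 < r t" "-1 < y1" "y1 < 0" "0 \<le> f y1"
  obtains a where "-1 < a" "a < 0" "\<And>y. a < y \<Longrightarrow> y < 0 \<Longrightarrow> f y < 0" "\<And>y. -1 < y \<Longrightarrow> y < a \<Longrightarrow> 0 < f y"
proof -
  obtain f' where f': "\<And>y. -1 < y \<Longrightarrow> (f has_real_derivative f' y) (at y)"
    "\<And>y. -1 < y \<Longrightarrow> y * f' y + N * f y = r y" "0 < N"
    using euler_odeE[OF assms(1)] by blast
  show ?thesis
  proof (rule euler_ode_sign_change[where F = "\<lambda>t. f (- t)" and F' = "\<lambda>t. - f' (- t)"
        and r = "\<lambda>t. r (- t)" and N = N and I = "{0<..<1}" and c = "- c" and ?t1.0 = "- y1"])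
    show "continuous_on (insert 0 {0<..<1}) (\<lambda>t. f (- t))"
      by (rule continuous_on_compose2[OF euler_ode_continuous[OF assms(1)]])
         (auto intro: continuous_intros)
  next
    fix t :: real assume "t \<in> {0<..<1}"
    then show "((\<lambda>t. f (- t)) has_real_derivative - f' (- t)) (at t)"
      "t * - f' (- t) + N * f (- t) = r (- t)"
      using f'(1)[of "- t"] f'(2)[of "- t"] by (auto intro: DERIV_reflect)
  next
    fix a :: real
    assume a: "a \<in> {0<..<1}" "\<And>t. t \<in> {0<..<1} \<Longrightarrow> t < a \<Longrightarrow> f (- t) < 0"
      "\<And>t. t \<in> {0<..<1} \<Longrightarrow> a < t \<Longrightarrow> 0 < f (- t)"
    show ?thesis
    proof (rule that[of "- a"])
      show "f y < 0" if "- a < y" "y < 0" for y using a(2)[of "- y"] a(1) that by auto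
      show "0 < f y" if "-1 < y" "y < - a" for y using a(3)[of "- y"] a(1) that by auto
    qed (use a in auto)
  qed (use f'(3) assms in auto)
qed

section \<open>Closed forms and bounds for the integrals\<close>

lemma kint_le: "-1 < y \<Longrightarrow> kint m j y \<le> kint 0 j y"
  unfolding kint_def
  by (rule integral_le; (intro integrable_continuous_interval kint_continuous)?)
     (use one_add_mult_pos[of y] in \<open>auto intro!: divide_right_mono power_le_one simp: less_imp_le\<close>)

lemma kint_0_2: "-1 < y \<Longrightarrow> kint 0 2 y = 1 / (1 + y)"
  using kint_ode[of y 0 1] kint_step[of y 0 1] by (simp add: numeral_2_eq_2)

lemma kint_0_1:
  assumes "-1 < y" "y \<noteq> 0"
  shows "kint 0 1 y = ln (1 + y) / y"
proof -
  have "integral {0..1} (\<lambda>t. t ^ 0 / (1 + y * t) ^ 1) = ln (1 + y * 1) / y - ln (1 + y * 0) / y"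
  proof (rule integral_fundamental)
    fix t :: real assume "0 \<le> t" "t \<le> 1"
    then have "0 < 1 + y * t" using assms one_add_mult_pos by auto
    then show "((\<lambda>t. ln (1 + y * t) / y) has_real_derivative t ^ 0 / (1 + y * t) ^ 1) (at t)"
      using assms by (auto intro!: derivative_eq_intros)
  qed simp
  then show ?thesis by (simp add: kint_def)
qed

text \<open>The case j = 2. The second part trades y J' for J, which is how J' is eliminated from
  all later derivatives.\<close>

lemma kint_2_deriv:
  assumes "-1 < y"
  shows "(kint m 2 has_real_derivative - 2 * kint (Suc m) 3 y) (at y)"
    and "y * (- 2 * kint (Suc m) 3 y) = 1 / (1 + y)\<^sup>2 - real (Suc m) * kint m 2 y"
  using kint_deriv[OF assms, of m 2] kint_ode[OF assms, of m 2]
  by (simp_all add: numeral_3_eq_3 numeral_2_eq_2)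

subsection \<open>Disks of fixed area\<close>

text \<open>The power 3/2 of 1 + y: one factor 1 + y stands in the eigenvalue formula, and s = sqrt
  (A (1 + y) / pi) supplies the square root.\<close>

definition area_profile :: "nat \<Rightarrow> real \<Rightarrow> real" where
  "area_profile m y = sqrt (1 + y) * (1 + y) * kint m 2 y"

text \<open>With q = m + 1 + (m - 1/2) y, the derivative of the profile times y is sqrt (1 + y)
  times 1 / (1 + y) - q J; dividing the latter by q > 0 isolates - J.\<close>

definition area_sign :: "nat \<Rightarrow> real \<Rightarrow> real" where
  "area_sign m y = 1 / ((1 + y) * (real m + 1 + (real m - 1/2) * y)) - kint m 2 y"

text \<open>The numerator has the roots 0 and (2 - m) / (m - 1/2). The second is 2 for m = 1, 0 for
  m = 2 and negative for m >= 3: this is the trichotomy for fixed area.\<close>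

definition area_rhs :: "nat \<Rightarrow> real \<Rightarrow> real" where
  "area_rhs m y = y * ((1 - real m / 2) - (real m - 1/2) / 2 * y)
     / ((1 + y) * (real m + 1 + (real m - 1/2) * y))\<^sup>2"

text \<open>An affine function of y with positive slope and the value 3/2 at y = -1.\<close>

lemma area_denom_pos:
  fixes y :: real
  assumes "1 \<le> m" "-1 < y"
  shows "0 < real m + 1 + (real m - 1/2) * y"
proof -
  have "(real m - 1/2) * (-1) < (real m - 1/2) * y"
    by (rule mult_strict_left_mono) (use assms in auto)
  then show ?thesis by simp
qed

lemma area_sign_ode:
  assumes "1 \<le> m"
  shows "euler_ode (real m + 1) (area_sign m) (area_rhs m)"
  unfolding euler_ode_def
proof (intro conjI allI impI)
  fix y :: real assume y: "-1 < y"
  define a b q where "a = real m + 1" and "b = real m - 1/2" and "q = a + b * y"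
  have q: "0 < q" using area_denom_pos[OF assms y] by (simp add: q_def a_def b_def)
  let ?d = "- ((a + b + 2 * b * y) / ((1 + y) * q)\<^sup>2) - (- 2 * kint (Suc m) 3 y)"
  have "(area_sign m has_real_derivative ?d) (at y)"
    unfolding area_sign_def[abs_def] a_def[symmetric] b_def[symmetric]
  proof (rule DERIV_diff[OF _ kint_2_deriv(1)[OF y]])
    have "(((\<lambda>y. (1 + y) * (a + b * y))) has_real_derivative (a + b + 2 * b * y)) (at y)"
      by (auto intro!: derivative_eq_intros simp: algebra_simps)
    from DERIV_inverse_fun[OF this]
    show "((\<lambda>y. 1 / ((1 + y) * (a + b * y))) has_real_derivative - ((a + b + 2 * b * y) / ((1 + y) * q)\<^sup>2)) (at y)"
      using y q unfolding q_def by (auto simp: divide_inverse power2_eq_square mult_ac)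
  qed
  moreover have "y * ?d + (real m + 1) * area_sign m y = area_rhs m y"
  proof -
    have "y * ?d + (real m + 1) * area_sign m y
       = - (y * (a + b + 2 * b * y) / ((1 + y) * q)\<^sup>2) + a / ((1 + y) * q) - 1 / (1 + y)\<^sup>2"
      using kint_2_deriv(2)[OF y, of m]
      by (simp add: area_sign_def algebra_simps a_def[symmetric] b_def[symmetric] q_def add_divide_distrib)
         (simp add: a_def algebra_simps add_divide_distrib diff_divide_distrib)
    also have "\<dots> = (- (y * (a + b + 2 * b * y)) + a * (1 + y) * q - q\<^sup>2) / ((1 + y) * q)\<^sup>2"
      using y q by (simp add: divide_simps) (simp add: power2_eq_square algebra_simps)
    \<comment> \<open>Here a - b = 3/2, so a (1 + y) q - q^2 = (3/2) y q, and a factor y splits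
      off.\<close>
    also have "- (y * (a + b + 2 * b * y)) + a * (1 + y) * q - q\<^sup>2
        = y * ((1 - real m / 2) - (real m - 1/2) / 2 * y)"
      by (simp add: q_def a_def b_def power2_eq_square field_simps)
    finally show ?thesis by (simp add: area_rhs_def q_def a_def b_def)
  qed
  ultimately show "\<exists>f'. (area_sign m has_real_derivative f') (at y)
      \<and> y * f' + (real m + 1) * area_sign m y = area_rhs m y" by blast
qed auto

lemma area_profile_deriv:
  assumes "-1 < y"
  shows "(area_profile m has_real_derivative
     sqrt (1 + y) * (3 / 2 * kint m 2 y + (1 + y) * (- 2 * kint (Suc m) 3 y))) (at y)"
proof -
  have s: "((\<lambda>y. sqrt (1 + y) * (1 + y)) has_real_derivative 3 / 2 * sqrt (1 + y)) (at y)"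
    using assms real_sqrt_mult_self[of "1 + y"]
    by (auto intro!: derivative_eq_intros simp: field_simps power2_eq_square simp del: real_sqrt_mult_self)
  show ?thesis
    unfolding area_profile_def[abs_def]
    by (rule DERIV_cong[OF DERIV_mult'[OF s kint_2_deriv(1)[OF assms]]]) (simp add: algebra_simps)
qed

lemma area_profile_deriv_sign:
  assumes "-1 < y" "1 \<le> m"
  shows "y * (3 / 2 * kint m 2 y + (1 + y) * (- 2 * kint (Suc m) 3 y))
     = (real m + 1 + (real m - 1/2) * y) * area_sign m y"
proof -
  define q where "q = real m + 1 + (real m - 1/2) * y"
  have q: "0 < q" using area_denom_pos[OF assms(2,1)] by (simp add: q_def)
  have "y * (3 / 2 * kint m 2 y + (1 + y) * (- 2 * kint (Suc m) 3 y))
     = 3 / 2 * y * kint m 2 y + (1 + y) * (1 / (1 + y)\<^sup>2 - real (Suc m) * kint m 2 y)"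
    unfolding kint_2_deriv(2)[OF assms(1), symmetric] by (simp add: algebra_simps)
  also have "\<dots> = 1 / (1 + y) - q * kint m 2 y"
    using assms by (simp add: q_def right_diff_distrib power2_eq_square) (simp add: field_simps)
  also have "\<dots> = q * area_sign m y"
    using q assms by (simp add: area_sign_def q_def[symmetric] right_diff_distrib)
  finally show ?thesis by (simp add: q_def)
qed

text \<open>For y different from 0, \<open>sgn y\<close> is its own inverse, so division by y
  appears as multiplication by \<open>sgn y\<close>.\<close>

lemma area_profile_deriv_cases:
  assumes "1 \<le> m" "-1 < y" "y \<noteq> 0"
  obtains g where "(area_profile m has_real_derivative g) (at y)" "sgn g = sgn (area_sign m y) * sgn y"
proof -
  let ?D = "3 / 2 * kint m 2 y + (1 + y) * (- 2 * kint (Suc m) 3 y)"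
  have "sgn y * sgn ?D = sgn (area_sign m y)"
    using arg_cong[OF area_profile_deriv_sign[OF assms(2,1)], of sgn] area_denom_pos[OF assms(1,2)]
    unfolding sgn_mult by simp
  then have "sgn ?D = sgn (area_sign m y) * sgn y"
    using assms(3) by (cases "0 < y") auto
  then show thesis
    using that[OF area_profile_deriv[OF assms(2)]] assms(2) by (simp add: sgn_mult)
qed

lemma area_profile_unimodal:
  assumes "1 \<le> m" "-1 < a"
    "\<And>y. -1 < y \<Longrightarrow> y < a \<Longrightarrow> y \<noteq> 0 \<Longrightarrow> 0 < area_sign m y * y"
    "\<And>y. a < y \<Longrightarrow> y \<noteq> 0 \<Longrightarrow> area_sign m y * y < 0"
  shows "unimodal (area_profile m) a"
proof (rule unimodalI[OF area_profile_deriv])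
  fix y :: real assume y: "y \<noteq> 0"
  show "0 < sqrt (1 + y) * (3 / 2 * kint m 2 y + (1 + y) * (- 2 * kint (Suc m) 3 y))" if y1: "-1 < y" "y < a"
  proof -
    obtain g where g: "(area_profile m has_real_derivative g) (at y)" "sgn g = sgn (area_sign m y) * sgn y"
      using area_profile_deriv_cases[OF assms(1) y1(1) y] .
    have "sgn g = 1" using g(2) assms(3)[OF y1 y] by (simp add: sgn_mult[symmetric])
    then show ?thesis
      using DERIV_unique[OF g(1) area_profile_deriv[OF y1(1)]] by (simp add: sgn_1_pos)
  qed
  show "sqrt (1 + y) * (3 / 2 * kint m 2 y + (1 + y) * (- 2 * kint (Suc m) 3 y)) < 0" if "a < y"
  proof -
    have y1: "-1 < y" using that assms(2) by simp
    obtain g where g: "(area_profile m has_real_derivative g) (at y)" "sgn g = sgn (area_sign m y) * sgn y"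
      using area_profile_deriv_cases[OF assms(1) y1 y] .
    have "sgn g = -1" using g(2) assms(4)[OF that y] by (simp add: sgn_mult[symmetric])
    then show ?thesis
      using DERIV_unique[OF g(1) area_profile_deriv[OF y1]] by (simp add: sgn_1_neg)
  qed
qed (use assms(2) in auto)

lemma area_rhs_sgn:
  assumes "1 \<le> m" "-1 < y"
  shows "sgn (area_rhs m y) = sgn y * sgn ((2 - real m) - (real m - 1/2) * y)"
proof -
  define P where "P = ((1 + y) * (real m + 1 + (real m - 1/2) * y))\<^sup>2"
  have "0 < P"
    unfolding P_def using area_denom_pos[OF assms] assms(2) by simp
  moreover have e: "(1 - real m / 2) - (real m - 1/2) / 2 * y = 1 / 2 * ((2 - real m) - (real m - 1/2) * y)"
    by (simp add: field_simps)
  ultimately show ?thesis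
    unfolding area_rhs_def P_def[symmetric] e sgn_divide sgn_mult by simp
qed

text \<open>From t^m <= 1 one gets J <= 1 / (1 + y). Hence the profile tends to 0 as y -> -1;
  equivalently, the eigenvalue blows up as K -> -oo.\<close>

lemma area_profile_le:
  assumes "-1 < y"
  shows "area_profile m y \<le> sqrt (1 + y)"
proof -
  have "(1 + y) * kint m 2 y \<le> (1 + y) * (1 / (1 + y))"
    using kint_le[OF assms, of m 2] kint_0_2[OF assms] assms by (intro mult_left_mono) auto
  then show ?thesis
    using mult_left_mono[of "(1 + y) * kint m 2 y" 1 "sqrt (1 + y)"] assms
    by (simp add: area_profile_def mult.assoc)
qed

lemma area_profile_pos: "-1 < y \<Longrightarrow> 0 < area_profile m y"
  using kint_pos[of y m 2] by (simp add: area_profile_def)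

text \<open>If \<open>area_sign m\<close> were positive on all of (-1, 0), the profile would
  decrease there, so near -1 it would exceed its value g at -1/2, against the bound sqrt (1 +
  y).\<close>

lemma area_sign_nonpos_left:
  assumes "1 \<le> m"
  obtains y where "-1 < y" "y < 0" "area_sign m y \<le> 0"
proof -
  note * = that
  show thesis
  proof (rule ccontr)
    assume "\<not> thesis"
    then have pos: "0 < area_sign m y" if "-1 < y" "y < 0" for y
      using *[of y] that by force
    define g where "g = area_profile m (-1/2)"
    have "sqrt (1 / 2) < (1::real)" by simp
    moreover have "0 < g" "g \<le> sqrt (1 / 2)"
      using area_profile_pos[of "-1/2" m] area_profile_le[of "-1/2" m] by (auto simp: g_def)
    ultimately have g: "0 < g" "g < 1" by linarith+
    have g2: "g\<^sup>2 < 1" using g by (simp add: power_less_one_iff abs_square_less_1)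
    \<comment> \<open>At this point the bound sqrt (1 + y) equals g / 2, and g < 1 puts the point to
      the left of -1/2.\<close>
    have "area_profile m (- 1 + g\<^sup>2 / 4) > area_profile m (-1/2)"
    proof (rule DERIV_neg_imp_decreasing[where f = "area_profile m"])
      fix y assume y: "- 1 + g\<^sup>2 / 4 \<le> y" "y \<le> -1/2"
      have y1: "-1 < y" using y(1) g(1) zero_less_power[of g 2] by linarith
      obtain h where h: "(area_profile m has_real_derivative h) (at y)" "sgn h = sgn (area_sign m y) * sgn y"
        using area_profile_deriv_cases[OF assms y1] y by force
      have "sgn h = -1" using h(2) pos[OF y1] y by simp
      then show "\<exists>h. (area_profile m has_real_derivative h) (at y) \<and> h < 0"
        using h(1) by (auto simp: sgn_1_neg)
    qed (use g2 in auto)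
    moreover have "area_profile m (- 1 + g\<^sup>2 / 4) \<le> g / 2"
      using area_profile_le[of "- 1 + g\<^sup>2 / 4" m] g by (simp add: real_sqrt_divide)
    ultimately show False using g by (simp add: g_def)
  qed
qed

text \<open>At y = e^3 - 1 the logarithm in \<open>kint 0 1 y\<close> equals 3, so y^2 J = 3 - y /
  (1 + y) >= 2, whereas y^2 / ((1 + y) (2 + y / 2)) stays below its limit 2.\<close>

lemma area_sign_1_nonpos: "area_sign 1 (exp 3 - 1) \<le> 0"
proof -
  define y :: real where "y = exp 3 - 1"
  have y: "0 < y" by (simp add: y_def)
  have "y * kint 1 2 y = 3 / y - 1 / (1 + y)"
    using kint_step[of y 0 1] kint_0_1[of y] kint_0_2[of y] y by (simp add: numeral_2_eq_2 y_def)
  then have "y * (y * kint 1 2 y) = 3 - y / (1 + y)"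
    using y by (simp add: right_diff_distrib)
  also have "\<dots> \<ge> 2" using y by (simp add: field_simps)
  also have "2 \<ge> y * (y * (1 / ((1 + y) * (2 + y / 2))))"
  proof -
    have "y * y \<le> 2 * ((1 + y) * (2 + y / 2))" using y by (simp add: field_simps)
    then show ?thesis using y by (simp add: divide_le_eq)
  qed
  finally have "y * (y * (1 / ((1 + y) * (2 + y / 2)))) \<le> y * (y * kint 1 2 y)" .
  then have "1 / ((1 + y) * (2 + y / 2)) \<le> kint 1 2 y"
    using y by (simp only: mult_le_cancel_left_pos)
  then show ?thesis by (simp add: area_sign_def y_def[symmetric])
qed

text \<open>The root 2 of \<open>area_rhs 1\<close> lies to the right of 0. So
  \<open>area_sign 1\<close> is negative on the left, and on the right it is positive and later
  negative, the change being forced by \<open>area_sign_1_nonpos\<close>.\<close>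

lemma area_profile_unimodal_1: "\<exists>a>0. unimodal (area_profile 1) a"
proof -
  note ode = area_sign_ode[of 1, OF order_refl]
  have s: "sgn (area_rhs 1 t) = sgn t * sgn (1 - t / 2)" if "-1 < t" for t
    using area_rhs_sgn[of 1 t, OF order_refl that] by simp
  obtain a where a: "0 < a" "\<And>y. 0 < y \<Longrightarrow> y < a \<Longrightarrow> - area_sign 1 y < 0" "\<And>y. a < y \<Longrightarrow> 0 < - area_sign 1 y"
  proof (rule euler_ode_sign_change_right[OF euler_ode_uminus[OF ode], where c = 2 and ?y1.0 = "exp 3 - 1"])
    show "(0::real) < 2" by simp
    fix t :: real
    show "- area_rhs 1 t < 0" if "0 < t" "t < 2" using s[of t] that by (simp add: sgn_1_pos)
    show "0 < - area_rhs 1 t" if "2 < t" using s[of t] that by (simp add: sgn_1_neg)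
  next
    show "0 < exp (3::real) - 1" by simp
    show "0 \<le> - area_sign 1 (exp 3 - 1)" using area_sign_1_nonpos by simp
  qed blast
  have neg: "area_sign 1 y < 0" if "-1 < y" "y < 0" for y
  proof -
    have "0 < - area_sign 1 y"
    proof (rule euler_ode_pos_left[OF euler_ode_uminus[OF ode] that])
      fix t assume "y < t" "t < 0"
      then show "0 < - area_rhs 1 t" using s[of t] that by (simp add: sgn_1_neg)
    qed
    then show ?thesis by simp
  qed
  have "unimodal (area_profile 1) a"
  proof (rule area_profile_unimodal)
    fix y :: real assume y: "y \<noteq> 0"
    show "0 < area_sign 1 y * y" if "-1 < y" "y < a"
      using neg[of y] a(2)[of y] y that by (cases "y < 0") (auto intro: mult_neg_neg)
    show "area_sign 1 y * y < 0" if "a < y"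
      using a(1) a(3)[OF that] that by (auto intro: mult_neg_pos)
  qed (use a in auto)
  then show ?thesis using a(1) by blast
qed

text \<open>For m >= 2 the second root of \<open>area_rhs m\<close> is not positive, so the
  right-hand side has one sign on the positive axis.\<close>

lemma area_sign_neg_right:
  assumes "2 \<le> m" "0 < y"
  shows "area_sign m y < 0"
proof -
  have "0 < - area_sign m y"
  proof (rule euler_ode_pos_right[OF euler_ode_uminus[OF area_sign_ode] assms(2)])
    fix t assume t: "0 < t" "t < y"
    have "0 < (real m - 1/2) * t" using assms(1) t by (intro mult_pos_pos) auto
    moreover have "real m \<ge> 2" using assms(1) by simp
    ultimately have "(2 - real m) - (real m - 1/2) * t < 0" by linarith
    then have "sgn (area_rhs m t) = -1"
      using area_rhs_sgn[of m t] t assms(1) by simp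
    then show "0 < - area_rhs m t" by (simp add: sgn_1_neg)
  qed (use assms in auto)
  then show ?thesis by simp
qed

text \<open>The two roots merge at 0. The right-hand side, and with it \<open>area_sign 2\<close>,
  is negative on both sides, and division by y puts the turning point at 0.\<close>

lemma area_profile_unimodal_2: "unimodal (area_profile 2) 0"
proof -
  note ode = area_sign_ode[of 2, simplified]
  have s: "sgn (area_rhs 2 t) = - (sgn t * sgn t)" if "-1 < t" for t
    using area_rhs_sgn[of 2 t, OF _ that] by (simp add: sgn_mult)
  have neg: "area_sign 2 y < 0" if "-1 < y" "y < 0" for y
  proof -
    have "0 < - area_sign 2 y"
    proof (rule euler_ode_pos_left[OF euler_ode_uminus[OF ode] that])
      fix t assume "y < t" "t < 0"
      then have "sgn (area_rhs 2 t) = -1" using s[of t] that by simp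
      then show "0 < - area_rhs 2 t" by (simp add: sgn_1_neg)
    qed
    then show ?thesis by simp
  qed
  show ?thesis
    by (rule area_profile_unimodal)
       (use neg area_sign_neg_right[of 2] in \<open>auto intro: mult_neg_neg mult_neg_pos\<close>)
qed

lemma area_profile_unimodal_ge_3:
  assumes "3 \<le> m"
  shows "\<exists>a. -1 < a \<and> a < 0 \<and> unimodal (area_profile m) a"
proof -
  have m1: "1 \<le> m" using assms by simp
  obtain y1 where y1: "-1 < y1" "y1 < 0" "area_sign m y1 \<le> 0" using area_sign_nonpos_left[OF m1] .
  \<comment> \<open>\<open>c\<close> is the nonzero root of the numerator of
    \<open>area_rhs m\<close>.\<close>
  define c where "c = (2 - real m) / (real m - 1/2)"
  have b: "0 < real m - 1/2" and m3: "3 \<le> real m" using assms by auto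
  have c: "c < 0" using b m3 by (simp add: c_def divide_neg_pos)
  have lin: "(2 - real m) - (real m - 1/2) * t = (real m - 1/2) * (c - t)" for t
  proof -
    have "(real m - 1/2) * c = 2 - real m" using b by (simp add: c_def)
    then show ?thesis by (simp only: right_diff_distrib)
  qed
  have s: "sgn (area_rhs m t) = - sgn (c - t)" if "-1 < t" "t < 0" for t
    using area_rhs_sgn[OF m1 that(1)] that(2) b unfolding lin by (simp add: sgn_mult)
  obtain a where a: "-1 < a" "a < 0" "\<And>y. a < y \<Longrightarrow> y < 0 \<Longrightarrow> - area_sign m y < 0"
    "\<And>y. -1 < y \<Longrightarrow> y < a \<Longrightarrow> 0 < - area_sign m y"
  proof (rule euler_ode_sign_change_left[OF euler_ode_uminus[OF area_sign_ode[OF m1]] c _ _ y1(1,2)])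
    fix t :: real assume t: "-1 < t"
    show "- area_rhs m t < 0" if "t < 0" "c < t" using s[OF t] that by (simp add: sgn_1_pos)
    show "0 < - area_rhs m t" if "t < c" using s[OF t] that c by (simp add: sgn_1_neg)
  qed (use y1 in auto)
  have "unimodal (area_profile m) a"
  proof (rule area_profile_unimodal[OF m1 a(1)])
    fix y :: real assume y: "y \<noteq> 0"
    show "0 < area_sign m y * y" if "-1 < y" "y < a"
      using a(2) a(4)[OF that] that by (auto intro: mult_neg_neg)
    show "area_sign m y * y < 0" if "a < y"
      using a(3)[OF that] area_sign_neg_right[of m y] assms y
      by (cases "y < 0") (auto intro: mult_pos_neg mult_neg_pos)
  qed
  then show ?thesis using a by blast
qed

subsection \<open>Disks of fixed radius\<close>

definition radius_profile :: "nat \<Rightarrow> real \<Rightarrow> real" where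
  "radius_profile m y = (1 + y) * kint m 2 y / arctan_quot y"

text \<open>Multiplying the derivative of the profile by 2 y L^2 and eliminating J' and L' leaves 2
  L / (1 + y) - w J, where w = 1 + L (2 m + 1 + (2 m - 1) y) > 0; division by w isolates -
  J.\<close>

definition radius_sign :: "nat \<Rightarrow> real \<Rightarrow> real" where
  "radius_sign m y =
     2 * arctan_quot y / ((1 + y) * (1 + arctan_quot y * (2 * real m + 1 + (2 * real m - 1) * y))) - kint m 2 y"

text \<open>The factor of \<open>radius_rhs m\<close> whose sign is not evident. Normalised by (1 +
  y)^2, it solves an equation of the same kind whose right-hand side only compares m (1 + y) L with
  1.\<close>

definition radius_aux :: "nat \<Rightarrow> real \<Rightarrow> real" where
  "radius_aux m y = (arctan_quot y * ((1 + y) * (2 * real m + 1 - (2 * real m - 1) * y))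
     - (2 * real m + 1 + (2 * real m - 1) * y)) / (1 + y)\<^sup>2"

definition radius_rhs :: "nat \<Rightarrow> real \<Rightarrow> real" where
  "radius_rhs m y = arctan_quot y * radius_aux m y
     / (1 + arctan_quot y * (2 * real m + 1 + (2 * real m - 1) * y))\<^sup>2"

definition radius_aux_rhs :: "nat \<Rightarrow> real \<Rightarrow> real" where
  "radius_aux_rhs m y = - 4 * y * (real m * arctan_quot y - 1 / (1 + y)) / (1 + y)\<^sup>2"

lemma radius_denom_pos:
  fixes y :: real
  assumes "1 \<le> m" "-1 < y"
  shows "0 < 1 + arctan_quot y * (2 * real m + 1 + (2 * real m - 1) * y)"
proof -
  have "(2 * real m - 1) * (-1) < (2 * real m - 1) * y"
    by (rule mult_strict_left_mono) (use assms in auto)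
  then have "0 < 2 * real m + 1 + (2 * real m - 1) * y" by simp
  then show ?thesis using arctan_quot_pos[OF assms(2)] by (simp add: add_pos_pos)
qed

text \<open>The numerator is affine in L, and the exponent 1/2 is that of L, taken from L + 2 y L' =
  1 / (1 + y).\<close>

lemma radius_aux_ode: "euler_ode (1/2) (radius_aux m) (radius_aux_rhs m)"
  unfolding euler_ode_def
proof (intro conjI allI impI)
  fix y :: real assume y: "-1 < y"
  define \<alpha> \<beta> L D e where "\<alpha> = 2 * real m + 1" and "\<beta> = 2 * real m - 1"
    and "L = arctan_quot y" and "D = arctan_quot' y" and "e = 1 + y"
  have e: "0 < e" using y by (simp add: e_def)
  have XD: "2 * y * D * e = 1 - e * L"
    using arctan_quot_ode[OF y] e by (simp add: L_def D_def e_def[symmetric] field_simps)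
  let ?n = "L * (e * (\<alpha> - \<beta> * y)) - (\<alpha> + \<beta> * y)"
  let ?n' = "D * (e * (\<alpha> - \<beta> * y)) + L * (\<alpha> - \<beta> * y - e * \<beta>) - \<beta>"
  let ?d = "(?n' * e\<^sup>2 - ?n * (2 * e)) / (e\<^sup>2 * e\<^sup>2)"
  have "(radius_aux m has_real_derivative ?d) (at y)"
    unfolding radius_aux_def[abs_def] \<alpha>_def[symmetric] \<beta>_def[symmetric]
    by (rule DERIV_cong[OF DERIV_divide[where D = ?n' and E = "2 * e"]])
       (use e in \<open>auto intro!: derivative_eq_intros arctan_quot_deriv[OF y]
          simp: L_def D_def e_def algebra_simps\<close>)
  moreover have "y * ?d + 1/2 * radius_aux m y = radius_aux_rhs m y"
  proof -
    have "y * ?d + 1/2 * radius_aux m y = (2 * y * e * ?n' - 4 * y * ?n + e * ?n) / (2 * e ^ 3)"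
    proof -
      have "y * ((n' * e\<^sup>2 - n * (2 * e)) / (e\<^sup>2 * e\<^sup>2)) + 1/2 * (n / e\<^sup>2)
          = (2 * y * e * n' - 4 * y * n + e * n) / (2 * e ^ 3)" for n n'
        using e by (simp add: field_simps power2_eq_square power3_eq_cube)
      then show ?thesis
        unfolding radius_aux_def L_def[symmetric] e_def[symmetric] \<alpha>_def[symmetric] \<beta>_def[symmetric] .
    qed
    \<comment> \<open>After L' is replaced, the terms without an explicit factor y are (1 - e L) e
      (\<alpha> - \<beta> y) + e n; their sum is - 2 \<beta> y e, so y splits off.\<close>
    also have "2 * y * e * ?n' - 4 * y * ?n + e * ?n = - 8 * y * (real m * L * e - 1)"
    proof -
      have "2 * y * e * ?n' = 2 * y * D * e * (e * (\<alpha> - \<beta> * y)) + 2 * y * e * (L * (\<alpha> - \<beta> * y - e * \<beta>) - \<beta>)"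
        by (simp add: algebra_simps)
      also have "\<dots> = (1 - e * L) * (e * (\<alpha> - \<beta> * y)) + 2 * y * e * (L * (\<alpha> - \<beta> * y - e * \<beta>) - \<beta>)"
        unfolding XD ..
      finally show ?thesis by (simp add: e_def \<alpha>_def \<beta>_def algebra_simps)
    qed
    also have "- 8 * y * (real m * L * e - 1) / (2 * e ^ 3) = radius_aux_rhs m y"
      using e by (simp add: radius_aux_rhs_def L_def[symmetric] e_def[symmetric])
        (simp add: divide_simps, simp add: power2_eq_square power3_eq_cube algebra_simps)
    finally show ?thesis .
  qed
  ultimately show "\<exists>f'. (radius_aux m has_real_derivative f') (at y)
      \<and> y * f' + 1/2 * radius_aux m y = radius_aux_rhs m y" by blast
qed auto

text \<open>J cancels as for fixed area, and 2 y (1 + y) L' = 1 - (1 + y) L removes L', leaving a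
  right-hand side in y and L alone.\<close>

lemma radius_sign_ode:
  assumes "1 \<le> m"
  shows "euler_ode (real m + 1) (radius_sign m) (radius_rhs m)"
  unfolding euler_ode_def
proof (intro conjI allI impI)
  fix y :: real assume y: "-1 < y"
  define \<alpha> \<beta> L D e where "\<alpha> = 2 * real m + 1" and "\<beta> = 2 * real m - 1"
    and "L = arctan_quot y" and "D = arctan_quot' y" and "e = 1 + y"
  define q where "q = \<alpha> + \<beta> * y"
  define w where "w = 1 + L * q"
  have e: "0 < e" using y by (simp add: e_def)
  have w: "0 < w" using radius_denom_pos[OF assms y] by (simp add: w_def q_def \<alpha>_def \<beta>_def L_def)
  have XD: "2 * y * D * e = 1 - e * L"
    using arctan_quot_ode[OF y] e by (simp add: L_def D_def e_def[symmetric] field_simps)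
  let ?d = "(2 * D * (e * w) - 2 * L * (w + e * (D * q + L * \<beta>))) / (e * w * (e * w)) - (- 2 * kint (Suc m) 3 y)"
  have "(radius_sign m has_real_derivative ?d) (at y)"
    unfolding radius_sign_def[abs_def] \<alpha>_def[symmetric] \<beta>_def[symmetric]
  proof (rule DERIV_diff[OF _ kint_2_deriv(1)[OF y]])
    show "((\<lambda>y. 2 * arctan_quot y / ((1 + y) * (1 + arctan_quot y * (\<alpha> + \<beta> * y)))) has_real_derivative
       (2 * D * (e * w) - 2 * L * (w + e * (D * q + L * \<beta>))) / (e * w * (e * w))) (at y)"
    proof (rule DERIV_cong[OF DERIV_divide])
      show "((\<lambda>y. 2 * arctan_quot y) has_real_derivative 2 * D) (at y)"
        unfolding D_def by (rule DERIV_cmult[OF arctan_quot_deriv[OF y]])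
      show "((\<lambda>y. (1 + y) * (1 + arctan_quot y * (\<alpha> + \<beta> * y))) has_real_derivative w + e * (D * q + L * \<beta>)) (at y)"
        by (auto intro!: derivative_eq_intros arctan_quot_deriv[OF y]
            simp: L_def D_def e_def w_def q_def algebra_simps)
      show "(1 + y) * (1 + arctan_quot y * (\<alpha> + \<beta> * y)) \<noteq> 0"
        using e w unfolding e_def w_def q_def L_def by simp
    qed (simp add: L_def e_def w_def q_def)
  qed
  moreover have "y * ?d + (real m + 1) * radius_sign m y = radius_rhs m y"
  proof -
    have "y * ?d + (real m + 1) * radius_sign m y
       = y * ((2 * D * (e * w) - 2 * L * (w + e * (D * q + L * \<beta>))) / (e * w * (e * w)))
         + (real m + 1) * (2 * L / (e * w)) - 1 / e\<^sup>2"
      using kint_2_deriv(2)[OF y, of m]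
      by (simp add: radius_sign_def \<alpha>_def[symmetric] \<beta>_def[symmetric] q_def[symmetric]
          L_def[symmetric] e_def[symmetric] w_def[symmetric])
         (simp add: algebra_simps)
    also have "\<dots> = (2 * y * D * e * (w - q * L) - 2 * y * L * w - 2 * y * e * L * L * \<beta>
          + 2 * (real m + 1) * L * e * w - w\<^sup>2) / (e * w)\<^sup>2"
      using e w by (simp add: divide_simps) (simp add: power2_eq_square algebra_simps)
    also have "2 * y * D * e * (w - q * L) - 2 * y * L * w - 2 * y * e * L * L * \<beta>
          + 2 * (real m + 1) * L * e * w - w\<^sup>2 = L * (L * (e * (\<alpha> - \<beta> * y)) - q)"
      unfolding XD
      by (simp add: w_def q_def e_def \<alpha>_def \<beta>_def power2_eq_square algebra_simps)
    also have "L * (L * (e * (\<alpha> - \<beta> * y)) - q) / (e * w)\<^sup>2 = radius_rhs m y"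
      by (simp add: radius_rhs_def radius_aux_def \<alpha>_def[symmetric] \<beta>_def[symmetric] q_def[symmetric]
          L_def[symmetric] e_def[symmetric] w_def[symmetric] power_mult_distrib)
    finally show ?thesis .
  qed
  ultimately show "\<exists>f'. (radius_sign m has_real_derivative f') (at y)
      \<and> y * f' + (real m + 1) * radius_sign m y = radius_rhs m y" by blast
qed auto

lemma radius_profile_deriv:
  assumes "1 \<le> m" "-1 < y" "y \<noteq> 0"
  obtains g where "(radius_profile m has_real_derivative g) (at y)" "sgn g = sgn (radius_sign m y) * sgn y"
proof -
  define J J' L D e where "J = kint m 2 y" and "J' = - 2 * kint (Suc m) 3 y"
    and "L = arctan_quot y" and "D = arctan_quot' y" and "e = 1 + y"
  define w where "w = 1 + L * (2 * real m + 1 + (2 * real m - 1) * y)"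
  have e: "0 < e" using assms by (simp add: e_def)
  have L: "0 < L" using arctan_quot_pos assms by (simp add: L_def)
  have w: "0 < w" using radius_denom_pos[OF assms(1,2)] by (simp add: w_def L_def)
  have XD: "2 * y * D * e = 1 - e * L"
    using arctan_quot_ode[OF assms(2)] e by (simp add: L_def D_def e_def[symmetric] field_simps)
  have XJ: "y * J' = 1 / e\<^sup>2 - real (Suc m) * J"
    using kint_2_deriv(2)[OF assms(2)] by (simp only: J_def J'_def e_def)
  let ?p = "(J + e * J') * L - e * J * D"
  have "(radius_profile m has_real_derivative ?p / (L * L)) (at y)"
    unfolding radius_profile_def[abs_def]
    by (rule DERIV_cong[OF DERIV_divide[where D = "J + e * J'" and E = D]])
       (use L e in \<open>auto intro!: derivative_eq_intros arctan_quot_deriv kint_2_deriv(1) assms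
          simp: L_def D_def e_def J_def J'_def algebra_simps\<close>)
  moreover have "y * (2 * ?p) = w * radius_sign m y"
  proof -
    have "y * (2 * ?p) = 2 * y * J * L + 2 * e * L * (y * J') - J * (2 * y * D * e)"
      by (simp add: algebra_simps)
    also have "\<dots> = 2 * y * J * L + 2 * L / e - 2 * e * L * (real (Suc m) * J) - J * (1 - e * L)"
      unfolding XJ XD using e by (simp add: power2_eq_square right_diff_distrib)
    also have "\<dots> = 2 * L / e - w * J"
      by (simp add: w_def e_def algebra_simps)
    also have "\<dots> = w * radius_sign m y"
      using w e by (simp add: radius_sign_def L_def[symmetric] e_def[symmetric] J_def[symmetric]
          w_def[symmetric] right_diff_distrib)
    finally show ?thesis .
  qed
  then have "sgn y * sgn ?p = sgn (radius_sign m y)"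
    using arg_cong[of "y * (2 * ?p)" "w * radius_sign m y" sgn] w unfolding sgn_mult by simp
  then have "sgn ?p = sgn (radius_sign m y) * sgn y"
    using assms(3) by (cases "0 < y") auto
  then have "sgn (?p / (L * L)) = sgn (radius_sign m y) * sgn y"
    using L by (simp add: sgn_divide sgn_mult)
  ultimately show thesis using that by blast
qed

text \<open>The integrand (1 + y) / (1 + y t^2) already increases with y for 0 < t < 1. With the
  value 1 at y = 0, this settles the comparison of m (1 + y) L with 1.\<close>

lemma arctan_quot_mult_mono:
  assumes "-1 < y" "y < z"
  shows "(1 + y) * arctan_quot y < (1 + z) * arctan_quot z"
proof -
  have "integral {0..1} (\<lambda>t. (1 + y) * (1 / (1 + y * t\<^sup>2))) < integral {0..1} (\<lambda>t. (1 + z) * (1 / (1 + z * t\<^sup>2)))"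
  proof (rule integral_less_real)
    show "continuous_on {0..1} (\<lambda>t. (1 + y) * (1 / (1 + y * t\<^sup>2)))"
      "continuous_on {0..1} (\<lambda>t. (1 + z) * (1 / (1 + z * t\<^sup>2)))"
      using assms by (auto intro!: continuous_on_mult_left arctan_quot_continuous simp del: times_divide_eq_right)
    fix t :: real assume t: "t \<in> {0<..<1}"
    then have "(z - y) * t\<^sup>2 < (z - y) * 1"
      using assms(2) power_strict_mono[of t 1 2] by (intro mult_strict_left_mono) auto
    then have "(1 + y) * (1 + z * t\<^sup>2) < (1 + z) * (1 + y * t\<^sup>2)"
      by (simp add: algebra_simps)
    then show "(1 + y) * (1 / (1 + y * t\<^sup>2)) < (1 + z) * (1 / (1 + z * t\<^sup>2))"
      using one_add_mult_sq_pos[of y t] one_add_mult_sq_pos[of z t] t assms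
      by (simp add: frac_less_eq divide_less_eq less_divide_eq)
  qed auto
  then show ?thesis unfolding integral_mult_right arctan_quot_def .
qed

text \<open>For y in (-1, 0) one has 1 + y t <= 1 + y t^2 <= 2 (1 + y t), the second difference
  being at least (1 - t)^2. Hence L diverges logarithmically at -1.\<close>

lemma arctan_quot_bounds:
  assumes "-1 < y" "y < 0"
  shows "arctan_quot y \<le> ln (1 + y) / y" "ln (1 + y) / (2 * y) \<le> arctan_quot y"
proof -
  have p: "0 < 1 + y * t" "0 < 1 + y * t\<^sup>2" "y * t \<le> y * t\<^sup>2" "1 + y * t\<^sup>2 \<le> 2 * (1 + y * t)"
    if "t \<in> {0..1}" for t
  proof -
    show "0 < 1 + y * t" "0 < 1 + y * t\<^sup>2"
      using that assms one_add_mult_pos one_add_mult_sq_pos by auto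
    have "t\<^sup>2 \<le> t" using that mult_left_mono[of t 1 t] by (simp add: power2_eq_square)
    then show "y * t \<le> y * t\<^sup>2" using assms(2) by (simp add: mult_left_mono_neg)
    have "(- 1) * (t * (2 - t)) \<le> y * (t * (2 - t))"
      using that assms by (intro mult_right_mono) auto
    moreover have "0 \<le> (1 - t)\<^sup>2" by simp
    ultimately show "1 + y * t\<^sup>2 \<le> 2 * (1 + y * t)"
      by (simp add: power2_eq_square algebra_simps)
  qed
  have "arctan_quot y \<le> kint 0 1 y"
    unfolding kint_def arctan_quot_def
    by (rule integral_le; (intro integrable_continuous_interval kint_continuous arctan_quot_continuous assms)?)
       (use p in \<open>auto intro!: divide_left_mono mult_pos_pos\<close>)
  then show "arctan_quot y \<le> ln (1 + y) / y" using kint_0_1[of y] assms by simp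
  have "kint 0 1 y \<le> integral {0..1} (\<lambda>t. 2 * (1 / (1 + y * t\<^sup>2)))"
    unfolding kint_def
  proof (rule integral_le; (intro integrable_on_mult_right integrable_continuous_interval kint_continuous arctan_quot_continuous assms)?)
    show "t ^ 0 / (1 + y * t) ^ 1 \<le> 2 * (1 / (1 + y * t\<^sup>2))" if "t \<in> {0..1}" for t
      using p[OF that] by (simp add: divide_le_eq pos_le_divide_eq)
  qed
  then have "kint 0 1 y \<le> 2 * arctan_quot y"
    unfolding integral_mult_right arctan_quot_def .
  then show "ln (1 + y) / (2 * y) \<le> arctan_quot y" using kint_0_1[of y] assms by (simp add: mult.commute)
qed

lemma radius_profile_unimodal:
  assumes "1 \<le> m" "-1 < a"
    "\<And>y. -1 < y \<Longrightarrow> y < a \<Longrightarrow> y \<noteq> 0 \<Longrightarrow> 0 < radius_sign m y * y"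
    "\<And>y. a < y \<Longrightarrow> y \<noteq> 0 \<Longrightarrow> radius_sign m y * y < 0"
  shows "unimodal (radius_profile m) a"
proof -
  have D: "\<exists>g. (radius_profile m has_real_derivative g) (at y) \<and> (y \<noteq> 0 \<longrightarrow> sgn g = sgn (radius_sign m y * y))"
    if "-1 < y" for y
  proof (cases "y = 0")
    case True
    \<comment> \<open>At y = 0 the derivative is shown to exist with its sign left open, as
      \<open>unimodalI\<close> permits.\<close>
    have "(radius_profile m has_real_derivative ((kint m 2 y + (1 + y) * (- 2 * kint (Suc m) 3 y)) * arctan_quot y
        - (1 + y) * kint m 2 y * arctan_quot' y) / (arctan_quot y * arctan_quot y)) (at y)"
      unfolding radius_profile_def[abs_def]
      by (rule DERIV_divide)
         (use arctan_quot_pos[OF that] in \<open>auto intro!: derivative_eq_intros arctan_quot_deriv kint_2_deriv(1) that\<close>)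
    then show ?thesis using True by blast
  next
    case False
    show ?thesis by (rule radius_profile_deriv[OF assms(1) that False]) (auto simp: sgn_mult)
  qed
  then obtain g where g: "\<And>y. -1 < y \<Longrightarrow> (radius_profile m has_real_derivative g y) (at y)"
    "\<And>y. -1 < y \<Longrightarrow> y \<noteq> 0 \<Longrightarrow> sgn (g y) = sgn (radius_sign m y * y)" by metis
  show ?thesis
  proof (rule unimodalI[OF g(1) assms(2)])
    fix y :: real assume y: "y \<noteq> 0"
    show "0 < g y" if y1: "-1 < y" "y < a"
      using g(2)[OF y1(1) y] assms(3)[OF y1 y] by (simp add: sgn_1_pos)
    show "g y < 0" if y1: "a < y"
      using g(2)[OF _ y] assms(4)[OF y1 y] assms(2) y1 by (simp add: sgn_1_neg)
  qed auto
qed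

lemma radius_rhs_sgn:
  assumes "1 \<le> m" "-1 < y"
  shows "sgn (radius_rhs m y) = sgn (radius_aux m y)"
proof -
  define P where "P = (1 + arctan_quot y * (2 * real m + 1 + (2 * real m - 1) * y))\<^sup>2"
  have "0 < P" using radius_denom_pos[OF assms] by (simp add: P_def)
  then show ?thesis
    unfolding radius_rhs_def P_def[symmetric] sgn_divide sgn_mult
    using arctan_quot_pos[OF assms(2)] by simp
qed

lemma radius_aux_rhs_sgn:
  assumes "-1 < y"
  shows "sgn (radius_aux_rhs m y) = - sgn y * sgn (real m * ((1 + y) * arctan_quot y) - 1)"
proof -
  have e: "radius_aux_rhs m y = (4 / (1 + y) ^ 3) * (- y * (real m * ((1 + y) * arctan_quot y) - 1))"
    using assms by (simp add: radius_aux_rhs_def field_simps power2_eq_square power3_eq_cube)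
  show ?thesis unfolding e sgn_mult using assms by simp
qed

lemma arctan_quot_mult_sgn: "-1 < y \<Longrightarrow> sgn ((1 + y) * arctan_quot y - 1) = sgn y"
  using arctan_quot_mult_mono[of y 0] arctan_quot_mult_mono[of 0 y]
  by (cases y "0::real" rule: linorder_cases) (auto simp: arctan_quot_0)

text \<open>Two passes of the comparison: (1 + y) L > 1 makes \<open>radius_aux\<close> negative,
  hence \<open>radius_rhs\<close>, hence \<open>radius_sign\<close>.\<close>

lemma radius_sign_neg_right:
  assumes "1 \<le> m" "0 < y"
  shows "radius_sign m y < 0"
proof -
  have aux: "radius_aux m t < 0" if "0 < t" for t
  proof -
    have "0 < - radius_aux m t"
    proof (rule euler_ode_pos_right[OF euler_ode_uminus[OF radius_aux_ode] that])
      fix s assume s: "0 < s" "s < t"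
      have "1 < (1 + s) * arctan_quot s" using arctan_quot_mult_sgn[of s] s by (simp add: sgn_1_pos)
      moreover have "1 * ((1 + s) * arctan_quot s) \<le> real m * ((1 + s) * arctan_quot s)"
        using assms(1) s arctan_quot_pos[of s] by (intro mult_right_mono) auto
      ultimately have "0 < real m * ((1 + s) * arctan_quot s) - 1" by linarith
      then have "sgn (radius_aux_rhs m s) = -1"
        using radius_aux_rhs_sgn[of s m] s by (simp only: sgn_pos)
      then show "0 < - radius_aux_rhs m s" by (simp add: sgn_1_neg)
    qed
    then show ?thesis by simp
  qed
  have "0 < - radius_sign m y"
  proof (rule euler_ode_pos_right[OF euler_ode_uminus[OF radius_sign_ode[OF assms(1)]] assms(2)])
    fix t assume t: "0 < t" "t < y"
    then have "sgn (radius_rhs m t) = -1" using radius_rhs_sgn[OF assms(1), of t] aux[of t] by simp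
    then show "0 < - radius_rhs m t" by (simp add: sgn_1_neg)
  qed
  then show ?thesis by simp
qed

text \<open>For m = 1 the equality (1 + y) L = 1 holds exactly at 0, so both right-hand sides are
  negative on (-1, 0) as well.\<close>

lemma radius_profile_unimodal_1: "unimodal (radius_profile 1) 0"
proof -
  have aux: "radius_aux 1 t < 0" if "-1 < t" "t < 0" for t
  proof -
    have "0 < - radius_aux 1 t"
    proof (rule euler_ode_pos_left[OF euler_ode_uminus[OF radius_aux_ode] that])
      fix s assume s: "t < s" "s < 0"
      then have "sgn (radius_aux_rhs 1 s) = -1"
        using radius_aux_rhs_sgn[of s 1] arctan_quot_mult_sgn[of s] that by simp
      then show "0 < - radius_aux_rhs 1 s" by (simp add: sgn_1_neg)
    qed
    then show ?thesis by simp
  qed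
  have neg: "radius_sign 1 y < 0" if "-1 < y" "y < 0" for y
  proof -
    have "0 < - radius_sign 1 y"
    proof (rule euler_ode_pos_left[OF euler_ode_uminus[OF radius_sign_ode[OF order_refl]] that])
      fix t assume t: "y < t" "t < 0"
      then have "sgn (radius_rhs 1 t) = -1" using radius_rhs_sgn[OF order_refl, of t] aux[of t] that by simp
      then show "0 < - radius_rhs 1 t" by (simp add: sgn_1_neg)
    qed
    then show ?thesis by simp
  qed
  show ?thesis
    by (rule radius_profile_unimodal)
       (use neg radius_sign_neg_right[of 1] in \<open>auto intro: mult_neg_neg mult_neg_pos\<close>)
qed

text \<open>The contradiction of \<open>area_sign_nonpos_left\<close>, now with the upper bound 1 /
  L for the profile and the divergence of L at -1.\<close>

lemma radius_sign_nonpos_left: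
  assumes "1 \<le> m"
  obtains y where "-1 < y" "y < 0" "radius_sign m y \<le> 0"
proof -
  have "\<exists>y. -1 < y \<and> y < 0 \<and> radius_sign m y \<le> 0"
  proof (rule ccontr)
    assume "\<not> ?thesis"
    then have pos: "0 < radius_sign m y" if "-1 < y" "y < 0" for y using that by force
    define g where "g = radius_profile m (-1/2)"
    have g: "0 < g"
      using kint_pos[of "-1/2" m 2] arctan_quot_pos[of "-1/2"] by (simp add: g_def radius_profile_def)
    \<comment> \<open>Chosen so that - (ln d) / 2 > 1 / g, which pushes the lower bound for L beyond
      1 / g; the factor 1/2 keeps -1 + d to the left of -1/2.\<close>
    define d where "d = exp (- 2 / g) / 2"
    have d: "0 < d" "d < 1/2" using g by (auto simp: d_def)
    have "radius_profile m (- 1 + d) > radius_profile m (-1/2)"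
    proof (rule DERIV_neg_imp_decreasing[where f = "radius_profile m"])
      fix y assume y: "- 1 + d \<le> y" "y \<le> -1/2"
      have y1: "-1 < y" using y(1) d by linarith
      obtain h where h: "(radius_profile m has_real_derivative h) (at y)" "sgn h = sgn (radius_sign m y) * sgn y"
        using radius_profile_deriv[OF assms y1] y by force
      have "sgn h = -1" using h(2) pos[OF y1] y by simp
      then show "\<exists>h. (radius_profile m has_real_derivative h) (at y) \<and> h < 0"
        using h(1) by (auto simp: sgn_1_neg)
    qed (use d in auto)
    moreover have "radius_profile m (- 1 + d) < g"
    proof -
      let ?y = "- 1 + d"
      have y: "-1 < ?y" "?y < 0" using d by auto
      have L: "0 < arctan_quot ?y" using arctan_quot_pos[OF y(1)] .
      have "ln d = - 2 / g - ln 2" by (simp add: d_def ln_div)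
      then have ld: "2 / g < - ln d" by simp
      have "1 / g < (- ln d) / 2" using ld by simp
      also have "\<dots> \<le> (- ln d) / (2 * (1 - d))"
        using d g by (intro divide_left_mono) auto
      also have "\<dots> = ln (1 + ?y) / (2 * ?y)"
        using d by (simp add: field_simps)
      also have "\<dots> \<le> arctan_quot ?y" by (rule arctan_quot_bounds(2)[OF y])
      finally have "1 / arctan_quot ?y < g" using g L by (simp add: field_simps)
      moreover have "radius_profile m ?y \<le> 1 / arctan_quot ?y"
      proof -
        have "(1 + ?y) * kint m 2 ?y \<le> (1 + ?y) * (1 / (1 + ?y))"
          using kint_le[OF y(1), of m 2] kint_0_2[OF y(1)] y by (intro mult_left_mono) auto
        then show ?thesis using L d by (simp add: radius_profile_def divide_right_mono)
      qed
      ultimately show ?thesis by simp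
    qed
    ultimately show False by (simp add: g_def)
  qed
  then show thesis using that by blast
qed

lemma arctan_quot_mult_eq:
  assumes "2 \<le> m"
  obtains c where "-1 < c" "c < 0" "real m * ((1 + c) * arctan_quot c) = 1"
proof -
  \<comment> \<open>At y = -1 + d the logarithmic bound gives m (1 + y) L <= 2 m^2 / (e^(2 m) - 1),
    which is at most 1 by the quadratic Taylor bound for exp.\<close>
  define d where "d = exp (- (2 * real m))"
  have m: "2 \<le> real m" using assms by simp
  have d: "0 < d" "d < 1" using m by (auto simp: d_def)
  let ?f = "\<lambda>y. real m * ((1 + y) * arctan_quot y)"
  have q: "1 + 2 * real m + (2 * real m)\<^sup>2 / 2 \<le> exp (2 * real m)"
    using m by (intro exp_lower_Taylor_quadratic) auto
  have "?f (- 1 + d) \<le> real m * (d * (ln (1 + (- 1 + d)) / (- 1 + d)))"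
    by (rule mult_left_mono, rule mult_mono[OF _ arctan_quot_bounds(1)[of "- 1 + d"]])
       (use d m arctan_quot_pos[of "- 1 + d"] in \<open>auto simp: less_imp_le\<close>)
  also have "\<dots> = real m * (2 * real m * d / (1 - d))"
    using d by (simp add: d_def field_simps)
  also have "\<dots> = 2 * (real m)\<^sup>2 / (exp (2 * real m) - 1)"
    using d by (simp add: d_def exp_minus field_simps power2_eq_square)
  also have "\<dots> \<le> 1"
    using q m by (simp add: divide_le_eq power2_eq_square)
  finally have lo: "?f (- 1 + d) \<le> 1" .
  have hi: "1 < ?f 0" using m by (simp add: arctan_quot_0)
  have cont: "continuous_on {- 1 + d..0} ?f"
    by (intro continuous_intros continuous_at_imp_continuous_on ballI DERIV_isCont[OF arctan_quot_deriv])
       (use d in auto)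
  obtain c where c: "- 1 + d \<le> c" "c \<le> 0" "?f c = 1"
    using IVT'[OF lo less_imp_le[OF hi] _ cont] d by auto
  have "c \<noteq> 0" using c(3) hi by auto
  then show thesis using that[of c] c d by auto
qed

text \<open>A sign change is passed on three times: at c for \<open>radius_aux_rhs\<close>, at b for
  \<open>radius_aux\<close> and \<open>radius_rhs\<close>, at a for
  \<open>radius_sign\<close>.\<close>

lemma radius_profile_unimodal_ge_2:
  assumes "2 \<le> m"
  shows "\<exists>a. -1 < a \<and> a < 0 \<and> unimodal (radius_profile m) a"
proof -
  have m1: "1 \<le> m" using assms by simp
  obtain y1 where y1: "-1 < y1" "y1 < 0" "radius_sign m y1 \<le> 0" using radius_sign_nonpos_left[OF m1] .
  obtain c where c: "-1 < c" "c < 0" "real m * ((1 + c) * arctan_quot c) = 1"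
    using arctan_quot_mult_eq[OF assms] .
  have m: "0 < real m" using assms by simp
  have s: "sgn (radius_aux_rhs m y) = sgn (y - c)" if "-1 < y" "y < 0" for y
    using radius_aux_rhs_sgn[OF that(1), of m] that(2) c(3) c(1)
      mult_strict_left_mono[OF arctan_quot_mult_mono[of y c] m]
      mult_strict_left_mono[OF arctan_quot_mult_mono[of c y] m] that(1)
    by (cases y c rule: linorder_cases) auto
  \<comment> \<open>No boundary analysis of \<open>radius_aux\<close> is made: if it were positive
    on all of (-1, 0), then \<open>radius_sign\<close> would be positive at
    \<open>y1\<close>.\<close>
  have "\<exists>t. -1 < t \<and> t < 0 \<and> radius_aux m t \<le> 0"
  proof (rule ccontr)
    assume n: "\<not> ?thesis"
    have "0 < radius_sign m y1"
    proof (rule euler_ode_pos_left[OF radius_sign_ode[OF m1] y1(1,2)])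
      fix t assume "y1 < t" "t < 0"
      then have "sgn (radius_rhs m t) = 1" using radius_rhs_sgn[OF m1, of t] n y1(1) by force
      then show "0 < radius_rhs m t" by (simp add: sgn_1_pos)
    qed
    then show False using y1(3) by simp
  qed
  then obtain t1 where t1: "-1 < t1" "t1 < 0" "radius_aux m t1 \<le> 0" by blast
  obtain b where b: "-1 < b" "b < 0" "\<And>y. b < y \<Longrightarrow> y < 0 \<Longrightarrow> - radius_aux m y < 0"
    "\<And>y. -1 < y \<Longrightarrow> y < b \<Longrightarrow> 0 < - radius_aux m y"
  proof (rule euler_ode_sign_change_left[OF euler_ode_uminus[OF radius_aux_ode[of m]] c(2) _ _ t1(1,2)])
    fix t :: real assume t: "-1 < t"
    show "- radius_aux_rhs m t < 0" if "t < 0" "c < t" using s[OF t] that by (simp add: sgn_1_pos)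
    show "0 < - radius_aux_rhs m t" if "t < c" using s[OF t] that c by (simp add: sgn_1_neg)
  qed (use t1 in auto)
  obtain a where a: "-1 < a" "a < 0" "\<And>y. a < y \<Longrightarrow> y < 0 \<Longrightarrow> - radius_sign m y < 0"
    "\<And>y. -1 < y \<Longrightarrow> y < a \<Longrightarrow> 0 < - radius_sign m y"
  proof (rule euler_ode_sign_change_left[OF euler_ode_uminus[OF radius_sign_ode[OF m1]] b(2) _ _ y1(1,2)])
    fix t :: real assume t: "-1 < t"
    show "- radius_rhs m t < 0" if "t < 0" "b < t"
      using radius_rhs_sgn[OF m1 t] b(3)[OF that(2,1)] by (simp add: sgn_1_pos)
    show "0 < - radius_rhs m t" if "t < b"
      using radius_rhs_sgn[OF m1 t] b(4)[OF t that] by (simp add: sgn_1_neg)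
  qed (use y1 in auto)
  have "unimodal (radius_profile m) a"
  proof (rule radius_profile_unimodal[OF m1 a(1)])
    fix y :: real assume y: "y \<noteq> 0"
    show "0 < radius_sign m y * y" if "-1 < y" "y < a"
      using a(2) a(4)[OF that] that by (auto intro: mult_neg_neg)
    show "radius_sign m y * y < 0" if "a < y"
      using a(3)[OF that] radius_sign_neg_right[OF m1, of y] y
      by (cases "y < 0") (auto intro: mult_pos_neg mult_neg_pos)
  qed
  then show ?thesis using a by blast
qed

section \<open>Space forms\<close>

definition space_form_c :: "real \<Rightarrow> real \<Rightarrow> real" where
  "space_form_c K r =
     (if K > 0 then cos (sqrt K * r) else if K = 0 then 1 else cosh (sqrt (- K) * r))"

definition space_form_s :: "real \<Rightarrow> real \<Rightarrow> real" where
  "space_form_s K r = 2 * space_form_h K r / (1 + space_form_c K r)"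

text \<open>Equal to tan^2 (sqrt K r / 2) for K > 0 and - tanh^2 (sqrt (-K) r / 2) for K < 0. In the
  coordinate s the metric is (ds^2 + s^2 dt^2) / (1 + y)^2 with t the angle.\<close>

definition space_form_y :: "real \<Rightarrow> real \<Rightarrow> real" where
  "space_form_y K r = K * (space_form_s K r)\<^sup>2 / 4"

definition steklov_value :: "real \<Rightarrow> real \<Rightarrow> nat \<Rightarrow> real" where
  "steklov_value K R m = space_form_h K R * space_form_s K R ^ (2 * m)
     / integral {0..R} (\<lambda>r. space_form_h K r * space_form_s K r ^ (2 * m))"

lemma sqrt_mult_sqrt: "0 \<le> K \<Longrightarrow> sqrt K * (sqrt K * x) = K * x"
  by (simp add: mult.assoc[symmetric])

lemma space_form_h_deriv: "(space_form_h K has_real_derivative space_form_c K r) (at r)"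
  unfolding space_form_h_def[abs_def] space_form_c_def
  by (cases "K = 0"; cases "K > 0") (auto intro!: derivative_eq_intros simp: mult_ac sqrt_mult_sqrt)

lemma space_form_c_deriv: "(space_form_c K has_real_derivative - K * space_form_h K r) (at r)"
  unfolding space_form_h_def space_form_c_def[abs_def]
  by (cases "K = 0"; cases "K > 0")
     (auto intro!: derivative_eq_intros simp: field_simps sqrt_mult_sqrt)

lemma space_form_pythagoras: "(space_form_c K r)\<^sup>2 + K * (space_form_h K r)\<^sup>2 = 1"
  unfolding space_form_h_def space_form_c_def
  by (cases "K = 0"; cases "K > 0") (auto simp: power_divide cosh_square_eq)

lemma space_form_0 [simp]: "space_form_h K 0 = 0" "space_form_c K 0 = 1" "space_form_s K 0 = 0" "space_form_y K 0 = 0"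
  by (auto simp: space_form_h_def space_form_c_def space_form_s_def space_form_y_def)

text \<open>The inequality \<open>K * r\<^sup>2 < pi\<^sup>2\<close> is used throughout as a form of
  r < r_0 that is uniform in the sign of K and defines an open set in Cartesian coordinates.\<close>

lemma sqrt_mult_less_pi: "0 < K \<Longrightarrow> 0 \<le> r \<Longrightarrow> K * r\<^sup>2 < pi\<^sup>2 \<Longrightarrow> sqrt K * r < pi"
  by (rule power2_less_imp_less) (auto simp: power_mult_distrib)

lemma space_form_h_pos:
  assumes "0 < r" "K * r\<^sup>2 < pi\<^sup>2"
  shows "0 < space_form_h K r"
  using assms sqrt_mult_less_pi[of K r] unfolding space_form_h_def
  by (auto intro!: divide_pos_pos sin_gt_zero)

lemma space_form_c_gt:
  assumes "0 \<le> r" "K * r\<^sup>2 < pi\<^sup>2"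
  shows "-1 < space_form_c K r"
proof (cases "0 < K")
  case True
  then have "cos pi < cos (sqrt K * r)"
    using assms sqrt_mult_less_pi[of K r] by (intro cos_monotone_0_pi) auto
  then show ?thesis using True by (simp add: space_form_c_def)
next
  case False
  have "0 < cosh (sqrt (- K) * r)" by simp
  then show ?thesis using False unfolding space_form_c_def by (auto intro: less_trans[of "-1" 0])
qed

lemma space_form_domain_mono:
  fixes K r R :: real
  assumes "0 \<le> r" "r \<le> R" "K * R\<^sup>2 < pi\<^sup>2" shows "K * r\<^sup>2 < pi\<^sup>2"
proof (cases "0 \<le> K")
  case True
  then have "K * r\<^sup>2 \<le> K * R\<^sup>2" using assms by (intro mult_left_mono power_mono) auto
  then show ?thesis using assms by simp
next
  case False
  then have "K * r\<^sup>2 \<le> 0" by (simp add: mult_nonpos_nonneg)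
  then show ?thesis using pi_gt_zero zero_less_power[of pi 2] by linarith
qed

context
  fixes K r :: real
  assumes r: "0 \<le> r" and Kr: "K * r\<^sup>2 < pi\<^sup>2"
begin

text \<open>K h^2 = (1 - c) (1 + c) turns y into (1 - c) / (1 + c).\<close>

lemma space_form_y_eq: "1 + space_form_y K r = 2 / (1 + space_form_c K r)"
proof -
  let ?c = "space_form_c K r"
  have c: "0 < 1 + ?c" using space_form_c_gt[OF r Kr] by simp
  have h: "K * (space_form_h K r)\<^sup>2 = (1 - ?c) * (1 + ?c)"
    using space_form_pythagoras[of K r] by (simp add: algebra_simps power2_eq_square)
  have "space_form_y K r = K * (space_form_h K r)\<^sup>2 / (1 + ?c)\<^sup>2"
    by (simp add: space_form_y_def space_form_s_def power_divide power_mult_distrib)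
  also have "\<dots> = (1 - ?c) / (1 + ?c)"
    unfolding h using c by (simp add: power2_eq_square)
  finally show ?thesis using c by (simp add: field_simps)
qed

lemma space_form_y_gt: "-1 < space_form_y K r"
  using space_form_y_eq space_form_c_gt[OF r Kr]
  by (metis add.commute add_less_cancel_right add.right_inverse divide_pos_pos zero_less_numeral less_diff_eq diff_0 uminus_add_conv_diff neg_less_iff_less add_uminus_conv_diff)

text \<open>By c^2 + K h^2 = 1 the quotient rule collapses to 2 / (1 + c), which is 1 + y.\<close>

lemma space_form_s_deriv:
  "(space_form_s K has_real_derivative 1 + space_form_y K r) (at r)"
proof -
  let ?c = "space_form_c K r" and ?h = "space_form_h K r"
  have c: "0 < 1 + ?c" using space_form_c_gt[OF r Kr] by simp
  have "(space_form_s K has_real_derivative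
      (2 * ?c * (1 + ?c) - 2 * ?h * (0 + - K * ?h)) / ((1 + ?c) * (1 + ?c))) (at r)"
    unfolding space_form_s_def[abs_def]
    by (intro DERIV_divide DERIV_cmult space_form_h_deriv DERIV_add DERIV_const space_form_c_deriv)
       (use c in auto)
  also have "2 * ?c * (1 + ?c) - 2 * ?h * (0 + - K * ?h) = 2 * (1 + ?c)"
    using space_form_pythagoras[of K r] by (simp add: algebra_simps power2_eq_square)
  also have "2 * (1 + ?c) / ((1 + ?c) * (1 + ?c)) = 1 + space_form_y K r"
    unfolding space_form_y_eq using c by (simp only: mult_divide_mult_cancel_right less_imp_neq[symmetric] simp_thms)
  finally show ?thesis .
qed

lemma space_form_y_deriv:
  "(space_form_y K has_real_derivative K * space_form_s K r / 2 * (1 + space_form_y K r)) (at r)"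
  unfolding space_form_y_def[abs_def]
  by (rule DERIV_cong[OF DERIV_cdivide[OF DERIV_cmult[OF DERIV_power[OF space_form_s_deriv]]]])
     (simp add: space_form_y_def algebra_simps)

lemma space_form_h_eq: "space_form_h K r = space_form_s K r / (1 + space_form_y K r)"
  unfolding space_form_y_eq using space_form_c_gt[OF r Kr] by (simp add: space_form_s_def)

lemma space_form_s_pos: "0 < r \<Longrightarrow> 0 < space_form_s K r"
  using space_form_h_pos[OF _ Kr] space_form_c_gt[OF r Kr] by (simp add: space_form_s_def)

end

text \<open>The r-derivative of s L(y) is (1 + y) (L + 2 y L') = 1 by
  \<open>arctan_quot_ode\<close>; the identity is the integral of the constant 1.\<close>

lemma space_form_radius_eq:
  assumes "0 \<le> R" "K * R\<^sup>2 < pi\<^sup>2"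
  shows "R = space_form_s K R * arctan_quot (space_form_y K R)"
proof -
  let ?F = "\<lambda>r. space_form_s K r * arctan_quot (space_form_y K r)"
  have "integral {0..R} (\<lambda>r. 1) = ?F R - ?F 0"
  proof (rule integral_fundamental)
    fix r assume r: "0 \<le> r" "r \<le> R"
    note d = r(1) space_form_domain_mono[OF r assms(2)]
    let ?y = "space_form_y K r" and ?s = "space_form_s K r"
    have y: "-1 < ?y" by (rule space_form_y_gt[OF d])
    have "(?F has_real_derivative
        ?s * (arctan_quot' ?y * (K * ?s / 2 * (1 + ?y))) + (1 + ?y) * arctan_quot ?y) (at r)"
      by (intro DERIV_mult' space_form_s_deriv[OF d] DERIV_chain2[OF arctan_quot_deriv[OF y] space_form_y_deriv[OF d]])
    also have "?s * (arctan_quot' ?y * (K * ?s / 2 * (1 + ?y))) + (1 + ?y) * arctan_quot ?y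
        = (1 + ?y) * (arctan_quot ?y + 2 * (K * ?s\<^sup>2 / 4) * arctan_quot' ?y)"
      by (simp add: power2_eq_square algebra_simps)
    also have "\<dots> = (1 + ?y) * (arctan_quot ?y + 2 * ?y * arctan_quot' ?y)"
      by (simp add: space_form_y_def)
    also have "\<dots> = 1" using arctan_quot_ode[OF y] y by simp
    finally show "(?F has_real_derivative 1) (at r)" .
  qed (use assms in auto)
  then show ?thesis using assms by simp
qed

text \<open>The primitive arises from the integral of h s^(2 m) over [0, R] by substituting t =
  (s(r) / s(R))^2; the equation for J verifies it.\<close>

lemma space_form_mass_deriv:
  assumes "0 \<le> r" "K * r\<^sup>2 < pi\<^sup>2"
  shows "((\<lambda>r. space_form_s K r ^ (2 * m + 2) / 2 * kint m 2 (space_form_y K r)) has_real_derivative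
    space_form_h K r * space_form_s K r ^ (2 * m)) (at r)"
proof -
  let ?y = "space_form_y K r" and ?s = "space_form_s K r"
  have y: "-1 < ?y" by (rule space_form_y_gt[OF assms])
  have s: "((\<lambda>r. space_form_s K r ^ (2 * m + 2) / 2) has_real_derivative
      real (Suc m) * ?s ^ (2 * m + 1) * (1 + ?y)) (at r)"
    by (rule DERIV_cong[OF DERIV_cdivide[OF DERIV_power[OF space_form_s_deriv[OF assms]]]])
       (simp add: algebra_simps)
  let ?J' = "- 2 * kint (Suc m) 3 ?y"
  have "((\<lambda>r. space_form_s K r ^ (2 * m + 2) / 2 * kint m 2 (space_form_y K r)) has_real_derivative
      ?s ^ (2 * m + 2) / 2 * (?J' * (K * ?s / 2 * (1 + ?y)))
        + real (Suc m) * ?s ^ (2 * m + 1) * (1 + ?y) * kint m 2 ?y) (at r)"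
    by (intro DERIV_mult' s DERIV_chain2[OF kint_2_deriv(1)[OF y] space_form_y_deriv[OF assms]])
  also have "?s ^ (2 * m + 2) / 2 * (?J' * (K * ?s / 2 * (1 + ?y)))
        + real (Suc m) * ?s ^ (2 * m + 1) * (1 + ?y) * kint m 2 ?y
      = ?s ^ (2 * m + 1) * (1 + ?y) * ((K * ?s\<^sup>2 / 4) * ?J' + real (Suc m) * kint m 2 ?y)"
    by (simp add: power2_eq_square field_simps)
  also have "\<dots> = ?s ^ (2 * m + 1) * (1 + ?y) * (?y * ?J' + real (Suc m) * kint m 2 ?y)"
    by (simp add: space_form_y_def)
  also have "\<dots> = ?s ^ (2 * m + 1) * (1 + ?y) * (1 / (1 + ?y)\<^sup>2)"
    unfolding kint_2_deriv(2)[OF y] by simp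
  also have "\<dots> = space_form_h K r * ?s ^ (2 * m)"
    unfolding space_form_h_eq[OF assms] using y by (simp add: power2_eq_square)
  finally show ?thesis .
qed

lemma space_form_mass_eq:
  assumes "0 \<le> R" "K * R\<^sup>2 < pi\<^sup>2"
  shows "integral {0..R} (\<lambda>r. space_form_h K r * space_form_s K r ^ (2 * m))
    = space_form_s K R ^ (2 * m + 2) / 2 * kint m 2 (space_form_y K R)"
  using integral_fundamental[OF assms(1) space_form_mass_deriv[of _ K m]] space_form_domain_mono[OF _ _ assms(2)]
  by simp

lemma steklov_value_eq:
  assumes "0 < R" "K * R\<^sup>2 < pi\<^sup>2"
  shows "steklov_value K R m
    = 2 / (space_form_s K R * (1 + space_form_y K R) * kint m 2 (space_form_y K R))"
proof -
  have R: "0 \<le> R" using assms by simp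
  let ?s = "space_form_s K R" and ?y = "space_form_y K R"
  have s: "0 < ?s" and y: "-1 < ?y" and J: "0 < kint m 2 ?y"
    using space_form_s_pos[OF R assms(2,1)] space_form_y_gt[OF R assms(2)] kint_pos by auto
  have "?s / e * P / (?s * ?s * P / 2 * J) = 2 / (?s * e * J)" if "0 < e" "0 < J" "0 < P" for e J P
    using that s by (simp add: field_simps)
  from this[of "1 + ?y" "kint m 2 ?y" "?s ^ (2 * m)"] show ?thesis
    unfolding steklov_value_def space_form_mass_eq[OF R assms(2)] space_form_h_eq[OF R assms(2)]
    using s y J by (simp add: power_add power2_eq_square mult_ac)
qed

lemma kint_Suc_less:
  assumes "-1 < y" shows "kint (Suc m) j y < kint m j y"
  unfolding kint_def
  by (rule integral_less_real; (intro kint_continuous assms)?)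
     (use one_add_mult_pos[OF assms] in \<open>auto intro!: divide_strict_right_mono\<close>)

text \<open>\<open>kint m 2\<close> decreases in m. So the frequency numbers the distinct
  eigenvalues, and the double multiplicity from cosine and sine does not affect the count.\<close>

lemma steklov_value_strict_mono:
  assumes "0 < R" "K * R\<^sup>2 < pi\<^sup>2"
  shows "strict_mono (steklov_value K R)"
proof (rule strict_mono_Suc_iff[THEN iffD2], rule allI)
  fix m
  let ?y = "space_form_y K R"
  have R: "0 \<le> R" using assms by simp
  have y: "-1 < ?y" and s: "0 < space_form_s K R"
    using space_form_y_gt[OF R assms(2)] space_form_s_pos[OF R assms(2,1)] by auto
  show "steklov_value K R m < steklov_value K R (Suc m)"
    unfolding steklov_value_eq[OF assms]
    using y s kint_Suc_less[OF y, of m 2] kint_pos[OF y]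
    by (intro divide_strict_left_mono mult_strict_left_mono mult_pos_pos) auto
qed

section \<open>Numbering of the eigenvalues, and transfer from y to the curvature\<close>

lemma nth_smallest_range:
  assumes "strict_mono (f :: nat \<Rightarrow> real)"
  shows "nth_smallest (range f) m = f m"
proof -
  have *: "{t \<in> range f. t < f n} = f ` {..<n}" for n
    using strict_mono_less[OF assms] by auto
  have c: "card (f ` {..<n}) = n" for n
    using card_image[of f "{..<n}"] strict_mono_imp_inj_on[OF assms] by (simp add: inj_on_subset)
  show ?thesis
    unfolding nth_smallest_def
  proof (rule the_equality)
    show "f m \<in> range f \<and> finite {t \<in> range f. t < f m} \<and> card {t \<in> range f. t < f m} = m"
      unfolding * c by simp
  next
    fix s assume s: "s \<in> range f \<and> finite {t \<in> range f. t < s} \<and> card {t \<in> range f. t < s} = m"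
    then obtain n where n: "s = f n" by blast
    show "s = f m" using s unfolding n * c by simp
  qed
qed

text \<open>Only the order of the values of Y and their position relative to a are used, so an
  implicitly given Y is admissible. Taking C / f exchanges increase and decrease; B is the upper end
  of the curvature range.\<close>

lemma unimodal_transfer:
  fixes \<eta> Y :: "real \<Rightarrow> real"
  assumes "unimodal f a" "\<And>y. -1 < y \<Longrightarrow> 0 < f y" "0 < C"
    "\<And>K. K < B \<Longrightarrow> \<eta> K = C / f (Y K)" "\<And>K. K < B \<Longrightarrow> -1 < Y K"
    "\<And>K K'. K < K' \<Longrightarrow> K' < B \<Longrightarrow> Y K < Y K'"
    "\<And>K. K < B \<Longrightarrow> K < k \<Longrightarrow> Y K < a" "\<And>K. K < B \<Longrightarrow> k < K \<Longrightarrow> a < Y K" "k \<le> B"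
  shows "strict_antimono_on {..<k} \<eta> \<and> strict_mono_on {k<..<B} \<eta>"
proof
  show "strict_antimono_on {..<k} \<eta>"
  proof (rule monotone_onI)
    fix r s assume *: "r \<in> {..<k}" "s \<in> {..<k}" "r < s"
    then have "r < B" "s < B" using assms(9) by (auto intro: less_le_trans)
    with * have "Y r \<in> {-1<..<a}" "Y s \<in> {-1<..<a}" "Y r < Y s"
      using assms(5)[of r] assms(5)[of s] assms(6)[of r s] assms(7)[of r] assms(7)[of s] assms(9) by auto
    then have "f (Y r) < f (Y s)"
      using assms(1) unfolding unimodal_def by (meson strict_mono_onD)
    then show "\<eta> r > \<eta> s"
      using * assms(2)[OF assms(5)] assms(3,4,9) by (auto intro!: divide_strict_left_mono)
  qed
  show "strict_mono_on {k<..<B} \<eta>"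
  proof (rule strict_mono_onI)
    fix r s assume *: "r \<in> {k<..<B}" "s \<in> {k<..<B}" "r < s"
    then have "Y r \<in> {a<..}" "Y s \<in> {a<..}" "Y r < Y s"
      using assms(6)[of r s] assms(8)[of r] assms(8)[of s] by auto
    then have "f (Y r) > f (Y s)"
      using assms(1) unfolding unimodal_def by (meson monotone_onD)
    then show "\<eta> r < \<eta> s"
      using * assms(2)[OF assms(5)] assms(3,4) by (auto intro!: divide_strict_left_mono)
  qed
qed

subsection \<open>Parametrization of the disks\<close>

text \<open>From R = s L and y = K s^2 / 4: this is K R^2 / 4 expressed by y.\<close>

definition radius_curvature :: "real \<Rightarrow> real" where
  "radius_curvature y = y * (arctan_quot y)\<^sup>2"

text \<open>The derivative is L (L + 2 y L') = L / (1 + y) > 0.\<close>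

lemma radius_curvature_strict_mono: "strict_mono_on {-1<..} radius_curvature"
proof (rule strict_mono_onI)
  fix r s :: real assume *: "r \<in> {-1<..}" "s \<in> {-1<..}" "r < s"
  show "radius_curvature r < radius_curvature s"
  proof (rule DERIV_pos_imp_increasing[OF *(3)])
    fix y assume "r \<le> y" "y \<le> s"
    then have y: "-1 < y" using * by auto
    have "(radius_curvature has_real_derivative
       arctan_quot y * (arctan_quot y + 2 * y * arctan_quot' y)) (at y)"
      unfolding radius_curvature_def[abs_def] power2_eq_square
      by (rule DERIV_cong[OF DERIV_mult'[OF DERIV_ident DERIV_mult'[OF arctan_quot_deriv[OF y] arctan_quot_deriv[OF y]]]])
         (simp add: algebra_simps)
    moreover have "0 < arctan_quot y * (arctan_quot y + 2 * y * arctan_quot' y)"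
      unfolding arctan_quot_ode[OF y] using arctan_quot_pos[OF y] y by simp
    ultimately show "\<exists>d. (radius_curvature has_real_derivative d) (at y) \<and> 0 < d" by blast
  qed
qed

lemma radius_curvature_less_iff:
  "-1 < y \<Longrightarrow> -1 < z \<Longrightarrow> radius_curvature y < radius_curvature z \<longleftrightarrow> y < z"
  using strict_mono_on_less[OF radius_curvature_strict_mono] by simp

lemma radius_profile_pos: "-1 < y \<Longrightarrow> 0 < radius_profile m y"
  using kint_pos[of y m 2] arctan_quot_pos[of y] by (simp add: radius_profile_def)

text \<open>The case m = 0 of the mass formula, where \<open>kint 0 2 y\<close> is 1 / (1 +
  y).\<close>

lemma disk_area_eq:
  assumes "0 \<le> R" "K * R\<^sup>2 < pi\<^sup>2"
  shows "2 * pi * integral {0..R} (space_form_h K) = pi * (space_form_s K R)\<^sup>2 / (1 + space_form_y K R)"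
proof -
  have "integral {0..R} (space_form_h K) = (space_form_s K R)\<^sup>2 / 2 * (1 / (1 + space_form_y K R))"
    using space_form_mass_eq[OF assms, of 0] kint_0_2[OF space_form_y_gt[OF assms]]
    by (simp add: power2_eq_square)
  then show ?thesis using space_form_y_gt[OF assms] by (simp add: field_simps)
qed

lemma space_form_r0_iff: "0 < R \<Longrightarrow> ereal R < space_form_r0 K \<longleftrightarrow> K * R\<^sup>2 < pi\<^sup>2"
proof (cases "0 < K")
  case True
  assume R: "0 < R"
  have "R < pi / sqrt K \<longleftrightarrow> sqrt K * R < pi"
    using True by (simp add: pos_less_divide_eq mult.commute)
  also have "\<dots> \<longleftrightarrow> (sqrt K * R)\<^sup>2 < pi\<^sup>2"
    using power_mono_iff[of pi "sqrt K * R" 2] R True by (simp add: not_le[symmetric])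
  finally show ?thesis using True by (simp add: space_form_r0_def power_mult_distrib)
next
  case False
  assume "0 < R"
  then have "K * R\<^sup>2 \<le> 0" using False by (simp add: mult_nonpos_nonneg)
  moreover have "0 < pi\<^sup>2" by simp
  ultimately have "K * R\<^sup>2 < pi\<^sup>2" by linarith
  then show ?thesis using False by (simp add: space_form_r0_def)
qed

lemma disk_area_strict_mono:
  assumes "0 \<le> r" "r < R" "K * R\<^sup>2 < pi\<^sup>2"
  shows "integral {0..r} (space_form_h K) < integral {0..R} (space_form_h K)"
proof -
  let ?F = "\<lambda>r. space_form_s K r ^ (2 * 0 + 2) / 2 * kint 0 2 (space_form_y K r)"
  have d: "(?F has_real_derivative space_form_h K t * space_form_s K t ^ (2 * 0)) (at t)" if "0 \<le> t" "t \<le> R" for t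
    by (rule space_form_mass_deriv[OF that(1) space_form_domain_mono[OF that assms(3)]])
  have "?F r < ?F R"
  proof (rule DERIV_pos_imp_increasing_open[OF assms(2)])
    fix t assume t: "r < t" "t < R"
    have "0 < space_form_h K t"
      by (rule space_form_h_pos[OF _ space_form_domain_mono[OF _ _ assms(3)]]) (use t assms in auto)
    then show "\<exists>D. (?F has_real_derivative D) (at t) \<and> 0 < D"
      using d[of t] t assms(1) by (intro exI[of _ "space_form_h K t * space_form_s K t ^ (2 * 0)"]) auto
  next
    show "continuous_on {r..R} ?F"
      by (rule DERIV_atLeastAtMost_imp_continuous_on) (use d assms(1) in \<open>meson order_trans\<close>)
  qed
  then show ?thesis
    using space_form_mass_eq[of r K 0] space_form_mass_eq[of R K 0] assms
      space_form_domain_mono[OF assms(1) less_imp_le[OF assms(2)] assms(3)] by simp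
qed

text \<open>For K different from 0 the area is 2 pi (1 - c(R)) / K, so c(R) = 1 - K A / (2 pi) is
  inverted by arccos or arcosh; K A < 4 pi keeps the target above -1.\<close>

lemma disk_radius_exists:
  assumes "0 < A" "K * A < 4 * pi"
  obtains R where "0 < R" "K * R\<^sup>2 < pi\<^sup>2" "2 * pi * integral {0..R} (space_form_h K) = A"
proof -
  have fin: thesis if "0 < R" "K * R\<^sup>2 < pi\<^sup>2" "space_form_c K R = 1 - K * A / (2 * pi)" "K \<noteq> 0" for R
  proof (rule \<open>\<And>R. 0 < R \<Longrightarrow> K * R\<^sup>2 < pi\<^sup>2 \<Longrightarrow> 2 * pi * integral {0..R} (space_form_h K) = A \<Longrightarrow> thesis\<close>[OF that(1,2)])
    note d = less_imp_le[OF that(1)] that(2)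
    let ?y = "space_form_y K R"
    have e: "1 + ?y = 2 / (1 + space_form_c K R)" "0 < 1 + space_form_c K R"
      using space_form_y_eq[OF d] space_form_c_gt[OF d] by auto
    have "K * (pi * (space_form_s K R)\<^sup>2 / (1 + ?y)) = 4 * pi * (?y / (1 + ?y))"
      by (simp only: space_form_y_def times_divide_eq_right times_divide_eq_left) simp
    also have "?y / (1 + ?y) = 1 - 1 / (1 + ?y)"
      using space_form_y_gt[OF d] by (simp add: field_simps)
    also have "\<dots> = (1 - space_form_c K R) / 2"
      unfolding e(1) using e(2) by (simp add: field_simps)
    also have "4 * pi * ((1 - space_form_c K R) / 2) = K * A"
      by (simp add: that(3))
    finally show "2 * pi * integral {0..R} (space_form_h K) = A"
      unfolding disk_area_eq[OF d] using mult_left_cancel[OF that(4)] by blast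
  qed
  consider "K = 0" | "0 < K" | "K < 0" by linarith
  then show thesis
  proof cases
    case 1
    have "2 * pi * integral {0..sqrt (A / pi)} (space_form_h 0) = A"
      using assms disk_area_eq[of "sqrt (A / pi)" 0] by (simp add: space_form_y_def space_form_s_def space_form_h_def space_form_c_def)
    then show thesis using that[of "sqrt (A / pi)"] 1 assms by simp
  next
    case 2
    let ?x = "1 - K * A / (2 * pi)"
    have x: "-1 < ?x" "?x < 1" using 2 assms by (simp_all add: field_simps)
    have a: "0 < arccos ?x" "arccos ?x < pi" using arccos_lt_bounded[OF x] by auto
    show thesis
    proof (rule fin)
      show "0 < arccos ?x / sqrt K" using 2 a by simp
      have "(arccos ?x)\<^sup>2 < pi\<^sup>2" using a by (intro power_strict_mono) auto
      then show "K * (arccos ?x / sqrt K)\<^sup>2 < pi\<^sup>2" using 2 by (simp add: power_divide)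
      show "space_form_c K (arccos ?x / sqrt K) = ?x"
        using 2 x by (simp add: space_form_c_def cos_arccos)
    qed (use 2 in auto)
  next
    case 3
    let ?x = "1 - K * A / (2 * pi)"
    have x: "1 < ?x" using 3 assms by (simp add: mult_neg_pos divide_neg_pos)
    show thesis
    proof (rule fin)
      show R: "0 < arcosh ?x / sqrt (- K)" using 3 arcosh_real_gt_1_iff[of ?x] x by (intro divide_pos_pos) auto
      have "K * (arcosh ?x / sqrt (- K))\<^sup>2 \<le> 0" using 3 by (simp add: mult_nonpos_nonneg)
      then show "K * (arcosh ?x / sqrt (- K))\<^sup>2 < pi\<^sup>2"
        using zero_less_power[OF pi_gt_zero, of 2] by linarith
      show "space_form_c K (arcosh ?x / sqrt (- K)) = ?x"
        using 3 x by (simp add: space_form_c_def)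
    qed (use 3 in auto)
  qed
qed

lemma disk_radius:
  assumes "0 < A" "K * A < 4 * pi"
  shows "0 < disk_radius K A" "K * (disk_radius K A)\<^sup>2 < pi\<^sup>2"
    "2 * pi * integral {0..disk_radius K A} (space_form_h K) = A"
proof -
  obtain R where R: "0 < R" "K * R\<^sup>2 < pi\<^sup>2" "2 * pi * integral {0..R} (space_form_h K) = A"
    using disk_radius_exists[OF assms] .
  have "disk_radius K A = R"
    unfolding disk_radius_def
  proof (rule the_equality)
    show "0 < R \<and> ereal R < space_form_r0 K \<and> 2 * pi * integral {0..R} (space_form_h K) = A"
      using R space_form_r0_iff by blast
    fix R' assume R': "0 < R' \<and> ereal R' < space_form_r0 K \<and> 2 * pi * integral {0..R'} (space_form_h K) = A"
    then have "integral {0..R'} (space_form_h K) = integral {0..R} (space_form_h K)"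
      using R(3) by (metis mult_left_cancel mult_eq_0_iff pi_neq_zero zero_neq_numeral)
    then show "R' = R"
      using disk_area_strict_mono[of R R' K] disk_area_strict_mono[of R' R K] R R' space_form_r0_iff[of R' K]
      by (cases R R' rule: linorder_cases) auto
  qed
  then show "0 < disk_radius K A" "K * (disk_radius K A)\<^sup>2 < pi\<^sup>2"
    "2 * pi * integral {0..disk_radius K A} (space_form_h K) = A" using R by auto
qed

section \<open>Smooth functions on open sets\<close>

lemma has_derivative_cong_open:
  assumes "open U" "x \<in> U" "\<And>y. y \<in> U \<Longrightarrow> f y = g y"
  shows "(f has_derivative D) (at x) \<longleftrightarrow> (g has_derivative D) (at x)"
  using assms has_derivative_transform_within_open[of f D x UNIV U g]
    has_derivative_transform_within_open[of g D x UNIV U f] by auto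

lemma partial_deriv_cong_open:
  assumes "open U" "x \<in> U" "\<And>y. y \<in> U \<Longrightarrow> f y = g y"
  shows "partial_deriv i f x = partial_deriv i g x"
  using has_derivative_cong_open[OF assms] by (simp add: partial_deriv_def frechet_derivative_def)

lemma partial_deriv_eqI: "(f has_derivative D) (at x) \<Longrightarrow> partial_deriv i f x = D (axis i 1)"
  by (simp add: partial_deriv_def frechet_derivative_at[symmetric])

text \<open>Openness of U is essential: \<open>partial_deriv\<close> sees a full neighbourhood of
  the point.\<close>

lemma Ck_on_cong:
  assumes "open U" "\<And>x. x \<in> U \<Longrightarrow> f x = g x" "Ck_on k U f"
  shows "Ck_on k U g"
  using assms(2,3)
proof (induction k arbitrary: f g)
  case 0
  then show ?case using continuous_on_cong[of U U f g] by simp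
next
  case (Suc k)
  have "g differentiable_on U"
    using Suc.prems has_derivative_cong_open[OF assms(1), of _ f g]
    unfolding differentiable_on_eq_differentiable_at[OF assms(1)] Ck_on.simps differentiable_def by blast
  moreover have "Ck_on k U (partial_deriv i g)" for i
    by (rule Suc.IH[of "partial_deriv i f"])
       (use Suc.prems partial_deriv_cong_open[OF assms(1), of _ f g i] in auto)
  ultimately show ?case by simp
qed

lemma Ck_on_Suc_imp: "Ck_on (Suc k) U f \<Longrightarrow> Ck_on k U f"
  by (induction k arbitrary: f) (auto intro: differentiable_imp_continuous_on)

lemma Ck_on_subset: "Ck_on k U f \<Longrightarrow> V \<subseteq> U \<Longrightarrow> Ck_on k V f"
  by (induction k arbitrary: f) (auto intro: continuous_on_subset differentiable_on_subset)

lemma Ck_on_const: "Ck_on k U (\<lambda>x. c)"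
proof (induction k arbitrary: c)
  case (Suc k)
  have "partial_deriv i (\<lambda>x. c) = (\<lambda>x. 0)" for i :: 'a
    by (rule ext) (simp add: partial_deriv_eqI[OF has_derivative_const])
  then show ?case using Suc by simp
qed (simp add: continuous_on_const)

lemma Ck_on_nth: "Ck_on k U (\<lambda>x. x $ j)"
proof (cases k)
  case (Suc k')
  have d: "((\<lambda>x. x $ j) has_derivative (\<lambda>x. x $ j)) (at x)" for x :: "real^'a"
    by (rule bounded_linear_imp_has_derivative) (rule bounded_linear_vec_nth)
  have "partial_deriv i (\<lambda>x. x $ j) = (\<lambda>x. if i = j then 1 else 0)" for i :: 'a
    by (rule ext) (simp add: partial_deriv_eqI[OF d] axis_def)
  then show ?thesis
    using Suc Ck_on_const[of k' U] d
    by (auto intro!: differentiable_at_imp_differentiable_on differentiableI)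
qed (auto intro: continuous_intros)

lemma Ck_on_has_derivative:
  assumes "open U" "Ck_on (Suc k) U f" "x \<in> U"
  shows "(f has_derivative frechet_derivative f (at x)) (at x)"
  using assms by (simp add: differentiable_on_eq_differentiable_at frechet_derivative_works)

lemma Ck_on_add:
  assumes "open U" "Ck_on k U f" "Ck_on k U g"
  shows "Ck_on k U (\<lambda>x. f x + g x)"
  using assms(2,3)
proof (induction k arbitrary: f g)
  case 0
  then show ?case by (auto intro: continuous_on_add)
next
  case (Suc k)
  have "Ck_on k U (partial_deriv i (\<lambda>x. f x + g x))" for i
  proof (rule Ck_on_cong[OF assms(1) _ Suc.IH])
    fix x assume x: "x \<in> U"
    show "partial_deriv i f x + partial_deriv i g x = partial_deriv i (\<lambda>x. f x + g x) x"
      using partial_deriv_eqI[OF has_derivative_add[OF Ck_on_has_derivative[OF assms(1) Suc.prems(1) x]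
          Ck_on_has_derivative[OF assms(1) Suc.prems(2) x]], of i]
      by (simp add: partial_deriv_def)
  qed (use Suc.prems in auto)
  then show ?case using Suc.prems by (auto intro: differentiable_on_add)
qed

lemma Ck_on_mult:
  assumes "open U" "Ck_on k U f" "Ck_on k U g"
  shows "Ck_on k U (\<lambda>x. f x * g x)"
  using assms(2,3)
proof (induction k arbitrary: f g)
  case 0
  then show ?case by (auto intro: continuous_on_mult)
next
  case (Suc k)
  have "Ck_on k U (partial_deriv i (\<lambda>x. f x * g x))" for i
  proof (rule Ck_on_cong[OF assms(1) _ Ck_on_add[OF assms(1)]])
    fix x assume x: "x \<in> U"
    show "f x * partial_deriv i g x + partial_deriv i f x * g x = partial_deriv i (\<lambda>x. f x * g x) x"
      using partial_deriv_eqI[OF has_derivative_mult[OF Ck_on_has_derivative[OF assms(1) Suc.prems(1) x]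
          Ck_on_has_derivative[OF assms(1) Suc.prems(2) x]], of i]
      by (simp add: partial_deriv_def)
  next
    show "Ck_on k U (\<lambda>x. f x * partial_deriv i g x)" "Ck_on k U (\<lambda>x. partial_deriv i f x * g x)"
      using Suc.prems Ck_on_Suc_imp by (auto intro!: Suc.IH)
  qed
  then show ?case using Suc.prems by (auto intro: differentiable_on_mult)
qed

text \<open>\<phi> is a whole tower of successive derivatives, and the induction keeps n arbitrary.
  Reciprocals, power series and \<open>kint\<close> are all handled by naming their towers.\<close>

lemma Ck_on_compose:
  fixes \<phi> :: "nat \<Rightarrow> real \<Rightarrow> real"
  assumes "open U" "Ck_on k U p" "p ` U \<subseteq> I"
    "\<And>n t. t \<in> I \<Longrightarrow> (\<phi> n has_real_derivative \<phi> (Suc n) t) (at t)"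
  shows "Ck_on k U (\<lambda>x. \<phi> n (p x))"
  using assms(2)
proof (induction k arbitrary: n)
  case 0
  have "continuous_on I (\<phi> n)"
    using assms(4) by (auto intro!: continuous_at_imp_continuous_on DERIV_isCont)
  then show ?case using 0 assms(3) by (auto intro: continuous_on_compose2)
next
  case (Suc k)
  have d: "((\<lambda>x. \<phi> n (p x)) has_derivative (\<lambda>h. \<phi> (Suc n) (p x) * frechet_derivative p (at x) h)) (at x)"
    if "x \<in> U" for x
  proof -
    have "(\<phi> n has_derivative (*) (\<phi> (Suc n) (p x))) (at (p x))"
      using assms(3,4) that unfolding has_field_derivative_def by blast
    from has_derivative_compose[OF Ck_on_has_derivative[OF assms(1) Suc.prems that] this]
    show ?thesis .
  qed
  have "Ck_on k U (partial_deriv i (\<lambda>x. \<phi> n (p x)))" for i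
  proof (rule Ck_on_cong[OF assms(1) _ Ck_on_mult[OF assms(1) Suc.IH]])
    fix x assume x: "x \<in> U"
    show "\<phi> (Suc n) (p x) * partial_deriv i p x = partial_deriv i (\<lambda>x. \<phi> n (p x)) x"
      using partial_deriv_eqI[OF d[OF x], of i] by (simp add: partial_deriv_def)
  qed (use Suc.prems Ck_on_Suc_imp in auto)
  then show ?case
    using d by (auto simp: differentiable_on_eq_differentiable_at[OF assms(1)] intro: differentiableI)
qed

definition Cinf :: "(real^'n::finite) set \<Rightarrow> (real^'n \<Rightarrow> real) \<Rightarrow> bool" where
  "Cinf U f \<longleftrightarrow> (\<forall>k. Ck_on k U f)"

lemma Cinf_cong: "open U \<Longrightarrow> (\<And>x. x \<in> U \<Longrightarrow> f x = g x) \<Longrightarrow> Cinf U f \<Longrightarrow> Cinf U g"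
  unfolding Cinf_def using Ck_on_cong by blast

lemma Cinf_subset: "Cinf U f \<Longrightarrow> V \<subseteq> U \<Longrightarrow> Cinf V f"
  unfolding Cinf_def using Ck_on_subset by blast

lemma Cinf_const: "Cinf U (\<lambda>x. c)" and Cinf_nth: "Cinf U (\<lambda>x. x $ j)"
  unfolding Cinf_def using Ck_on_const Ck_on_nth by auto

lemma Cinf_add: "open U \<Longrightarrow> Cinf U f \<Longrightarrow> Cinf U g \<Longrightarrow> Cinf U (\<lambda>x. f x + g x)"
  and Cinf_mult: "open U \<Longrightarrow> Cinf U f \<Longrightarrow> Cinf U g \<Longrightarrow> Cinf U (\<lambda>x. f x * g x)"
  unfolding Cinf_def by (blast intro: Ck_on_add Ck_on_mult)+

lemma Cinf_diff:
  assumes "open U" "Cinf U f" "Cinf U g" shows "Cinf U (\<lambda>x. f x - g x)"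
  using Cinf_add[OF assms(1,2) Cinf_mult[OF assms(1) Cinf_const[of _ "-1"] assms(3)]] by simp

lemma Cinf_power: "open U \<Longrightarrow> Cinf U f \<Longrightarrow> Cinf U (\<lambda>x. f x ^ n)"
  by (induction n) (auto intro: Cinf_const Cinf_mult)

lemma Cinf_partial_deriv: "Cinf U f \<Longrightarrow> Cinf U (partial_deriv i f)"
  unfolding Cinf_def using Ck_on.simps(2) by blast

lemma Cinf_continuous_on: "Cinf U f \<Longrightarrow> continuous_on U f"
  unfolding Cinf_def using Ck_on.simps(1) by blast

lemma Cinf_compose:
  fixes \<phi> :: "nat \<Rightarrow> real \<Rightarrow> real"
  assumes "open U" "Cinf U p" "p ` U \<subseteq> I"
    "\<And>n t. t \<in> I \<Longrightarrow> (\<phi> n has_real_derivative \<phi> (Suc n) t) (at t)"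
  shows "Cinf U (\<lambda>x. \<phi> n (p x))"
  unfolding Cinf_def
proof
  fix k show "Ck_on k U (\<lambda>x. \<phi> n (p x))"
  proof (rule Ck_on_compose[where \<phi> = \<phi> and I = I, OF assms(1)])
    show "Ck_on k U p" using assms(2) by (simp add: Cinf_def)
  qed (use assms(3,4) in auto)
qed

lemma Cinf_inverse:
  assumes "open U" "Cinf U f" "\<And>x. x \<in> U \<Longrightarrow> f x \<noteq> 0"
  shows "Cinf U (\<lambda>x. 1 / f x)"
proof -
  let ?\<phi> = "\<lambda>n t. (- 1) ^ n * fact n * (1 / t ^ Suc n) :: real"
  have "Cinf U (\<lambda>x. ?\<phi> 0 (f x))"
  proof (rule Cinf_compose[OF assms(1,2), where I = "- {0}" and \<phi> = ?\<phi>])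
    fix n and t :: real assume "t \<in> - {0}"
    then have "(?\<phi> n has_real_derivative (- 1) ^ n * fact n * (- real (Suc n) * (1 / t ^ Suc (Suc n)))) (at t)"
      by (intro DERIV_cmult deriv_inverse_power DERIV_ident) auto
    moreover have "(- 1) ^ n * fact n * (- real (Suc n) * x) = (- 1) ^ Suc n * fact (Suc n) * x" for x :: real
      by (simp add: algebra_simps)
    ultimately show "(?\<phi> n has_real_derivative ?\<phi> (Suc n) t) (at t)" by metis
  qed (use assms(3) in auto)
  then show ?thesis by simp
qed

lemma Cinf_divide:
  assumes "open U" "Cinf U f" "Cinf U g" "\<And>x. x \<in> U \<Longrightarrow> g x \<noteq> 0"
  shows "Cinf U (\<lambda>x. f x / g x)"
  using Cinf_mult[OF assms(1,2) Cinf_inverse[OF assms(1,3,4)]] by simp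

lemma Cinf_power_series:
  assumes "open U" "Cinf U p" "\<And>x. summable (\<lambda>n. a n * x ^ n)"
  shows "Cinf U (\<lambda>x. \<Sum>n. a n * p x ^ n)"
proof -
  have s: "summable (\<lambda>j. (diffs ^^ n) a j * x ^ j)" for n and x :: real
    by (induction n arbitrary: x) (auto intro: assms(3) termdiff_converges_all)
  have "Cinf U (\<lambda>x. (\<lambda>n t. \<Sum>j. (diffs ^^ n) a j * t ^ j) 0 (p x))"
    by (rule Cinf_compose[OF assms(1,2), where I = UNIV and \<phi> = "\<lambda>n t. \<Sum>j. (diffs ^^ n) a j * t ^ j"])
       (auto intro!: termdiffs_strong_converges_everywhere s)
  then show ?thesis by simp
qed

lemma Cinf_norm_sq: "open U \<Longrightarrow> Cinf U (\<lambda>x :: real^2. (norm x)\<^sup>2)"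
  by (rule Cinf_cong[where f = "\<lambda>x. x $ 1 * x $ 1 + x $ 2 * x $ 2"])
     (auto intro!: Cinf_add Cinf_mult Cinf_nth simp: power2_norm_eq_inner inner_vec_def sum_2)

lemma Cinf_has_derivative:
  fixes f :: "real^2 \<Rightarrow> real"
  assumes "open U" "Cinf U f" "x \<in> U"
  shows "(f has_derivative (\<lambda>h. partial_deriv 1 f x * h $ 1 + partial_deriv 2 f x * h $ 2)) (at x)"
proof -
  have d: "(f has_derivative frechet_derivative f (at x)) (at x)"
    using assms Ck_on_has_derivative unfolding Cinf_def by blast
  interpret linear "frechet_derivative f (at x)"
    using has_derivative_linear[OF d] .
  have "frechet_derivative f (at x) h = partial_deriv 1 f x * h $ 1 + partial_deriv 2 f x * h $ 2" for h
  proof -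
    have "h = h $ 1 *\<^sub>R axis 1 1 + h $ 2 *\<^sub>R axis 2 1"
      by (simp add: vec_eq_iff forall_2 axis_def)
    then have "frechet_derivative f (at x) h = frechet_derivative f (at x) (h $ 1 *\<^sub>R axis 1 1 + h $ 2 *\<^sub>R axis 2 1)"
      by simp
    then show ?thesis by (simp only: add scale partial_deriv_def real_scaleR_def mult.commute)
  qed
  then show ?thesis using d by (metis (no_types, lifting) ext)
qed

section \<open>The Laplacian of a space form in normal coordinates\<close>

text \<open>The power series of h(r) / r in q = r^2. Evaluated at (norm x)^2 it is smooth at the
  pole and needs no case distinction on K.\<close>

definition h_series :: "real \<Rightarrow> real \<Rightarrow> real" where
  "h_series K q = (\<Sum>n. (- K) ^ n / fact (2 * n + 1) * q ^ n)"

definition c_series :: "real \<Rightarrow> real \<Rightarrow> real" where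
  "c_series K q = (\<Sum>n. (- K) ^ n / fact (2 * n) * q ^ n)"

text \<open>The series of (H - 1) / q with H = \<open>h_series K q\<close>; it resolves the
  quotients x_i x_j / r^2 in the metric.\<close>

definition h1_series :: "real \<Rightarrow> real \<Rightarrow> real" where
  "h1_series K q = (\<Sum>n. (- K) ^ Suc n / fact (2 * n + 3) * q ^ n)"

lemma summable_exp_like:
  fixes K q :: real
  assumes "\<And>n. n \<le> f n"
  shows "summable (\<lambda>n. (- K) ^ n / fact (f n) * q ^ n)"
proof (rule summable_comparison_test'[OF summable_exp[of "\<bar>K\<bar> * \<bar>q\<bar>"]])
  fix n
  have "inverse (fact (f n)) \<le> (inverse (fact n) :: real)"
    by (rule le_imp_inverse_le) (use assms fact_mono in auto)
  then have "inverse (fact (f n)) * (\<bar>K\<bar> * \<bar>q\<bar>) ^ n \<le> inverse (fact n) * (\<bar>K\<bar> * \<bar>q\<bar>) ^ n"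
    by (rule mult_right_mono) simp
  then show "norm ((- K) ^ n / fact (f n) * q ^ n) \<le> inverse (fact n) * (\<bar>K\<bar> * \<bar>q\<bar>) ^ n"
    by (simp add: abs_mult power_abs divide_inverse power_mult_distrib mult_ac)
qed

lemma summable_h: "summable (\<lambda>n. (- K) ^ n / fact (2 * n + 1) * q ^ n)" for K q :: real
  by (rule summable_exp_like) simp

lemma summable_c: "summable (\<lambda>n. (- K) ^ n / fact (2 * n) * q ^ n)" for K q :: real
  by (rule summable_exp_like) simp

lemma summable_h1: "summable (\<lambda>n. (- K) ^ Suc n / fact (2 * n + 3) * q ^ n)" for K q :: real
  using summable_mult[OF summable_exp_like[of "\<lambda>n. 2 * n + 3" K q], of "- K"] by (simp add: mult_ac)

lemma h_series_0: "h_series K 0 = 1" and c_series_0: "c_series K 0 = 1"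
  unfolding h_series_def c_series_def powser_zero by simp_all

lemma h_series_eq_h1: "h_series K q = 1 + q * h1_series K q"
proof -
  have "h_series K q = (\<Sum>n. (- K) ^ Suc n / fact (2 * Suc n + 1) * q ^ Suc n) + 1"
    unfolding h_series_def using suminf_split_head[OF summable_h[of K q]] by simp
  also have "(\<Sum>n. (- K) ^ Suc n / fact (2 * Suc n + 1) * q ^ Suc n)
      = (\<Sum>n. q * ((- K) ^ Suc n / fact (2 * n + 3) * q ^ n))"
    by (rule suminf_cong) (simp add: eval_nat_numeral mult_ac)
  also have "\<dots> = q * h1_series K q"
    unfolding h1_series_def by (rule suminf_mult[OF summable_h1])
  finally show ?thesis by simp
qed

lemma c_series_deriv: "(c_series K has_real_derivative - K / 2 * h_series K q) (at q)"
proof -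
  let ?a = "\<lambda>n. (- K) ^ n / fact (2 * n)"
  have d: "(c_series K has_real_derivative (\<Sum>n. diffs ?a n * q ^ n)) (at q)"
    unfolding c_series_def[abs_def]
    by (rule termdiffs_strong_converges_everywhere) (rule summable_c)
  have e: "diffs ?a n * q ^ n = - K / 2 * ((- K) ^ n / fact (2 * n + 1) * q ^ n)" for n
  proof -
    have f: "fact (2 * Suc n) = 2 * real (Suc n) * fact (2 * n + 1)"
      by (simp add: algebra_simps)
    have "real (Suc n) * (K * x) / (2 * real (Suc n) * F) = K / 2 * (x / F)" if "F \<noteq> 0" for F x
      using that by (simp add: divide_simps del: of_nat_Suc)
    from this[of "fact (2 * n + 1)" "(- K) ^ n"] show ?thesis
      unfolding diffs_def f by (simp del: of_nat_Suc fact_Suc)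
  qed
  show ?thesis
    using d unfolding e suminf_mult[OF summable_h] h_series_def .
qed

text \<open>This is (r H)' = C written in q = r^2; on coefficients, (2 n + 1) / (2 n + 1)! = 1 / (2
  n)!.\<close>

lemma h_series_deriv:
  obtains h' where "(h_series K has_real_derivative h') (at q)" "2 * q * h' = c_series K q - h_series K q"
proof -
  let ?a = "\<lambda>n. (- K) ^ n / fact (2 * n + 1)"
  let ?h' = "\<Sum>n. diffs ?a n * q ^ n"
  have d: "(h_series K has_real_derivative ?h') (at q)"
    unfolding h_series_def[abs_def]
    by (rule termdiffs_strong_converges_everywhere) (rule summable_h)
  have "summable (\<lambda>n. diffs ?a n * q ^ n)"
    by (rule termdiff_converges_all) (rule summable_h)
  then have "(\<lambda>n. real n * ?a n * q ^ (n - Suc 0)) sums ?h'" by (rule diffs_equiv)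
  then have "(\<lambda>n. 2 * q * (real n * ?a n * q ^ (n - Suc 0))) sums (2 * q * ?h')" by (rule sums_mult)
  moreover have "2 * q * (real n * A * q ^ (n - Suc 0)) = 2 * real n * A * q ^ n" for n A
    by (cases n) (auto simp del: of_nat_Suc)
  ultimately have "(\<lambda>n. 2 * real n * ?a n * q ^ n) sums (2 * q * ?h')" by simp
  then have "(\<lambda>n. 2 * real n * ?a n * q ^ n + ?a n * q ^ n) sums (2 * q * ?h' + h_series K q)"
    unfolding h_series_def by (intro sums_add summable_sums summable_h)
  moreover have "2 * real n * ?a n * q ^ n + ?a n * q ^ n = (- K) ^ n / fact (2 * n) * q ^ n" for n
  proof -
    have f: "fact (2 * n + 1) = (2 * real n + 1) * fact (2 * n)"
      by (simp add: algebra_simps)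
    have "2 * real n * ?a n * q ^ n + ?a n * q ^ n = (2 * real n + 1) * ?a n * q ^ n"
      by (simp only: distrib_right mult_1_left)
    also have "(2 * real n + 1) * ?a n = (- K) ^ n / fact (2 * n)"
      unfolding f by (simp add: add_eq_0_iff_both_eq_0 del: fact_Suc)
    finally show ?thesis .
  qed
  ultimately have "2 * q * ?h' + h_series K q = c_series K q"
    unfolding c_series_def by (simp add: sums_unique)
  then show thesis using that[OF d] by (simp add: algebra_simps)
qed

text \<open>Both pairs (f, C) and (h, c) solve f' = C, C' = - K f with the same initial values.
  Hence f c - C h and C c + K f h are constant, equal to 0 and 1, and c^2 + K h^2 = 1 allows solving
  for f and C for every sign of K.\<close>

lemma series_eq_space_form: "r * h_series K (r\<^sup>2) = space_form_h K r \<and> c_series K (r\<^sup>2) = space_form_c K r"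
proof -
  let ?f = "\<lambda>r. r * h_series K (r\<^sup>2)" and ?C = "\<lambda>r. c_series K (r\<^sup>2)"
  let ?h = "space_form_h K" and ?c = "space_form_c K"
  have sq: "((\<lambda>r. r\<^sup>2) has_real_derivative 2 * r) (at r)" for r :: real
    by (auto intro!: derivative_eq_intros)
  have C: "(?C has_real_derivative - K * ?f r) (at r)" for r
    by (rule DERIV_cong[OF DERIV_chain2[OF c_series_deriv sq]]) simp
  have f: "(?f has_real_derivative ?C r) (at r)" for r
  proof -
    obtain h' where h': "(h_series K has_real_derivative h') (at (r\<^sup>2))"
      "2 * r\<^sup>2 * h' = c_series K (r\<^sup>2) - h_series K (r\<^sup>2)" by (rule h_series_deriv)
    show ?thesis
      by (rule DERIV_cong[OF DERIV_mult'[OF DERIV_ident DERIV_chain2[OF h'(1) sq]]])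
         (use h'(2) in \<open>simp add: power2_eq_square algebra_simps\<close>)
  qed
  have "((\<lambda>r. ?f r * ?c r - ?C r * ?h r) has_real_derivative
      (?f r * (- K * ?h r) + ?C r * ?c r) - (?C r * ?c r + (- K * ?f r) * ?h r)) (at r)" for r
    by (intro DERIV_diff DERIV_mult' f C space_form_h_deriv space_form_c_deriv)
  then have "\<And>r. ((\<lambda>r. ?f r * ?c r - ?C r * ?h r) has_real_derivative 0) (at r)"
    by (simp add: algebra_simps)
  from DERIV_isconst_all[OF allI[OF this], of r 0] have P: "?f r * ?c r = ?C r * ?h r" by simp
  have "((\<lambda>r. ?C r * ?c r + K * (?f r * ?h r)) has_real_derivative
      (?C r * (- K * ?h r) + (- K * ?f r) * ?c r) + K * (?f r * ?c r + ?C r * ?h r)) (at r)" for r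
    by (intro DERIV_add DERIV_mult' DERIV_cmult f C space_form_h_deriv space_form_c_deriv)
  then have "\<And>r. ((\<lambda>r. ?C r * ?c r + K * (?f r * ?h r)) has_real_derivative 0) (at r)"
    by (simp add: algebra_simps)
  from DERIV_isconst_all[OF allI[OF this], of r 0] have Q: "?C r * ?c r + K * (?f r * ?h r) = 1"
    by (simp add: c_series_0)
  have py: "?c r * ?c r + K * (?h r * ?h r) = 1"
    using space_form_pythagoras[of K r] by (simp add: power2_eq_square)
  have "?f r = ?f r * (?c r * ?c r + K * (?h r * ?h r))" unfolding py by simp
  also have "\<dots> = (?f r * ?c r) * ?c r + K * ?f r * ?h r * ?h r" by (simp add: algebra_simps)
  also have "\<dots> = ?h r * (?C r * ?c r + K * (?f r * ?h r))" unfolding P by (simp add: algebra_simps)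
  finally have 1: "?f r = ?h r" unfolding Q by simp
  have "?C r = ?C r * (?c r * ?c r + K * (?h r * ?h r))" unfolding py by simp
  also have "\<dots> = ?c r * (?C r * ?c r) + K * ?h r * (?C r * ?h r)" by (simp add: algebra_simps)
  also have "\<dots> = ?c r * (?C r * ?c r + K * (?f r * ?h r))" unfolding P[symmetric] by (simp add: algebra_simps)
  finally show ?thesis using 1 unfolding Q by simp
qed

definition space_form_domain :: "real \<Rightarrow> (real^2) set" where
  "space_form_domain K = {x. K * (norm x)\<^sup>2 < pi\<^sup>2}"

lemma open_space_form_domain: "open (space_form_domain K)"
  unfolding space_form_domain_def by (intro open_Collect_less continuous_intros)

lemma h_series_pos: "x \<in> space_form_domain K \<Longrightarrow> 0 < h_series K ((norm x)\<^sup>2)"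
proof (cases "x = 0")
  case False
  assume "x \<in> space_form_domain K"
  then have "0 < space_form_h K (norm x)"
    using space_form_h_pos[of "norm x" K] False by (simp add: space_form_domain_def)
  then show ?thesis
    using series_eq_space_form[of "norm x" K] False by (metis zero_less_mult_pos zero_less_norm_iff)
qed (simp add: h_series_0)

lemma c_series_gt: "x \<in> space_form_domain K \<Longrightarrow> -1 < c_series K ((norm x)\<^sup>2)"
  using space_form_c_gt[of "norm x" K] series_eq_space_form[of "norm x" K] by (simp add: space_form_domain_def)

lemma norm_sq_2: "(norm x)\<^sup>2 = x $ 1 * x $ 1 + x $ 2 * x $ 2" for x :: "real^2"
  by (simp add: power2_norm_eq_inner inner_vec_def sum_2)

text \<open>As H = 1 + q H1, the quotient (H^2 - 1) / q is H1 (H + 1); this removes the division by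
  \<open>norm x\<close> and shows the Gram matrix to be smooth at the pole.\<close>

lemma space_form_metric_eq:
  "space_form_metric K x = (\<chi> i j. (if i = j then (h_series K ((norm x)\<^sup>2))\<^sup>2 else 0)
      - h1_series K ((norm x)\<^sup>2) * (h_series K ((norm x)\<^sup>2) + 1) * (x $ i * x $ j))"
proof (cases "x = 0")
  case True
  have z: "(h_series K ((norm (0 :: real^2))\<^sup>2))\<^sup>2 = 1" by (simp add: h_series_0)
  show ?thesis unfolding True space_form_metric_def mat_def z by simp
next
  case False
  let ?H = "h_series K ((norm x)\<^sup>2)" and ?H1 = "h1_series K ((norm x)\<^sup>2)"
  have "space_form_h K (norm x) / norm x = ?H"
    using False series_eq_space_form[of "norm x" K] by (simp add: field_simps)
  then have "space_form_metric K x = (\<chi> i j. x $ i * x $ j / (norm x)\<^sup>2 +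
      ?H\<^sup>2 * ((if i = j then 1 else 0) - x $ i * x $ j / (norm x)\<^sup>2))"
    using False by (simp add: space_form_metric_def)
  also have "\<dots> = (\<chi> i j. (if i = j then ?H\<^sup>2 else 0) - ?H1 * (?H + 1) * (x $ i * x $ j))"
  proof -
    have "P / q + A * (d - P / q) = A * d - e * P" if "A = 1 + q * e" "q \<noteq> 0" for P q A d e :: real
      unfolding that(1) using that(2) by (simp add: field_simps)
    moreover have "?H\<^sup>2 = 1 + (norm x)\<^sup>2 * (?H1 * (?H + 1))"
      using h_series_eq_h1[of K "(norm x)\<^sup>2"] by (simp add: power2_eq_square algebra_simps)
    ultimately have "x $ i * x $ j / (norm x)\<^sup>2 + ?H\<^sup>2 * ((if i = j then 1 else 0) - x $ i * x $ j / (norm x)\<^sup>2)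
        = ?H\<^sup>2 * (if i = j then 1 else 0) - ?H1 * (?H + 1) * (x $ i * x $ j)" for i j
      using False by (metis norm_eq_zero power_eq_0_iff)
    then show ?thesis by (simp only: if_distrib mult_1_right mult_zero_right cong: if_cong)
  qed
  finally show ?thesis .
qed

lemma matrix_inv_eqI:
  fixes A B :: "real^'n^'n"
  assumes "A ** B = mat 1" "B ** A = mat 1" shows "matrix_inv A = B"
proof -
  have "matrix_inv A = matrix_inv A ** (A ** B)" using assms by simp
  also have "\<dots> = (matrix_inv A ** A) ** B" by (simp add: matrix_mul_assoc)
  also have "matrix_inv A ** A = mat 1"
    using assms someI_ex[of "\<lambda>B. A ** B = mat 1 \<and> B ** A = mat 1"] unfolding matrix_inv_def by blast
  finally show ?thesis by simp
qed

text \<open>The Gram matrix has eigenvalue 1 along x and H^2 across it, hence determinant H^2 and an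
  inverse that is again a multiple of the identity plus a multiple of x x^T.\<close>

lemma space_form_metric_inverse:
  assumes "x \<in> space_form_domain K"
  defines "H \<equiv> h_series K ((norm x)\<^sup>2)" and "H1 \<equiv> h1_series K ((norm x)\<^sup>2)"
  shows "sqrt (det (space_form_metric K x)) = H"
    and "matrix_inv (space_form_metric K x)
      = (\<chi> i j. (if i = j then 1 / H\<^sup>2 else 0) + H1 * (H + 1) / H\<^sup>2 * (x $ i * x $ j))"
proof -
  have H: "0 < H" using h_series_pos[OF assms(1)] by (simp add: H_def)
  define e where "e = H1 * (H + 1)"
  have e: "(x $ 1 * x $ 1 + x $ 2 * x $ 2) * e = H\<^sup>2 - 1"
    using h_series_eq_h1[of K "(norm x)\<^sup>2"] unfolding norm_sq_2[symmetric]
    by (simp add: e_def H_def H1_def power2_eq_square algebra_simps)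
  have g: "space_form_metric K x = (\<chi> i j. (if i = j then H\<^sup>2 else 0) - e * (x $ i * x $ j))"
    unfolding space_form_metric_eq e_def H_def H1_def by simp
  have "det (space_form_metric K x) = H\<^sup>2 * (H\<^sup>2 - (x $ 1 * x $ 1 + x $ 2 * x $ 2) * e)"
    unfolding g by (simp add: det_2 algebra_simps)
  then show "sqrt (det (space_form_metric K x)) = H" using H unfolding e by simp
  let ?B = "\<chi> i j. (if i = j then 1 / H\<^sup>2 else 0) + e / H\<^sup>2 * (x $ i * x $ j)"
  \<comment> \<open>The relation for e enters the matrix products multiplied by e and two
    coordinates, so it is supplied in that form.\<close>
  have s: "e * (H\<^sup>2 - 1) = e * (e * (x $ 1 * x $ 1 + x $ 2 * x $ 2))"
    using e by (simp add: mult.commute)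
  have "space_form_metric K x ** ?B = mat 1" "?B ** space_form_metric K x = mat 1"
    unfolding g matrix_matrix_mult_def mat_def
    using H arg_cong[OF s, of "\<lambda>t. x $ 1 * x $ 1 * t"] arg_cong[OF s, of "\<lambda>t. x $ 1 * x $ 2 * t"]
      arg_cong[OF s, of "\<lambda>t. x $ 2 * x $ 2 * t"]
    by (simp_all add: vec_eq_iff sum_2 forall_2 field_simps power2_eq_square)
  then show "matrix_inv (space_form_metric K x)
      = (\<chi> i j. (if i = j then 1 / H\<^sup>2 else 0) + H1 * (H + 1) / H\<^sup>2 * (x $ i * x $ j))"
    unfolding e_def[symmetric] by (rule matrix_inv_eqI)
qed

text \<open>The Euler field \<open>x \<bullet> \<nabla>\<close> is \<open>r \<partial>\<^sub>r\<close>, and the rotation field is \<open>\<partial>\<^sub>\<theta>\<close>.\<close>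

definition euler_op :: "(real^2 \<Rightarrow> real) \<Rightarrow> real^2 \<Rightarrow> real" where
  "euler_op u x = x $ 1 * partial_deriv 1 u x + x $ 2 * partial_deriv 2 u x"

definition rot_op :: "(real^2 \<Rightarrow> real) \<Rightarrow> real^2 \<Rightarrow> real" where
  "rot_op u x = x $ 1 * partial_deriv 2 u x - x $ 2 * partial_deriv 1 u x"

text \<open>Component i of sqrt (det g) times the gradient, with the inverse metric written
  out.\<close>

definition space_form_flux :: "real \<Rightarrow> (real^2 \<Rightarrow> real) \<Rightarrow> 2 \<Rightarrow> real^2 \<Rightarrow> real" where
  "space_form_flux K u i x = partial_deriv i u x / h_series K ((norm x)\<^sup>2)
     + h1_series K ((norm x)\<^sup>2) * (h_series K ((norm x)\<^sup>2) + 1) / h_series K ((norm x)\<^sup>2) * (x $ i * euler_op u x)"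

lemma laplace_beltrami_eq_flux:
  assumes "x \<in> space_form_domain K"
  shows "laplace_beltrami (space_form_metric K) u x =
    (partial_deriv 1 (space_form_flux K u 1) x + partial_deriv 2 (space_form_flux K u 2) x) / h_series K ((norm x)\<^sup>2)"
proof -
  have "sqrt (det (space_form_metric K y)) * riemannian_grad (space_form_metric K) u y $ i = space_form_flux K u i y"
    if y: "y \<in> space_form_domain K" for y i
  proof -
    note g = space_form_metric_inverse[OF y]
    define H e where "H = h_series K ((norm y)\<^sup>2)" and "e = h1_series K ((norm y)\<^sup>2) * (h_series K ((norm y)\<^sup>2) + 1)"
    have H: "0 < H" using h_series_pos[OF y] by (simp add: H_def)
    have "i = 1 \<or> i = 2" using exhaust_2 by blast
    then show ?thesis
      unfolding riemannian_grad_def g matrix_vector_mult_def space_form_flux_def euler_op_def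
      unfolding H_def[symmetric] e_def[symmetric]
      using H by (auto simp: sum_2 field_simps power2_eq_square)
  qed
  from partial_deriv_cong_open[OF open_space_form_domain assms this]
  show ?thesis
    unfolding laplace_beltrami_def riemannian_div_def space_form_metric_inverse(1)[OF assms]
    by (simp add: sum_2)
qed

context
  fixes U :: "(real^2) set" and K :: real
  assumes U: "open U" "U \<subseteq> space_form_domain K"
begin

lemma Cinf_h_series: "Cinf U (\<lambda>x. h_series K ((norm x)\<^sup>2))"
  unfolding h_series_def by (rule Cinf_power_series[OF U(1) Cinf_norm_sq[OF U(1)] summable_h])

lemma Cinf_c_series: "Cinf U (\<lambda>x. c_series K ((norm x)\<^sup>2))"
  unfolding c_series_def by (rule Cinf_power_series[OF U(1) Cinf_norm_sq[OF U(1)] summable_c])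

lemma Cinf_h1_series: "Cinf U (\<lambda>x. h1_series K ((norm x)\<^sup>2))"
  unfolding h1_series_def by (rule Cinf_power_series[OF U(1) Cinf_norm_sq[OF U(1)] summable_h1])

lemma Cinf_euler_op: "Cinf U u \<Longrightarrow> Cinf U (euler_op u)"
  unfolding euler_op_def[abs_def] by (intro Cinf_add Cinf_mult Cinf_nth Cinf_partial_deriv U)

lemma Cinf_rot_op: "Cinf U u \<Longrightarrow> Cinf U (rot_op u)"
  unfolding rot_op_def[abs_def] by (intro Cinf_diff Cinf_mult Cinf_nth Cinf_partial_deriv U)

lemma h_series_nz: "x \<in> U \<Longrightarrow> h_series K ((norm x)\<^sup>2) \<noteq> 0"
  using h_series_pos U(2) by fastforce

lemma Cinf_flux: "Cinf U u \<Longrightarrow> Cinf U (space_form_flux K u i)"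
  unfolding space_form_flux_def[abs_def]
  by (intro Cinf_add Cinf_mult Cinf_divide Cinf_h_series Cinf_h1_series Cinf_const Cinf_nth Cinf_euler_op
      Cinf_partial_deriv U h_series_nz)

lemma Cinf_laplace_beltrami:
  assumes "Cinf U u" shows "Cinf U (laplace_beltrami (space_form_metric K) u)"
proof (rule Cinf_cong[OF U(1)])
  show "Cinf U (\<lambda>x. (partial_deriv 1 (space_form_flux K u 1) x + partial_deriv 2 (space_form_flux K u 2) x)
      / h_series K ((norm x)\<^sup>2))"
    by (intro Cinf_add Cinf_divide Cinf_h_series Cinf_partial_deriv Cinf_flux U h_series_nz assms)
qed (use U(2) laplace_beltrami_eq_flux in auto)

end

lemma Cinf_frechet_derivative:
  assumes "open U" "Cinf U f" "x \<in> U"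
  shows "(f has_derivative frechet_derivative f (at x)) (at x)"
  using assms Ck_on_has_derivative unfolding Cinf_def by blast

lemma partial_deriv_add:
  assumes "open U" "Cinf U f" "Cinf U g" "x \<in> U"
  shows "partial_deriv i (\<lambda>x. f x + g x) x = partial_deriv i f x + partial_deriv i g x"
  using partial_deriv_eqI[OF has_derivative_add[OF Cinf_frechet_derivative[OF assms(1,2,4)]
      Cinf_frechet_derivative[OF assms(1,3,4)]], of i]
  by (simp add: partial_deriv_def)

lemma partial_deriv_mult:
  assumes "open U" "Cinf U f" "Cinf U g" "x \<in> U"
  shows "partial_deriv i (\<lambda>x. f x * g x) x = f x * partial_deriv i g x + partial_deriv i f x * g x"
  using partial_deriv_eqI[OF has_derivative_mult[OF Cinf_frechet_derivative[OF assms(1,2,4)]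
      Cinf_frechet_derivative[OF assms(1,3,4)]], of i]
  by (simp add: partial_deriv_def)

lemma partial_deriv_nth: "partial_deriv i (\<lambda>x. x $ j) x = (if i = j then 1 else 0)"
proof -
  have d: "((\<lambda>x. x $ j) has_derivative (\<lambda>x. x $ j)) (at x)"
    by (rule bounded_linear_imp_has_derivative) (rule bounded_linear_vec_nth)
  show ?thesis by (simp add: partial_deriv_eqI[OF d] axis_def)
qed

lemma partial_deriv_radial:
  fixes x :: "real^2"
  assumes "(f has_real_derivative f') (at ((norm x)\<^sup>2))"
  shows "partial_deriv i (\<lambda>x. f ((norm x)\<^sup>2)) x = 2 * f' * x $ i"
proof -
  have "((\<lambda>x. (norm x)\<^sup>2) has_derivative (\<lambda>h. 2 * (x \<bullet> h))) (at x)"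
    unfolding power2_norm_eq_inner
    by (auto intro!: derivative_eq_intros simp: inner_commute)
  from has_derivative_compose[OF this assms[unfolded has_field_derivative_def]]
  have "((\<lambda>x. f ((norm x)\<^sup>2)) has_derivative (\<lambda>h. f' * (2 * (x \<bullet> h)))) (at x)" .
  from partial_deriv_eqI[OF this, of i] show ?thesis by (simp add: inner_axis)
qed

text \<open>In polar terms, (r d/dr)^2 + (d/dt)^2 is r^2 times the flat Laplacian. The mixed partial
  derivatives cancel without being interchanged.\<close>

lemma euler_rot_sq:
  assumes "open U" "Cinf U u" "x \<in> U"
  shows "euler_op (euler_op u) x + rot_op (rot_op u) x
    = (norm x)\<^sup>2 * (partial_deriv 1 (partial_deriv 1 u) x + partial_deriv 2 (partial_deriv 2 u) x)"
proof -
  note C = Cinf_mult[OF assms(1) Cinf_nth Cinf_partial_deriv[OF assms(2)]]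
  have E: "partial_deriv i (euler_op u) x = (if i = 1 then partial_deriv 1 u x else 0) + x $ 1 * partial_deriv i (partial_deriv 1 u) x
      + ((if i = 2 then partial_deriv 2 u x else 0) + x $ 2 * partial_deriv i (partial_deriv 2 u) x)" for i
    unfolding euler_op_def[abs_def]
    by (simp add: partial_deriv_add[OF assms(1) C C assms(3)] partial_deriv_nth
        partial_deriv_mult[OF assms(1) Cinf_nth Cinf_partial_deriv[OF assms(2)] assms(3)])
  have m: "Cinf U (\<lambda>x. - 1 * (x $ 2 * partial_deriv 1 u x))"
    by (rule Cinf_mult[OF assms(1) Cinf_const C])
  have c: "partial_deriv i (\<lambda>x. - 1 * (x $ 2 * partial_deriv 1 u x)) x = - partial_deriv i (\<lambda>x. x $ 2 * partial_deriv 1 u x) x" for i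
    using partial_deriv_mult[OF assms(1) Cinf_const C assms(3), of i "- 1"]
      partial_deriv_eqI[OF has_derivative_const[of "- 1 :: real" "at x"], of i] by simp
  have r: "rot_op u = (\<lambda>x. x $ 1 * partial_deriv 2 u x + - 1 * (x $ 2 * partial_deriv 1 u x))"
    by (simp add: rot_op_def[abs_def])
  have Rt: "partial_deriv i (rot_op u) x = (if i = 1 then partial_deriv 2 u x else 0) + x $ 1 * partial_deriv i (partial_deriv 2 u) x
      - ((if i = 2 then partial_deriv 1 u x else 0) + x $ 2 * partial_deriv i (partial_deriv 1 u) x)" for i
    unfolding r partial_deriv_add[OF assms(1) C m assms(3)] c
    by (simp add: partial_deriv_nth partial_deriv_mult[OF assms(1) Cinf_nth Cinf_partial_deriv[OF assms(2)] assms(3)])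
  show ?thesis
    unfolding euler_op_def[of "euler_op u"] rot_op_def[of "rot_op u"] E Rt norm_sq_2
    by (simp add: algebra_simps)
qed

text \<open>The classical d^2/dr^2 + (c / h) d/dr + h^(-2) d^2/dt^2, multiplied by r^2 H and written
  with the Cartesian fields, so that it makes sense at the pole too.\<close>

lemma laplace_beltrami_polar:
  assumes "open U" "U \<subseteq> space_form_domain K" "Cinf U u" "x \<in> U"
  defines "H \<equiv> h_series K ((norm x)\<^sup>2)" and "C \<equiv> c_series K ((norm x)\<^sup>2)"
  shows "(norm x)\<^sup>2 * H * laplace_beltrami (space_form_metric K) u x
    = H * euler_op (euler_op u) x + (C - H) * euler_op u x + rot_op (rot_op u) x / H"
proof -
  let ?q = "(norm x)\<^sup>2"
  let ?a = "\<lambda>q. 1 / h_series K q" and ?g = "\<lambda>q. h1_series K q * (h_series K q + 1) / h_series K q"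
  have xD: "x \<in> space_form_domain K" using assms(2,4) by blast
  have H: "0 < H" using h_series_pos[OF xD] by (simp add: H_def)
  obtain h' where h': "(h_series K has_real_derivative h') (at ?q)" "2 * ?q * h' = C - H"
    using h_series_deriv[where q = ?q and K = K] unfolding H_def C_def by metis
  have a: "(?a has_real_derivative - h' / H\<^sup>2) (at ?q)"
    using H unfolding H_def
    by (rule_tac DERIV_cong[OF DERIV_divide[OF DERIV_const h'(1)]]) (auto simp: power2_eq_square)
  have "h1_series K differentiable (at ?q)"
    unfolding h1_series_def[abs_def] real_differentiable_def
    using termdiffs_strong_converges_everywhere[OF summable_h1] by blast
  then obtain h1' where h1': "(h1_series K has_real_derivative h1') (at ?q)"
    unfolding real_differentiable_def by blast
  have "\<exists>g'. (?g has_real_derivative g') (at ?q)"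
    using DERIV_divide[OF DERIV_mult'[OF h1' DERIV_add[OF h'(1) DERIV_const[of 1]]] h'(1)]
      less_imp_neq[OF H, symmetric] unfolding H_def by blast
  then obtain g' where g': "(?g has_real_derivative g') (at ?q)" by blast
  have qg: "q * ?g q = h_series K q - ?a q" if "h_series K q \<noteq> 0" for q
  proof -
    have "q * h1_series K q = h_series K q - 1" using h_series_eq_h1[of K q] by simp
    then have "q * ?g q = (h_series K q - 1) * (h_series K q + 1) / h_series K q" by (simp add: mult.assoc[symmetric])
    then show ?thesis using that by (simp add: field_simps)
  qed
  \<comment> \<open>\<open>g'\<close> itself is never computed: only g + q g' occurs, and this is
    the derivative of q g = H - 1 / H.\<close>
  have gid: "?g ?q + ?q * g' = h' + h' / H\<^sup>2"
  proof (rule DERIV_unique)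
    show "((\<lambda>q. q * ?g q) has_real_derivative ?g ?q + ?q * g') (at ?q)"
      by (rule DERIV_cong[OF DERIV_mult'[OF DERIV_ident g']]) simp
    have d: "((\<lambda>q. h_series K q - ?a q) has_real_derivative h' + h' / H\<^sup>2) (at ?q)"
      by (rule DERIV_cong[OF DERIV_diff[OF h'(1) a]]) simp
    have "continuous_on UNIV (h_series K)"
      by (rule continuous_at_imp_continuous_on, rule ballI, rule h_series_deriv) (rule DERIV_isCont)
    then have "open {q. h_series K q \<noteq> 0}"
      by (intro open_Collect_neq continuous_on_const)
    then show "((\<lambda>q. q * ?g q) has_real_derivative h' + h' / H\<^sup>2) (at ?q)"
    proof (rule has_field_derivative_transform_within_open[OF d])
      show "?q \<in> {q. h_series K q \<noteq> 0}" using H by (simp add: H_def)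
      show "h_series K q - ?a q = q * ?g q" if "q \<in> {q. h_series K q \<noteq> 0}" for q
        using qg[of q] that by (metis mem_Collect_eq)
    qed
  qed
  have flux: "partial_deriv i (space_form_flux K u i) x
      = 1 / H * partial_deriv i (partial_deriv i u) x + 2 * (- h' / H\<^sup>2) * x $ i * partial_deriv i u x
        + (?g ?q * (euler_op u x + x $ i * partial_deriv i (euler_op u) x) + 2 * g' * x $ i * (x $ i * euler_op u x))" for i
  proof -
    have f: "space_form_flux K u i = (\<lambda>x. ?a ((norm x)\<^sup>2) * partial_deriv i u x + ?g ((norm x)\<^sup>2) * (x $ i * euler_op u x))"
      by (simp add: space_form_flux_def[abs_def])
    note nz = h_series_nz[OF assms(1,2)]
    have ca: "Cinf U (\<lambda>x. ?a ((norm x)\<^sup>2))"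
      by (intro Cinf_inverse Cinf_h_series assms nz)
    have cg: "Cinf U (\<lambda>x. ?g ((norm x)\<^sup>2))"
      by (intro Cinf_divide Cinf_mult Cinf_add Cinf_const Cinf_h1_series Cinf_h_series assms nz)
    note cu = Cinf_partial_deriv[OF assms(3), of i] and ce = Cinf_euler_op[OF assms(1,2,3)]
    note cx = Cinf_mult[OF assms(1) Cinf_nth ce, of i]
    show ?thesis
      unfolding f partial_deriv_add[OF assms(1) Cinf_mult[OF assms(1) ca cu] Cinf_mult[OF assms(1) cg cx] assms(4)]
        partial_deriv_mult[OF assms(1) ca cu assms(4)] partial_deriv_mult[OF assms(1) cg cx assms(4)]
        partial_deriv_mult[OF assms(1) Cinf_nth ce assms(4)] partial_deriv_radial[OF a] partial_deriv_radial[OF g']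
        partial_deriv_nth
      by (simp add: H_def add.commute)
  qed
  define E EE RR where "E = euler_op u x" and "EE = euler_op (euler_op u) x" and "RR = rot_op (rot_op u) x"
  define S where "S = partial_deriv 1 (partial_deriv 1 u) x + partial_deriv 2 (partial_deriv 2 u) x"
  define G where "G = ?g ?q"
  have S: "?q * S = EE + RR" using euler_rot_sq[OF assms(1,3,4)] by (simp add: S_def EE_def RR_def)
  have "partial_deriv 1 (space_form_flux K u 1) x + partial_deriv 2 (space_form_flux K u 2) x
      = 1 / H * S - 2 * h' / H\<^sup>2 * E + 2 * G * E + G * EE + 2 * g' * ?q * E"
    unfolding flux G_def[symmetric]
    unfolding S_def EE_def E_def euler_op_def[of "euler_op u"] euler_op_def[of u x] norm_sq_2
    by (simp add: algebra_simps)
  then have "?q * H * laplace_beltrami (space_form_metric K) u x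
      = ?q * (1 / H * S - 2 * h' / H\<^sup>2 * E + 2 * G * E + G * EE + 2 * g' * ?q * E)"
    unfolding laplace_beltrami_eq_flux[OF xD] using H by (simp add: H_def)
  also have "\<dots> = 1 / H * (?q * S) - 2 * ?q * (h' / H\<^sup>2) * E + 2 * ?q * (G + ?q * g') * E + (?q * G) * EE"
    by (simp add: algebra_simps)
  also have "\<dots> = 1 / H * (EE + RR) - 2 * ?q * (h' / H\<^sup>2) * E + 2 * ?q * (h' + h' / H\<^sup>2) * E + (H - 1 / H) * EE"
    using qg[of ?q] H unfolding S gid[folded G_def] by (simp add: G_def H_def)
  also have "\<dots> = H * EE + (2 * ?q * h') * E + RR / H"
    by (simp add: algebra_simps add_divide_distrib)
  finally show ?thesis unfolding h'(2) by (simp add: E_def EE_def RR_def)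
qed

section \<open>Angular modes\<close>

definition pol :: "real \<Rightarrow> real \<Rightarrow> real^2" where
  "pol r \<theta> = (\<chi> i. if i = 1 then r * cos \<theta> else r * sin \<theta>)"

lemma pol_nth [simp]: "pol r \<theta> $ 1 = r * cos \<theta>" "pol r \<theta> $ 2 = r * sin \<theta>"
  by (simp_all add: pol_def)

lemma norm_pol_sq: "(norm (pol r \<theta>))\<^sup>2 = r\<^sup>2"
proof -
  have "(norm (pol r \<theta>))\<^sup>2 = r\<^sup>2 * ((cos \<theta>)\<^sup>2 + (sin \<theta>)\<^sup>2)"
    unfolding norm_sq_2 pol_nth by (simp only: power2_eq_square algebra_simps)
  then show ?thesis by simp
qed

lemma norm_pol [simp]: "norm (pol r \<theta>) = \<bar>r\<bar>"
  by (rule power2_eq_imp_eq) (simp_all add: norm_pol_sq)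

lemma polE:
  fixes x :: "real^2"
  obtains \<theta> where "0 \<le> \<theta>" "\<theta> \<le> 2 * pi" "x = pol (norm x) \<theta>"
proof (cases "x = 0")
  case True
  then have "x = pol (norm x) 0" by (simp add: vec_eq_iff forall_2)
  then show thesis using that[of 0] by simp
next
  case False
  then have n: "norm x \<noteq> 0" by simp
  have "(x $ 1 / norm x)\<^sup>2 + (x $ 2 / norm x)\<^sup>2 = 1"
  proof -
    have "(x $ 1 / norm x)\<^sup>2 + (x $ 2 / norm x)\<^sup>2 = (x $ 1 * x $ 1 + x $ 2 * x $ 2) / (norm x)\<^sup>2"
      by (simp only: power_divide add_divide_distrib) (simp only: power2_eq_square)
    then show ?thesis unfolding norm_sq_2[symmetric] using n by simp
  qed
  then obtain t where t: "0 \<le> t" "t < 2 * pi" "x $ 1 / norm x = cos t" "x $ 2 / norm x = sin t"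
    by (rule sincos_total_2pi)
  have "x $ 1 = norm x * cos t" "x $ 2 = norm x * sin t"
    unfolding t(3,4)[symmetric] using n by simp_all
  then have "x = pol (norm x) t" unfolding vec_eq_iff forall_2 pol_nth by blast
  then show thesis by (rule that[OF t(1) less_imp_le[OF t(2)]])
qed

lemma continuous_on_pol [continuous_intros]:
  fixes f g :: "'a::t2_space \<Rightarrow> real"
  assumes "continuous_on S f" "continuous_on S g"
  shows "continuous_on S (\<lambda>z. pol (f z) (g z))"
proof -
  have e: "pol r t = (r * cos t) *\<^sub>R axis 1 1 + (r * sin t) *\<^sub>R axis 2 1" for r t
    by (simp add: vec_eq_iff forall_2 axis_def)
  show ?thesis unfolding e by (intro continuous_intros assms)
qed

lemma pol_has_derivative_radius:
  "((\<lambda>r. pol r \<theta>) has_derivative (\<lambda>d. d *\<^sub>R pol 1 \<theta>)) (at r)"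
proof -
  have e: "(\<lambda>r. pol r \<theta>) = (\<lambda>r. r *\<^sub>R pol 1 \<theta>)"
    by (rule ext) (simp add: vec_eq_iff forall_2)
  show ?thesis unfolding e by (auto intro!: derivative_eq_intros)
qed

lemma pol_has_derivative_angle:
  "((\<lambda>\<theta>. pol r \<theta>) has_derivative (\<lambda>d. d *\<^sub>R (\<chi> i. if i = 1 then - r * sin \<theta> else r * cos \<theta>))) (at \<theta>)"
proof -
  have e: "(\<lambda>\<theta>. pol r \<theta>) = (\<lambda>t. (r * cos t) *\<^sub>R axis 1 1 + (r * sin t) *\<^sub>R axis 2 1)"
    by (rule ext) (simp add: vec_eq_iff forall_2 axis_def)
  have f: "(\<lambda>d. d *\<^sub>R (\<chi> i. if i = 1 then - r * sin \<theta> else r * cos \<theta>) :: real^2)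
      = (\<lambda>d. (r * (d * - sin \<theta>)) *\<^sub>R axis 1 1 + (r * (d * cos \<theta>)) *\<^sub>R axis 2 1)"
    by (rule ext) (simp add: vec_eq_iff forall_2 axis_def)
  show ?thesis unfolding e f by (auto intro!: derivative_eq_intros simp: fun_eq_iff)
qed

lemma Cinf_radial_deriv:
  assumes "open U" "Cinf U w" "pol r \<theta> \<in> U"
  shows "((\<lambda>r. w (pol r \<theta>)) has_real_derivative
    partial_deriv 1 w (pol r \<theta>) * cos \<theta> + partial_deriv 2 w (pol r \<theta>) * sin \<theta>) (at r)"
  using has_derivative_compose[OF pol_has_derivative_radius Cinf_has_derivative[OF assms]]
  unfolding has_field_derivative_def by (rule has_derivative_eq_rhs) (simp add: fun_eq_iff algebra_simps)

lemma Cinf_angular_deriv: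
  assumes "open U" "Cinf U w" "pol r \<theta> \<in> U"
  shows "((\<lambda>\<theta>. w (pol r \<theta>)) has_real_derivative rot_op w (pol r \<theta>)) (at \<theta>)"
  using has_derivative_compose[OF pol_has_derivative_angle Cinf_has_derivative[OF assms]]
  unfolding has_field_derivative_def by (rule has_derivative_eq_rhs) (simp add: fun_eq_iff rot_op_def algebra_simps)

lemma space_form_local:
  assumes "0 < r" "K * r\<^sup>2 < pi\<^sup>2"
  shows "0 < h_series K (r\<^sup>2)" "0 < space_form_s K r" "0 < space_form_h K r"
    "space_form_h K r = r * h_series K (r\<^sup>2)" "1 + space_form_y K r = space_form_s K r / space_form_h K r"
    "(space_form_s K has_real_derivative space_form_s K r / space_form_h K r) (at r)"
proof -
  note d = less_imp_le[OF assms(1)] assms(2)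
  show h: "0 < space_form_h K r" by (rule space_form_h_pos[OF assms])
  show s: "0 < space_form_s K r" by (rule space_form_s_pos[OF d assms(1)])
  show e: "space_form_h K r = r * h_series K (r\<^sup>2)" using series_eq_space_form by simp
  show "0 < h_series K (r\<^sup>2)" using h assms(1) unfolding e by (simp add: zero_less_mult_iff)
  show y: "1 + space_form_y K r = space_form_s K r / space_form_h K r"
    using s unfolding space_form_h_eq[OF d] by simp
  show "(space_form_s K has_real_derivative space_form_s K r / space_form_h K r) (at r)"
    using space_form_s_deriv[OF d] unfolding y .
qed

text \<open>Treats cos (k t) and sin (k t) alike. Periodicity is asked of \<xi> and of its
  derivative because both occur in the boundary terms of the integration by parts.\<close>

locale angular_mode =
  fixes k :: nat and \<xi> \<xi>' :: "real \<Rightarrow> real"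
  assumes chi_deriv: "(\<xi> has_real_derivative \<xi>' t) (at t)"
    and chi'_deriv: "(\<xi>' has_real_derivative - (real k)\<^sup>2 * \<xi> t) (at t)"
    and periodic: "\<xi> (2 * pi) = \<xi> 0" "\<xi>' (2 * pi) = \<xi>' 0"
begin

definition ang :: "(real^2 \<Rightarrow> real) \<Rightarrow> real \<Rightarrow> real" where
  "ang w r = integral {0..2 * pi} (\<lambda>\<theta>. w (pol r \<theta>) * \<xi> \<theta>)"

lemma chi_continuous [continuous_intros]: "continuous_on (S :: 'a::t2_space set) g \<Longrightarrow> continuous_on S (\<lambda>x. \<xi> (g x))"
proof -
  have "continuous_on UNIV \<xi>"
    using chi_deriv by (auto intro: continuous_at_imp_continuous_on DERIV_isCont)
  then show "continuous_on S g \<Longrightarrow> continuous_on S (\<lambda>x. \<xi> (g x))"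
    by (rule continuous_on_compose2) auto
qed

lemma ang_continuous_on:
  assumes "continuous_on (cball 0 R) w"
  shows "continuous_on {0..R} (ang w)"
proof -
  have "continuous_on {0..R} (\<lambda>r. integral (cbox 0 (2 * pi)) (\<lambda>\<theta>. w (pol r \<theta>) * \<xi> \<theta>))"
  proof (rule integral_continuous_on_param)
    show "continuous_on ({0..R} \<times> cbox 0 (2 * pi)) (\<lambda>(r, \<theta>). w (pol r \<theta>) * \<xi> \<theta>)"
      unfolding case_prod_unfold
      by (intro continuous_intros continuous_on_compose2[OF assms]) auto
  qed
  then show ?thesis by (simp add: ang_def[abs_def])
qed

lemma ang_0: "w 0 = 0 \<Longrightarrow> ang w 0 = 0"
proof -
  have "pol 0 \<theta> = 0" for \<theta> by (simp add: vec_eq_iff forall_2)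
  then show "w 0 = 0 \<Longrightarrow> ang w 0 = 0" by (simp add: ang_def)
qed

text \<open>The derivative is described through r d because r d/dr is the Euler field, so the result
  is again an angular coefficient.\<close>

lemma ang_deriv:
  assumes "Cinf (ball 0 R) w" "0 < r" "r < R"
  obtains d where "(ang w has_real_derivative d) (at r)" "r * d = ang (euler_op w) r"
proof -
  let ?I = "{0<..<R}"
  let ?f = "\<lambda>r \<theta>. (partial_deriv 1 w (pol r \<theta>) * cos \<theta> + partial_deriv 2 w (pol r \<theta>) * sin \<theta>) * \<xi> \<theta>"
  have w: "continuous_on (ball 0 R) w" "continuous_on (ball 0 R) (partial_deriv i w)" for i
    using assms(1) Cinf_continuous_on Cinf_partial_deriv by blast+
  have "((\<lambda>r. integral (cbox 0 (2 * pi)) (\<lambda>\<theta>. w (pol r \<theta>) * \<xi> \<theta>)) has_field_derivative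
      integral (cbox 0 (2 * pi)) (?f r)) (at r within ?I)"
  proof (rule leibniz_rule_field_derivative)
    fix r \<theta> assume "r \<in> ?I" "\<theta> \<in> cbox 0 (2 * pi)"
    then have "((\<lambda>r. w (pol r \<theta>)) has_real_derivative
        partial_deriv 1 w (pol r \<theta>) * cos \<theta> + partial_deriv 2 w (pol r \<theta>) * sin \<theta>) (at r)"
      by (intro Cinf_radial_deriv[OF _ assms(1)]) auto
    from DERIV_cmult_right[OF this, of "\<xi> \<theta>"]
    show "((\<lambda>r. w (pol r \<theta>) * \<xi> \<theta>) has_field_derivative ?f r \<theta>) (at r within ?I)"
      by (rule has_field_derivative_at_within)
  next
    fix r assume r: "r \<in> ?I"
    have "continuous_on {0..2 * pi} (\<lambda>\<theta>. w (pol r \<theta>) * \<xi> \<theta>)"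
      by (intro continuous_intros continuous_on_compose2[OF w(1)]) (use r in auto)
    then show "(\<lambda>\<theta>. w (pol r \<theta>) * \<xi> \<theta>) integrable_on cbox 0 (2 * pi)"
      using integrable_continuous_interval by auto
  next
    show "continuous_on (?I \<times> cbox 0 (2 * pi)) (\<lambda>(r, \<theta>). ?f r \<theta>)"
      unfolding case_prod_unfold
      by (intro continuous_intros continuous_on_compose2[OF w(2)]) auto
  qed (use assms in auto)
  then have d: "(ang w has_real_derivative integral {0..2 * pi} (?f r)) (at r)"
    using assms by (simp add: ang_def[abs_def] at_within_open[of r ?I])
  have "r * integral {0..2 * pi} (?f r) = integral {0..2 * pi} (\<lambda>\<theta>. r * ?f r \<theta>)"
    by (simp only: integral_mult_right)
  also have "\<dots> = ang (euler_op w) r"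
    unfolding ang_def euler_op_def by (rule integral_cong) (simp add: algebra_simps)
  finally show thesis using that[OF d] by blast
qed

text \<open>Two integrations by parts in one: (rot w) \<xi> - w \<xi>' is a primitive of (rot rot w)
  \<xi> + k^2 w \<xi> and takes equal values at 0 and 2 pi.\<close>

lemma ang_rot:
  assumes "Cinf (ball 0 R) w" "0 < r" "r < R"
  shows "ang (rot_op (rot_op w)) r = - (real k)\<^sup>2 * ang w r"
proof -
  have B: "pol r t \<in> ball 0 R" for t using assms by simp
  have rw: "Cinf (ball 0 R) (rot_op w)"
    unfolding rot_op_def[abs_def] by (intro Cinf_diff Cinf_mult Cinf_nth Cinf_partial_deriv assms) auto
  have rrw: "Cinf (ball 0 R) (rot_op (rot_op w))"
    unfolding rot_op_def[of "rot_op w", abs_def]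
    by (intro Cinf_diff Cinf_mult Cinf_nth Cinf_partial_deriv rw) auto
  have int: "(\<lambda>\<theta>. f (pol r \<theta>) * \<xi> \<theta>) integrable_on {0..2 * pi}" if "Cinf (ball 0 R) f" for f
    by (intro integrable_continuous_interval continuous_intros continuous_on_compose2[OF Cinf_continuous_on[OF that]])
       (use B in auto)
  let ?F = "\<lambda>t. rot_op w (pol r t) * \<xi> t - w (pol r t) * \<xi>' t"
  let ?f = "\<lambda>t. rot_op (rot_op w) (pol r t) * \<xi> t + (real k)\<^sup>2 * (w (pol r t) * \<xi> t)"
  have "integral {0..2 * pi} ?f = ?F (2 * pi) - ?F 0"
  proof (rule integral_fundamental)
    fix t
    have "(?F has_real_derivative (rot_op w (pol r t) * \<xi>' t + rot_op (rot_op w) (pol r t) * \<xi> t)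
        - (w (pol r t) * (- (real k)\<^sup>2 * \<xi> t) + rot_op w (pol r t) * \<xi>' t)) (at t)"
      by (intro DERIV_diff DERIV_mult' chi_deriv chi'_deriv Cinf_angular_deriv[OF _ assms(1) B]
          Cinf_angular_deriv[OF _ rw B]) auto
    then show "(?F has_real_derivative ?f t) (at t)"
      by (rule DERIV_cong) (simp add: algebra_simps)
  qed simp
  also have "\<dots> = 0"
  proof -
    have "pol r (2 * pi) = pol r 0" by (simp add: vec_eq_iff forall_2)
    then show ?thesis using periodic by simp
  qed
  finally have "integral {0..2 * pi} ?f = 0" .
  moreover have "integral {0..2 * pi} ?f = ang (rot_op (rot_op w)) r + (real k)\<^sup>2 * ang w r"
    unfolding ang_def integral_mult_right[symmetric]
    by (rule integral_add) (intro integrable_on_mult_right int rrw assms)+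
  ultimately show ?thesis by simp
qed

lemma ang_polar:
  assumes "Cinf (ball 0 R) w" "ball 0 R \<subseteq> space_form_domain K" "0 < r" "r < R"
  defines "H \<equiv> h_series K (r\<^sup>2)" and "C \<equiv> c_series K (r\<^sup>2)"
  shows "r\<^sup>2 * H * ang (laplace_beltrami (space_form_metric K) w) r
    = H * ang (euler_op (euler_op w)) r + (C - H) * ang (euler_op w) r - (real k)\<^sup>2 / H * ang w r"
proof -
  let ?B = "ball (0::real^2) R"
  let ?L = "laplace_beltrami (space_form_metric K) w"
  have B: "pol r t \<in> ?B" for t using assms by simp
  have e: "Cinf ?B (euler_op f)" if "Cinf ?B f" for f
    by (rule Cinf_euler_op[OF _ assms(2) that]) simp
  have rot: "Cinf ?B (rot_op f)" if "Cinf ?B f" for f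
    by (rule Cinf_rot_op[OF _ assms(2) that]) simp
  have lap: "Cinf ?B ?L" by (rule Cinf_laplace_beltrami[OF _ assms(2,1)]) simp
  have int: "(\<lambda>\<theta>. f (pol r \<theta>) * \<xi> \<theta>) integrable_on {0..2 * pi}" if "Cinf ?B f" for f
    by (intro integrable_continuous_interval continuous_intros continuous_on_compose2[OF Cinf_continuous_on[OF that]])
       (use B in auto)
  let ?E = "euler_op w" let ?EE = "euler_op ?E" let ?R = "rot_op (rot_op w)"
  have "r\<^sup>2 * H * ang ?L r = integral {0..2 * pi} (\<lambda>t. r\<^sup>2 * H * (?L (pol r t) * \<xi> t))"
    by (simp only: ang_def integral_mult_right)
  also have "\<dots> = integral {0..2 * pi} (\<lambda>t. (H * (?EE (pol r t) * \<xi> t) + (C - H) * (?E (pol r t) * \<xi> t))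
      + 1 / H * (?R (pol r t) * \<xi> t))"
  proof (rule integral_cong)
    fix t
    have "r\<^sup>2 * H * ?L (pol r t) = H * ?EE (pol r t) + (C - H) * ?E (pol r t) + ?R (pol r t) / H"
      using laplace_beltrami_polar[OF open_ball assms(2,1) B[of t]] by (simp add: norm_pol_sq H_def C_def)
    from arg_cong[OF this, of "\<lambda>z. z * \<xi> t"]
    show "r\<^sup>2 * H * (?L (pol r t) * \<xi> t) = (H * (?EE (pol r t) * \<xi> t) + (C - H) * (?E (pol r t) * \<xi> t))
      + 1 / H * (?R (pol r t) * \<xi> t)"
      by (simp add: algebra_simps)
  qed
  also have "\<dots> = (integral {0..2 * pi} (\<lambda>t. H * (?EE (pol r t) * \<xi> t))
      + integral {0..2 * pi} (\<lambda>t. (C - H) * (?E (pol r t) * \<xi> t)))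
      + integral {0..2 * pi} (\<lambda>t. 1 / H * (?R (pol r t) * \<xi> t))"
  proof -
    have i: "(\<lambda>t. H * (?EE (pol r t) * \<xi> t)) integrable_on {0..2 * pi}"
      "(\<lambda>t. (C - H) * (?E (pol r t) * \<xi> t)) integrable_on {0..2 * pi}"
      "(\<lambda>t. 1 / H * (?R (pol r t) * \<xi> t)) integrable_on {0..2 * pi}"
      by (intro integrable_on_mult_right int e rot assms)+
    show ?thesis
      unfolding integral_add[OF integrable_add[OF i(1,2)] i(3)] integral_add[OF i(1,2)] ..
  qed
  also have "\<dots> = H * ang ?EE r + (C - H) * ang ?E r + 1 / H * ang ?R r"
    by (simp only: ang_def integral_mult_right)
  finally show ?thesis unfolding ang_rot[OF assms(1,3,4)] by simp
qed

text \<open>With a = \<open>ang w\<close> this is (h a' - k a) s^k; expressing h a' by the Euler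
  field keeps it meaningful at r = 0 and r = R.\<close>

definition mode_flux :: "real \<Rightarrow> (real^2 \<Rightarrow> real) \<Rightarrow> real \<Rightarrow> real" where
  "mode_flux K w r = (h_series K (r\<^sup>2) * ang (euler_op w) r - real k * ang w r) * space_form_s K r ^ k"

context
  fixes K R :: real
  assumes R: "0 < R" "K * R\<^sup>2 < pi\<^sup>2"
begin

lemma ball_subset_domain: "ball 0 R \<subseteq> space_form_domain K" "cball 0 R \<subseteq> space_form_domain K"
  using space_form_domain_mono[OF _ _ R(2)] by (auto simp: space_form_domain_def)

lemma space_form_facts:
  assumes "0 < r" "r \<le> R"
  shows "0 < h_series K (r\<^sup>2)" "0 < space_form_s K r" "0 < space_form_h K r"
    "space_form_h K r = r * h_series K (r\<^sup>2)"
    "(space_form_s K has_real_derivative space_form_s K r / space_form_h K r) (at r)"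
  using space_form_local[OF assms(1) space_form_domain_mono[OF less_imp_le[OF assms(1)] assms(2) R(2)]] by auto

text \<open>The radial operator factors: with b = h a' - k a, a'' + (c / h) a' - k^2 a / h^2 equals
  (b' + k b / h) / h, and s^k is the integrating factor since s' = s / h.\<close>

lemma mode_flux_deriv:
  assumes w: "Cinf (ball 0 R) w" and r: "0 < r" "r < R"
  shows "(mode_flux K w has_real_derivative
    space_form_h K r * space_form_s K r ^ k * ang (laplace_beltrami (space_form_metric K) w) r) (at r)"
proof -
  define H C s h where "H = h_series K (r\<^sup>2)" and "C = c_series K (r\<^sup>2)"
    and "s = space_form_s K r" and "h = space_form_h K r"
  note f = space_form_facts[OF r(1) less_imp_le[OF r(2)]]
  have H: "0 < H" and s: "0 < s" and h: "0 < h" "h = r * H"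
    using f by (auto simp: H_def s_def h_def)
  have E: "Cinf (ball 0 R) (euler_op w)" by (rule Cinf_euler_op[OF _ ball_subset_domain(1) w]) simp
  obtain d0 where d0: "(ang w has_real_derivative d0) (at r)" "r * d0 = ang (euler_op w) r"
    using ang_deriv[OF w r] .
  obtain d1 where d1: "(ang (euler_op w) has_real_derivative d1) (at r)" "r * d1 = ang (euler_op (euler_op w)) r"
    using ang_deriv[OF E r] .
  obtain h' where h': "(h_series K has_real_derivative h') (at (r\<^sup>2))" "2 * r\<^sup>2 * h' = C - H"
    using h_series_deriv[where q = "r\<^sup>2" and K = K] unfolding H_def C_def by metis
  have sq: "((\<lambda>r. r\<^sup>2) has_real_derivative 2 * r) (at r)"
    by (auto intro!: derivative_eq_intros)
  have sk: "((\<lambda>r. space_form_s K r ^ k) has_real_derivative real k * s ^ k / h) (at r)"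
    by (rule DERIV_cong[OF DERIV_power[OF f(5)]])
       (use s in \<open>cases k; auto simp: s_def h_def\<close>)
  let ?A = "ang w r" let ?A1 = "ang (euler_op w) r"
  let ?d = "(H * ?A1 - real k * ?A) * (real k * s ^ k / h) + (H * d1 + h' * (2 * r) * ?A1 - real k * d0) * s ^ k"
  have "(mode_flux K w has_real_derivative ?d) (at r)"
    unfolding mode_flux_def[abs_def] H_def s_def
    by (intro DERIV_mult' DERIV_diff DERIV_cmult sk[unfolded s_def] d0 d1 DERIV_chain2[OF h'(1) sq])
  \<comment> \<open>\<open>ang_deriv\<close> and \<open>ang_polar\<close> give their information
    multiplied by powers of r, so r is cancelled only at the end.\<close>
  moreover have "r * ?d = r * (h * s ^ k * ang (laplace_beltrami (space_form_metric K) w) r)"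
  proof -
    have "r * ?d = s ^ k * ((H * ?A1 - real k * ?A) * (real k * (r / h)) + H * (r * d1) + (2 * r\<^sup>2 * h') * ?A1 - real k * (r * d0))"
      by (simp add: power2_eq_square algebra_simps)
    also have "\<dots> = s ^ k * (H * ang (euler_op (euler_op w)) r + (C - H) * ?A1 - (real k)\<^sup>2 / H * ?A)"
      unfolding d0(2) d1(2) h'(2) using r H by (simp add: h(2) field_simps power2_eq_square)
    also have "\<dots> = s ^ k * (r\<^sup>2 * H * ang (laplace_beltrami (space_form_metric K) w) r)"
      using ang_polar[OF w ball_subset_domain(1) r] by (simp add: H_def C_def)
    finally show ?thesis by (simp only: h(2) power2_eq_square mult_ac)
  qed
  ultimately show ?thesis using r by (simp add: s_def h_def)
qed

lemma mode_flux_continuous: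
  assumes "continuous_on (cball 0 R) w" "continuous_on (cball 0 R) (euler_op w)"
  shows "continuous_on {0..R} (mode_flux K w)"
proof -
  have "isCont (h_series K) q" for q
    by (rule h_series_deriv) (rule DERIV_isCont)
  then have "continuous_on UNIV (h_series K)" by (simp add: continuous_at_imp_continuous_on)
  then have h: "continuous_on {0..R} (\<lambda>r. h_series K (r\<^sup>2))"
    by (rule continuous_on_compose2) (auto intro: continuous_intros)
  have s: "continuous_on {0..R} (space_form_s K)"
    using space_form_s_deriv space_form_domain_mono[OF _ _ R(2)]
    by (intro continuous_at_imp_continuous_on ballI) (auto intro: DERIV_isCont)
  show ?thesis
    unfolding mode_flux_def[abs_def]
    by (intro continuous_intros h s ang_continuous_on assms)
qed

text \<open>Regularity at the pole enters here, excluding s^(-k) or ln s: for k > 0 the factor s^k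
  vanishes, for k = 0 the Euler coefficient does.\<close>

lemma mode_flux_0: "mode_flux K w 0 = 0"
proof -
  have "ang (euler_op w) 0 = 0" by (rule ang_0) (simp add: euler_op_def)
  then show ?thesis unfolding mode_flux_def by (cases "k = 0") auto
qed

text \<open>A vanishing flux means h a' = k a, so a / s^k has derivative 0.\<close>

lemma ang_of_mode_flux_0:
  assumes w: "Cinf (ball 0 R) w" "continuous_on (cball 0 R) w"
    and 0: "\<And>r. 0 < r \<Longrightarrow> r < R \<Longrightarrow> mode_flux K w r = 0" and r: "0 < r" "r \<le> R"
  shows "ang w r * space_form_s K R ^ k = ang w R * space_form_s K r ^ k"
proof (cases "r = R")
  case False
  let ?q = "\<lambda>r. ang w r / space_form_s K r ^ k"
  have sR: "0 < space_form_s K t" if "0 < t" "t \<le> R" for t using space_form_facts(2)[OF that] .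
  have s: "continuous_on {r..R} (space_form_s K)"
  proof (intro continuous_at_imp_continuous_on ballI)
    fix t assume "t \<in> {r..R}"
    then show "isCont (space_form_s K) t"
      using DERIV_isCont[OF space_form_facts(5)[of t]] r by auto
  qed
  have "?q R = ?q r"
  proof (rule DERIV_isconst2[of r R])
    show "continuous_on {r..R} ?q"
    proof (intro continuous_on_divide continuous_on_power s continuous_on_subset[OF ang_continuous_on[OF w(2)]] ballI)
      fix t assume "t \<in> {r..R}"
      then show "space_form_s K t ^ k \<noteq> 0" using sR[of t] r by simp
    qed (use r in auto)
    fix t assume t: "r < t" "t < R"
    then have t0: "0 < t" using r by simp
    note f = space_form_facts[OF t0 less_imp_le[OF t(2)]]
    obtain d where d: "(ang w has_real_derivative d) (at t)" "t * d = ang (euler_op w) t"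
      using ang_deriv[OF w(1) t0 t(2)] .
    have "h_series K (t\<^sup>2) * (t * d) = real k * ang w t"
      using 0[OF t0 t(2)] f(2) unfolding d(2) mode_flux_def by simp
    then have hd: "space_form_h K t * d = real k * ang w t" unfolding f(4) by (simp add: mult_ac)
    have sk: "((\<lambda>r. space_form_s K r ^ k) has_real_derivative real k * space_form_s K t ^ k / space_form_h K t) (at t)"
      by (rule DERIV_cong[OF DERIV_power[OF f(5)]]) (use f(2) in \<open>cases k; auto\<close>)
    show "(?q has_real_derivative 0) (at t)"
    proof (rule DERIV_cong[OF DERIV_divide[OF d(1) sk]])
      have "d = real k * ang w t / space_form_h K t"
        using hd f(3) by (metis less_irrefl nonzero_mult_div_cancel_left)
      then show "(d * space_form_s K t ^ k - ang w t * (real k * space_form_s K t ^ k / space_form_h K t))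
          / (space_form_s K t ^ k * space_form_s K t ^ k) = 0" by simp
    qed (use f(2) in simp)
  qed (use r False in auto)
  then show ?thesis using sR[OF r] sR[OF R(1) order_refl] by (simp add: field_simps)
qed simp

text \<open>The flux of v is constant and 0 at the pole, so its mode is c s^k. The flux of u at R is
  then c N, with N the integral of h s^(2 k), and the boundary conditions turn this into c h s^(2 k)
  = \<eta> c N. If c is nonzero, \<eta> is the k-th value; if c = 0, the mode of u is a multiple of
  s^k vanishing at R.\<close>

lemma mode_dichotomy:
  assumes u: "Cinf (ball 0 R) u" "continuous_on (cball 0 R) u" "continuous_on (cball 0 R) (euler_op u)"
    and v: "continuous_on (cball 0 R) v" "continuous_on (cball 0 R) (euler_op v)"
      "v = laplace_beltrami (space_form_metric K) u"
    and bih: "\<And>x. x \<in> ball 0 R \<Longrightarrow> laplace_beltrami (space_form_metric K) v x = 0"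
    and bc: "\<And>x. norm x = R \<Longrightarrow> u x = 0" "\<And>x. norm x = R \<Longrightarrow> v x = \<eta> * (euler_op u x / R)"
    and \<eta>: "\<eta> \<noteq> steklov_value K R k" and r: "0 < r" "r \<le> R"
  shows "ang u r = 0"
proof -
  let ?s = "space_form_s K" and ?h = "space_form_h K"
  note fR = space_form_facts[OF R(1) order_refl]
  have vB: "Cinf (ball 0 R) v" unfolding v(3) by (rule Cinf_laplace_beltrami[OF _ ball_subset_domain(1) u(1)]) simp
  have lv: "ang (laplace_beltrami (space_form_metric K) v) t = 0" if "0 < t" "t < R" for t
    using bih that by (simp add: ang_def)
  have mv: "mode_flux K v t = 0" if t: "0 < t" "t < R" for t
  proof -
    have "mode_flux K v t = mode_flux K v 0"
    proof (rule DERIV_isconst2[OF R(1) mode_flux_continuous[OF v(1,2)]])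
      fix x assume "0 < x" "x < R"
      then show "(mode_flux K v has_real_derivative 0) (at x)"
        using mode_flux_deriv[OF vB, of x] lv[of x] by simp
    qed (use t in auto)
    then show ?thesis by (simp add: mode_flux_0)
  qed
  have vform: "ang v t * ?s R ^ k = ang v R * ?s t ^ k" if "0 < t" "t \<le> R" for t
    by (rule ang_of_mode_flux_0[OF vB v(1) _ that]) (rule mv)
  define c where "c = ang v R / ?s R ^ k"
  have cv: "ang v t = c * ?s t ^ k" if "0 < t" "t \<le> R" for t
    using vform[OF that] fR(2) by (simp add: c_def field_simps)
  have du: "(mode_flux K u has_real_derivative c * (?h t * ?s t ^ (2 * k))) (at t)" if t: "0 < t" "t < R" for t
  proof (rule DERIV_cong[OF mode_flux_deriv[OF u(1) t]])
    have "?s t ^ (2 * k) = ?s t ^ k * ?s t ^ k" by (simp only: mult_2 power_add)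
    then show "?h t * ?s t ^ k * ang (laplace_beltrami (space_form_metric K) u) t = c * (?h t * ?s t ^ (2 * k))"
      using cv[OF t(1)] t unfolding v(3)[symmetric] by simp
  qed
  have aR: "ang u R = 0" using bc(1) R(1) by (simp add: ang_def)
  show ?thesis
  proof (cases "c = 0")
    case True
    have mu: "mode_flux K u t = 0" if t: "0 < t" "t < R" for t
    proof -
      have "mode_flux K u t = mode_flux K u 0"
      proof (rule DERIV_isconst2[OF R(1) mode_flux_continuous[OF u(2,3)]])
        fix x assume "0 < x" "x < R"
        then show "(mode_flux K u has_real_derivative 0) (at x)" using du[of x] True by simp
      qed (use t in auto)
      then show ?thesis by (simp add: mode_flux_0)
    qed
    have "ang u r * ?s R ^ k = ang u R * ?s r ^ k"
      by (rule ang_of_mode_flux_0[OF u(1,2) _ r]) (rule mu)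
    then show ?thesis using fR(2) aR by simp
  next
    case False
    let ?N = "integral {0..R} (\<lambda>t. ?h t * ?s t ^ (2 * k))"
    have "((\<lambda>t. c * (?h t * ?s t ^ (2 * k))) has_integral mode_flux K u R - mode_flux K u 0) {0..R}"
      using du R(1)
      by (intro fundamental_theorem_of_calculus_interior mode_flux_continuous[OF u(2,3)])
         (auto simp: has_real_derivative_iff_has_vector_derivative)
    from integral_unique[OF this] have "mode_flux K u R = c * ?N"
      unfolding integral_mult_right mode_flux_0 by simp
    then have M: "h_series K (R\<^sup>2) * ang (euler_op u) R * ?s R ^ k = c * ?N"
      by (simp add: mode_flux_def aR)
    have "ang v R = \<eta> * (ang (euler_op u) R / R)"
    proof -
      have "ang v R = integral {0..2 * pi} (\<lambda>t. \<eta> / R * (euler_op u (pol R t) * \<xi> t))"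
        unfolding ang_def by (rule integral_cong) (use bc(2) R(1) in simp)
      then show ?thesis by (simp only: integral_mult_right ang_def) simp
    qed
    then have "c * ?s R ^ k * R = \<eta> * ang (euler_op u) R"
      using cv[OF R(1) order_refl] R(1) by (simp add: field_simps)
    then have "c * (?s R ^ k * ?s R ^ k * (R * h_series K (R\<^sup>2))) = \<eta> * (h_series K (R\<^sup>2) * ang (euler_op u) R * ?s R ^ k)"
      by (metis mult.assoc mult.commute mult.left_commute)
    then have *: "c * (?s R ^ k * ?s R ^ k * ?h R) = c * (\<eta> * ?N)"
      unfolding M fR(4)[symmetric] by (simp add: mult_ac)
    have e: "?h R * ?s R ^ (2 * k) = \<eta> * ?N"
    proof -
      have p: "?s R ^ (2 * k) = ?s R ^ k * ?s R ^ k" by (simp only: mult_2 power_add)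
      have "?h R * (?s R ^ k * ?s R ^ k) = ?s R ^ k * ?s R ^ k * ?h R" by (rule mult.commute)
      also have "\<dots> = \<eta> * ?N" using * unfolding mult_left_cancel[OF False] .
      finally show ?thesis unfolding p .
    qed
    moreover have "0 < ?h R * ?s R ^ (2 * k)" using fR by simp
    ultimately have "0 < \<eta> * ?N" by (simp only:)
    then have "?N \<noteq> 0" by (metis mult_zero_right less_irrefl)
    then have "\<eta> = steklov_value K R k" unfolding steklov_value_def e by (rule nonzero_mult_div_cancel_right[symmetric])
    then show ?thesis using \<eta> by simp
  qed
qed

end

end

section \<open>Completeness of the angular modes\<close>

definition trig_orth :: "(real \<Rightarrow> real) \<Rightarrow> bool" where
  "trig_orth f \<longleftrightarrow> continuous_on {0..2 * pi} f \<and>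
     (\<forall>n::nat. integral {0..2 * pi} (\<lambda>t. f t * cos (real n * t)) = 0 \<and>
       integral {0..2 * pi} (\<lambda>t. f t * sin (real n * t)) = 0)"

text \<open>Serves in two roles: one function against two harmonics, or one harmonic against two
  functions.\<close>

lemma integral_comb_0:
  fixes f g1 g2 :: "real \<Rightarrow> real"
  assumes "continuous_on {0..2 * pi} f" "continuous_on {0..2 * pi} g1" "continuous_on {0..2 * pi} g2"
    "integral {0..2 * pi} (\<lambda>t. f t * g1 t) = 0" "integral {0..2 * pi} (\<lambda>t. f t * g2 t) = 0"
    "\<And>t. F t = a * (f t * g1 t) + b * (f t * g2 t)"
  shows "integral {0..2 * pi} F = 0"
proof -
  have "integral {0..2 * pi} F = integral {0..2 * pi} (\<lambda>t. a * (f t * g1 t)) + integral {0..2 * pi} (\<lambda>t. b * (f t * g2 t))"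
    unfolding assms(6)[abs_def]
    by (rule integral_add) (intro integrable_continuous_interval continuous_intros assms)+
  also have "\<dots> = 0" unfolding integral_mult_right assms(4,5) by simp
  finally show ?thesis .
qed

lemma trig_orth_D:
  assumes "trig_orth f"
  shows "continuous_on {0..2 * pi} f" "integral {0..2 * pi} (\<lambda>t. f t * cos (real n * t)) = 0"
    "integral {0..2 * pi} (\<lambda>t. f t * sin (real n * t)) = 0"
  using assms by (auto simp: trig_orth_def)

lemma trig_orth_comb:
  assumes "trig_orth f" "trig_orth g"
  shows "trig_orth (\<lambda>t. a * f t + b * g t)"
  unfolding trig_orth_def
proof (intro conjI allI)
  note f = trig_orth_D[OF assms(1)] and g = trig_orth_D[OF assms(2)]
  show "continuous_on {0..2 * pi} (\<lambda>t. a * f t + b * g t)"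
    by (intro continuous_intros f g)
  fix n
  show "integral {0..2 * pi} (\<lambda>t. (a * f t + b * g t) * cos (real n * t)) = 0"
    by (rule integral_comb_0[where f = "\<lambda>t. cos (real n * t)" and ?g1.0 = f and ?g2.0 = g and a = a and b = b])
       (use f g in \<open>auto intro!: continuous_intros simp: algebra_simps\<close>)
  show "integral {0..2 * pi} (\<lambda>t. (a * f t + b * g t) * sin (real n * t)) = 0"
    by (rule integral_comb_0[where f = "\<lambda>t. sin (real n * t)" and ?g1.0 = f and ?g2.0 = g and a = a and b = b])
       (use f g in \<open>auto intro!: continuous_intros simp: algebra_simps\<close>)
qed

text \<open>Product-to-sum: cos t or sin t times a harmonic of frequency n combines the frequencies
  n + 1 and n - 1.\<close>

lemma trig_orth_cos_sin:
  assumes "trig_orth f"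
  shows "trig_orth (\<lambda>t. cos t * f t)" "trig_orth (\<lambda>t. sin t * f t)"
proof -
  note f = trig_orth_D[OF assms]
  have c: "continuous_on {0..2 * pi} (\<lambda>t. cos (real n * t))" "continuous_on {0..2 * pi} (\<lambda>t. sin (real n * t))" for n
    by (intro continuous_intros)+
  have e: "real (Suc (Suc j)) * t = real (Suc j) * t + t" "real j * t = real (Suc j) * t - t" for j t
    by (simp_all add: algebra_simps)
  have f1: "integral {0..2 * pi} (\<lambda>t. f t * cos t) = 0" "integral {0..2 * pi} (\<lambda>t. f t * sin t) = 0"
    using f(2,3)[of 1] by simp_all
  have "integral {0..2 * pi} (\<lambda>t. cos t * f t * cos (real n * t)) = 0 \<and>
      integral {0..2 * pi} (\<lambda>t. cos t * f t * sin (real n * t)) = 0 \<and>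
      integral {0..2 * pi} (\<lambda>t. sin t * f t * cos (real n * t)) = 0 \<and>
      integral {0..2 * pi} (\<lambda>t. sin t * f t * sin (real n * t)) = 0" for n
  \<comment> \<open>Writing n = Suc j keeps n - 1 a natural number; for n = 0 only the frequency 1
    occurs.\<close>
  proof (cases n)
    case 0
    then show ?thesis using f1 by (simp add: mult.commute)
  next
    case (Suc j)
    show ?thesis
    proof (intro conjI)
      show "integral {0..2 * pi} (\<lambda>t. cos t * f t * cos (real n * t)) = 0"
        unfolding Suc by (rule integral_comb_0[OF f(1) c(1) c(1) f(2) f(2), of _ "1/2" "Suc (Suc j)" "1/2" j])
          (simp only: e[of j] cos_add cos_diff, simp add: algebra_simps)
      show "integral {0..2 * pi} (\<lambda>t. cos t * f t * sin (real n * t)) = 0"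
        unfolding Suc by (rule integral_comb_0[OF f(1) c(2) c(2) f(3) f(3), of _ "1/2" "Suc (Suc j)" "1/2" j])
          (simp only: e[of j] sin_add sin_diff, simp add: algebra_simps)
      show "integral {0..2 * pi} (\<lambda>t. sin t * f t * cos (real n * t)) = 0"
        unfolding Suc by (rule integral_comb_0[OF f(1) c(2) c(2) f(3) f(3), of _ "1/2" "Suc (Suc j)" "-1/2" j])
          (simp only: e[of j] sin_add sin_diff, simp add: algebra_simps)
      show "integral {0..2 * pi} (\<lambda>t. sin t * f t * sin (real n * t)) = 0"
        unfolding Suc by (rule integral_comb_0[OF f(1) c(1) c(1) f(2) f(2), of _ "-1/2" "Suc (Suc j)" "1/2" j])
          (simp only: e[of j] cos_add cos_diff, simp add: algebra_simps)
    qed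
  qed
  then show "trig_orth (\<lambda>t. cos t * f t)" "trig_orth (\<lambda>t. sin t * f t)"
    unfolding trig_orth_def by (auto intro!: continuous_intros f(1))
qed

text \<open>The induction keeps f arbitrary, so that a product of polynomials acts as two successive
  multiplications.\<close>

lemma trig_orth_polynomial:
  fixes p :: "real^2 \<Rightarrow> real"
  assumes "real_polynomial_function p" "trig_orth f"
  shows "trig_orth (\<lambda>t. p (pol 1 t) * f t)"
  using assms
proof (induction p arbitrary: f rule: real_polynomial_function.induct)
  case lin: (linear h)
  interpret bounded_linear h by fact
  have "pol 1 t = cos t *\<^sub>R axis 1 1 + sin t *\<^sub>R axis 2 1" for t
    by (simp add: vec_eq_iff forall_2 axis_def)
  then have "h (pol 1 t) = cos t * h (axis 1 1) + sin t * h (axis 2 1)" for t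
    by (simp only: add scaleR real_scaleR_def)
  then have "(\<lambda>t. h (pol 1 t) * f t) = (\<lambda>t. h (axis 1 1) * (cos t * f t) + h (axis 2 1) * (sin t * f t))"
    by (simp add: algebra_simps)
  then show ?case using trig_orth_comb[OF trig_orth_cos_sin[OF lin.prems]] by simp
next
  case (const c)
  show ?case using trig_orth_comb[OF const const, of c 0] by simp
next
  case (add p q)
  show ?case using trig_orth_comb[OF add.IH(1)[OF add.prems] add.IH(2)[OF add.prems], of 1 1]
    by (simp add: algebra_simps)
next
  case (mult p q)
  show ?case using mult.IH(1)[OF mult.IH(2)[OF mult.prems]] by (simp add: mult.assoc)
qed

text \<open>Approximate f within e by a polynomial p on the unit circle. Since p f integrates to 0,
  the integral of f^2 equals that of f (f - p) and is at most e times that of |f|. Working on the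
  circle builds in periodicity.\<close>

lemma trig_orth_imp_zero:
  assumes u: "continuous_on (cball 0 R) u" and r: "0 < r" "r \<le> R"
    and orth: "trig_orth (\<lambda>t. u (pol r t))" and t: "0 \<le> t" "t \<le> 2 * pi"
  shows "u (pol r t) = 0"
proof -
  let ?f = "\<lambda>t. u (pol r t)"
  have fc: "continuous_on {0..2 * pi} ?f" using trig_orth_D(1)[OF orth] .
  define C where "C = integral {0..2 * pi} (\<lambda>t. \<bar>?f t\<bar>)"
  have C: "0 \<le> C" unfolding C_def by (intro integral_nonneg integrable_continuous_interval continuous_intros fc) auto
  have g: "continuous_on (sphere 0 1) (\<lambda>x. u (r *\<^sub>R x))"
    by (intro continuous_on_compose2[OF u] continuous_intros) (use r in auto)
  have le: "integral {0..2 * pi} (\<lambda>t. ?f t * ?f t) \<le> e * C" if e: "0 < e" for e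
  proof -
    obtain p where p: "real_polynomial_function p" "\<And>x. x \<in> sphere 0 1 \<Longrightarrow> \<bar>u (r *\<^sub>R x) - p x\<bar> < e"
      using Stone_Weierstrass_real_polynomial_function[OF compact_sphere g e] by metis
    have pt: "\<bar>?f t - p (pol 1 t)\<bar> < e" for t
    proof -
      have "pol r t = r *\<^sub>R pol 1 t" by (simp add: vec_eq_iff forall_2)
      then show ?thesis using p(2)[of "pol 1 t"] by simp
    qed
    have pc: "continuous_on {0..2 * pi} (\<lambda>t. p (pol 1 t) * ?f t)"
      and p0: "integral {0..2 * pi} (\<lambda>t. p (pol 1 t) * ?f t) = 0"
      using trig_orth_D(1)[OF trig_orth_polynomial[OF p(1) orth]] trig_orth_D(2)[OF trig_orth_polynomial[OF p(1) orth], of 0]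
      by simp_all
    have "integral {0..2 * pi} (\<lambda>t. ?f t * ?f t)
        = integral {0..2 * pi} (\<lambda>t. ?f t * ?f t - p (pol 1 t) * ?f t)"
      using p0 by (subst integral_diff) (auto intro!: integrable_continuous_interval continuous_intros fc pc)
    also have "\<dots> \<le> integral {0..2 * pi} (\<lambda>t. e * \<bar>?f t\<bar>)"
    proof (rule integral_le)
      show "(\<lambda>t. ?f t * ?f t - p (pol 1 t) * ?f t) integrable_on {0..2 * pi}"
        "(\<lambda>t. e * \<bar>?f t\<bar>) integrable_on {0..2 * pi}"
        by (intro integrable_continuous_interval continuous_intros fc pc)+
      fix t
      have "?f t * ?f t - p (pol 1 t) * ?f t \<le> \<bar>?f t - p (pol 1 t)\<bar> * \<bar>?f t\<bar>"
        unfolding abs_mult[symmetric] left_diff_distrib[symmetric] by (rule abs_ge_self)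
      also have "\<dots> \<le> e * \<bar>?f t\<bar>" using pt[of t] by (intro mult_right_mono) auto
      finally show "?f t * ?f t - p (pol 1 t) * ?f t \<le> e * \<bar>?f t\<bar>" .
    qed
    also have "\<dots> = e * C" by (simp add: C_def)
    finally show ?thesis .
  qed
  have "integral {0..2 * pi} (\<lambda>t. ?f t * ?f t) \<le> 0"
  proof (rule field_le_epsilon)
    fix e :: real assume e: "0 < e"
    have "e / (C + 1) * C \<le> e" using C e by (simp add: field_simps)
    then show "integral {0..2 * pi} (\<lambda>t. ?f t * ?f t) \<le> 0 + e"
      using le[of "e / (C + 1)"] C e by simp
  qed
  moreover have "0 \<le> integral {0..2 * pi} (\<lambda>t. ?f t * ?f t)"
    by (intro integral_nonneg integrable_continuous_interval continuous_intros fc) auto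
  ultimately have "integral {0..2 * pi} (\<lambda>t. ?f t * ?f t) = 0" by simp
  moreover have "integral {0..2 * pi} (\<lambda>t. ?f t * ?f t) = 0 \<longleftrightarrow> (\<forall>t\<in>{0..2 * pi}. ?f t * ?f t = 0)"
    by (rule integral_eq_0_iff) (auto intro: continuous_on_mult fc)
  ultimately have z: "\<forall>t\<in>{0..2 * pi}. ?f t * ?f t = 0" by blast
  have "?f t * ?f t = 0" by (rule bspec[OF z]) (use t in simp)
  then show ?thesis by (simp only: mult_eq_0_iff disj_absorb)
qed

text \<open>If \<eta> avoids every \<open>steklov_value\<close>, all modes of u vanish on every
  circle, so u is 0 off the pole and, by continuity, at it.\<close>

lemma disk_spectrum_subset:
  assumes R: "0 < R" "K * R\<^sup>2 < pi\<^sup>2"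
  shows "disk_spectrum K R \<subseteq> range (steklov_value K R)"
proof
  fix \<eta> assume "\<eta> \<in> disk_spectrum K R"
  then obtain u where u: "smooth_on (cball 0 R) u" "\<exists>x\<in>cball 0 R. u x \<noteq> 0"
    "\<forall>x\<in>cball 0 R. laplace_beltrami (space_form_metric K) (laplace_beltrami (space_form_metric K) u) x = 0"
    "\<forall>x\<in>frontier (cball 0 R). u x = 0"
    "\<forall>x\<in>frontier (cball 0 R). laplace_beltrami (space_form_metric K) u x
      = \<eta> * frechet_derivative u (at x) (x /\<^sub>R norm x)"
    unfolding disk_spectrum_def steklov4_eigenvalue_def by blast
  have u0: "u x = 0" if "norm x = R" for x using u(4) that by simp
  obtain U where U: "open U" "cball 0 R \<subseteq> U" "Cinf U u"
    using u(1) unfolding smooth_on_def Cinf_def by blast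
  \<comment> \<open>The metric coefficients are known to be smooth only on the domain; V is still an
    open neighbourhood of the closed disk.\<close>
  define V where "V = U \<inter> space_form_domain K"
  have "cball 0 R \<subseteq> V"
    using U(2) space_form_domain_mono[OF norm_ge_zero _ R(2)]
    by (auto simp: V_def space_form_domain_def)
  then have V: "open V" "cball 0 R \<subseteq> V" "V \<subseteq> space_form_domain K" "ball 0 R \<subseteq> V"
    using U(1) open_space_form_domain ball_subset_cball by (auto simp: V_def)
  have uV: "Cinf V u" using Cinf_subset[OF U(3)] by (simp add: V_def)
  define v where "v = laplace_beltrami (space_form_metric K) u"
  have vV: "Cinf V v" unfolding v_def by (rule Cinf_laplace_beltrami[OF V(1,3) uV])
  have cont: "continuous_on (cball 0 R) f" if "Cinf V f" for f
    by (rule continuous_on_subset[OF Cinf_continuous_on[OF that] V(2)])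
  note reg = Cinf_subset[OF uV V(4)] cont[OF uV] cont[OF Cinf_euler_op[OF V(1,3) uV]]
    cont[OF vV] cont[OF Cinf_euler_op[OF V(1,3) vV]] v_def
  have bih: "laplace_beltrami (space_form_metric K) v x = 0" if "x \<in> ball 0 R" for x
    using u(3) that by (simp add: v_def)
  have bc: "v x = \<eta> * (euler_op u x / R)" if "norm x = R" for x
  proof -
    have "x \<in> V" using that V(2) by auto
    from frechet_derivative_at[OF Cinf_has_derivative[OF V(1) uV this], symmetric]
    have "frechet_derivative u (at x) (x /\<^sub>R norm x) = euler_op u x / R"
      using that R(1) by (simp add: euler_op_def divide_inverse algebra_simps)
    then show ?thesis using u(5) that by (simp add: v_def)
  qed
  show "\<eta> \<in> range (steklov_value K R)"
  proof (rule ccontr)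
    assume no: "\<eta> \<notin> range (steklov_value K R)"
    have orth: "trig_orth (\<lambda>t. u (pol r t))" if r: "0 < r" "r \<le> R" for r
      unfolding trig_orth_def
    proof (intro conjI allI)
      show "continuous_on {0..2 * pi} (\<lambda>t. u (pol r t))"
        by (intro continuous_on_compose2[OF reg(2)] continuous_intros) (use r in auto)
      fix n :: nat
      have per: "cos (real n * (2 * pi)) = 1" "sin (real n * (2 * pi)) = 0"
        using cos_2npi[of n] sin_2npi[of n] by (simp_all add: mult_ac)
      have n: "\<eta> \<noteq> steklov_value K R n" using no by blast
      interpret C: angular_mode n "\<lambda>t. cos (real n * t)" "\<lambda>t. - real n * sin (real n * t)"
        by unfold_locales (auto intro!: derivative_eq_intros simp: power2_eq_square per)
      show "integral {0..2 * pi} (\<lambda>t. u (pol r t) * cos (real n * t)) = 0"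
        using C.mode_dichotomy[OF R reg bih u0 bc n r] by (simp add: C.ang_def)
      interpret S: angular_mode n "\<lambda>t. sin (real n * t)" "\<lambda>t. real n * cos (real n * t)"
        by unfold_locales (auto intro!: derivative_eq_intros simp: power2_eq_square per)
      show "integral {0..2 * pi} (\<lambda>t. u (pol r t) * sin (real n * t)) = 0"
        using S.mode_dichotomy[OF R reg bih u0 bc n r] by (simp add: S.ang_def)
    qed
    have zero: "u x = 0" if "x \<in> cball 0 R - {0}" for x
    proof -
      obtain t where t: "0 \<le> t" "t \<le> 2 * pi" "x = pol (norm x) t" by (rule polE)
      have r: "0 < norm x" "norm x \<le> R" using that by auto
      show ?thesis using trig_orth_imp_zero[OF reg(2) r orth[OF r] t(1,2)] t(3) by simp
    qed
    have c0: "continuous_on {0..R} (\<lambda>r. u (pol r 0))"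
      by (intro continuous_on_compose2[OF reg(2)] continuous_intros) auto
    have "u 0 = 0"
    proof -
      have zp: "u (pol r 0) = 0" if "0 < r" "r \<le> R" for r
      proof (rule zero)
        have "norm (pol r 0) = r" using that by simp
        then show "pol r 0 \<in> cball 0 R - {0}" using that by (auto simp del: norm_pol)
      qed
      have "((\<lambda>r. u (pol r 0)) \<longlongrightarrow> u (pol 0 0)) (at 0 within {0..R})"
        using c0 R(1) by (simp add: continuous_on_def)
      then have "((\<lambda>r. 0) \<longlongrightarrow> u (pol 0 0)) (at 0 within {0..R})"
        by (rule Lim_transform_eventually)
           (auto simp: eventually_at zp intro!: exI[of _ 1])
      moreover have "at 0 within {0..R} \<noteq> bot"
        using R(1) by (simp add: trivial_limit_within islimpt_Icc)
      ultimately have "u (pol 0 0) = 0" using tendsto_unique tendsto_const by metis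
      moreover have "pol 0 0 = 0" by (simp add: vec_eq_iff forall_2)
      ultimately show ?thesis by simp
    qed
    then show False using u(2) zero by (metis Diff_iff empty_iff insert_iff)
  qed
qed

section \<open>Existence of the eigenfunctions\<close>

text \<open>In polar form r^k cos (k t). Times (s / r)^k, which is smooth in r^2, it makes s^k cos
  (k t) visibly smooth at the pole.\<close>

definition harmonic_poly :: "nat \<Rightarrow> real^2 \<Rightarrow> real" where
  "harmonic_poly k x = Re (Complex (x $ 1) (x $ 2) ^ k)"

lemma Cinf_harmonic_poly: "open U \<Longrightarrow> Cinf U (harmonic_poly k)"
proof -
  assume U: "open U"
  have "Cinf U (\<lambda>x. Re (Complex (x $ 1) (x $ 2) ^ k)) \<and> Cinf U (\<lambda>x. Im (Complex (x $ 1) (x $ 2) ^ k))"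
  proof (induction k)
    case (Suc k)
    then show ?case
      using U by (auto intro!: Cinf_add Cinf_diff Cinf_mult Cinf_nth)
  qed (simp add: Cinf_const)
  then show ?thesis by (simp add: harmonic_poly_def[abs_def])
qed

lemma harmonic_poly_pol: "harmonic_poly k (pol r t) = r ^ k * cos (real k * t)"
proof -
  have "Complex (pol r t $ 1) (pol r t $ 2) = of_real r * cis t"
    by (simp add: complex_eq_iff)
  then have "Complex (pol r t $ 1) (pol r t $ 2) ^ k = of_real (r ^ k) * cis (real k * t)"
    by (simp only: power_mult_distrib Complex.DeMoivre of_real_power)
  then show ?thesis by (simp add: harmonic_poly_def)
qed

lemma pol_in_domain: "pol r t \<in> space_form_domain K \<longleftrightarrow> K * r\<^sup>2 < pi\<^sup>2"
  by (simp add: space_form_domain_def)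

text \<open>\<open>G\<close> stands for h f'. The eigenfunctions have h f' in closed form, so its
  derivative replaces f''.\<close>

lemma laplace_beltrami_separated:
  assumes w: "Cinf (space_form_domain K) w"
    and f: "\<And>r t. 0 < r \<Longrightarrow> K * r\<^sup>2 < pi\<^sup>2 \<Longrightarrow> w (pol r t) = f r * cos (real k * t)"
    and df: "\<And>r. 0 < r \<Longrightarrow> K * r\<^sup>2 < pi\<^sup>2 \<Longrightarrow> (f has_real_derivative G r / space_form_h K r) (at r)"
    and dG: "\<And>r. 0 < r \<Longrightarrow> K * r\<^sup>2 < pi\<^sup>2 \<Longrightarrow> (G has_real_derivative G' r) (at r)"
    and r: "0 < r" "K * r\<^sup>2 < pi\<^sup>2"
  shows "euler_op w (pol r t) = r * (G r / space_form_h K r) * cos (real k * t)"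
    and "laplace_beltrami (space_form_metric K) w (pol r t)
      = (G' r / space_form_h K r - (real k)\<^sup>2 * f r / (space_form_h K r)\<^sup>2) * cos (real k * t)"
proof -
  let ?D = "space_form_domain K"
  let ?I = "{r. 0 < r \<and> K * r\<^sup>2 < pi\<^sup>2}"
  note D = open_space_form_domain
  have I: "open ?I"
    by (intro open_Collect_conj open_Collect_less continuous_intros)
  have E: "euler_op w (pol r t) = r * (G r / space_form_h K r) * cos (real k * t)"
    if r: "0 < r" "K * r\<^sup>2 < pi\<^sup>2" for r t
  proof -
    have "((\<lambda>r. f r * cos (real k * t)) has_real_derivative G r / space_form_h K r * cos (real k * t)) (at r)"
      by (rule DERIV_cmult_right[OF df[OF r]])
    then have "((\<lambda>r. w (pol r t)) has_real_derivative G r / space_form_h K r * cos (real k * t)) (at r)"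
      by (rule has_field_derivative_transform_within_open[OF _ I]) (use r f in auto)
    with Cinf_radial_deriv[OF D w, of r t] r
    have "partial_deriv 1 w (pol r t) * cos t + partial_deriv 2 w (pol r t) * sin t = G r / space_form_h K r * cos (real k * t)"
      unfolding pol_in_domain by (blast intro: DERIV_unique)
    from arg_cong[OF this, of "\<lambda>z. r * z"] show ?thesis
      unfolding euler_op_def pol_nth by (simp only: distrib_left mult_ac)
  qed
  then show "euler_op w (pol r t) = r * (G r / space_form_h K r) * cos (real k * t)" using r by blast
  have wE: "Cinf ?D (euler_op w)" and wR: "Cinf ?D (rot_op w)"
    using Cinf_euler_op[OF D _ w] Cinf_rot_op[OF D _ w] by auto
  define H C where "H = h_series K (r\<^sup>2)" and "C = c_series K (r\<^sup>2)"
  note fa = space_form_local[OF r]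
  have H: "0 < H" "space_form_h K r = r * H" using fa by (auto simp: H_def)
  obtain h' where h': "(h_series K has_real_derivative h') (at (r\<^sup>2))" "2 * r\<^sup>2 * h' = C - H"
    using h_series_deriv[where q = "r\<^sup>2" and K = K] unfolding H_def C_def by metis
  have sq: "((\<lambda>r. r\<^sup>2) has_real_derivative 2 * r) (at r)"
    by (auto intro!: derivative_eq_intros)
  have Hr: "((\<lambda>r. h_series K (r\<^sup>2)) has_real_derivative h' * (2 * r)) (at r)"
    by (rule DERIV_chain2[OF h'(1) sq])
  have "((\<lambda>r. G r / h_series K (r\<^sup>2) * cos (real k * t)) has_real_derivative
      (G' r * H - G r * (h' * (2 * r))) / (H * H) * cos (real k * t)) (at r)"
    unfolding H_def by (rule DERIV_cmult_right[OF DERIV_divide[OF dG[OF r] Hr]]) (use H in \<open>simp add: H_def\<close>)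
  then have "((\<lambda>r. euler_op w (pol r t)) has_real_derivative
      (G' r * H - G r * (h' * (2 * r))) / (H * H) * cos (real k * t)) (at r)"
    by (rule has_field_derivative_transform_within_open[OF _ I])
       (use r E space_form_local(1,4) in \<open>auto simp: field_simps\<close>)
  with Cinf_radial_deriv[OF D wE, of r t] r
  have "partial_deriv 1 (euler_op w) (pol r t) * cos t + partial_deriv 2 (euler_op w) (pol r t) * sin t
      = (G' r * H - G r * (h' * (2 * r))) / (H * H) * cos (real k * t)"
    unfolding pol_in_domain by (blast intro: DERIV_unique)
  from arg_cong[OF this, of "\<lambda>z. r * z"]
  have EE: "euler_op (euler_op w) (pol r t) = r * ((G' r * H - G r * (h' * (2 * r))) / (H * H) * cos (real k * t))"
    unfolding euler_op_def[of "euler_op w"] pol_nth by (simp only: distrib_left mult_ac)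
  have R1: "rot_op w (pol r t) = - (real k * f r * sin (real k * t))" for t
  proof -
    have "((\<lambda>t. f r * cos (real k * t)) has_real_derivative - (real k * f r * sin (real k * t))) (at t)"
      by (auto intro!: derivative_eq_intros)
    then have "((\<lambda>t. w (pol r t)) has_real_derivative - (real k * f r * sin (real k * t))) (at t)"
      using f[OF r] by simp
    from DERIV_unique[OF Cinf_angular_deriv[OF D w] this] show ?thesis using r by (simp add: pol_in_domain)
  qed
  have R2: "rot_op (rot_op w) (pol r t) = - ((real k)\<^sup>2 * f r * cos (real k * t))"
  proof -
    have "((\<lambda>t. - (real k * f r * sin (real k * t))) has_real_derivative - ((real k)\<^sup>2 * f r * cos (real k * t))) (at t)"
      by (auto intro!: derivative_eq_intros simp: power2_eq_square)
    then have "((\<lambda>t. rot_op w (pol r t)) has_real_derivative - ((real k)\<^sup>2 * f r * cos (real k * t))) (at t)"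
      unfolding R1 .
    from DERIV_unique[OF Cinf_angular_deriv[OF D wR] this] show ?thesis using r by (simp add: pol_in_domain)
  qed
  let ?c = "cos (real k * t)"
  have "r\<^sup>2 * H * laplace_beltrami (space_form_metric K) w (pol r t)
      = H * euler_op (euler_op w) (pol r t) + (C - H) * euler_op w (pol r t) + rot_op (rot_op w) (pol r t) / H"
    using laplace_beltrami_polar[OF D subset_refl w, of "pol r t"] r
    by (simp add: pol_in_domain norm_pol_sq H_def C_def)
  also have "\<dots> = (r * G' r - (2 * r\<^sup>2 * h') * G r / H) * ?c + (C - H) * (G r / H * ?c) - (real k)\<^sup>2 * f r / H * ?c"
    unfolding EE E[OF r] R2 H(2) using H(1) r(1) by (simp add: field_simps power2_eq_square)
  also have "\<dots> = (r * G' r - (real k)\<^sup>2 * f r / H) * ?c"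
    unfolding h'(2) by (simp add: algebra_simps)
  finally have "laplace_beltrami (space_form_metric K) w (pol r t) = (r * G' r - (real k)\<^sup>2 * f r / H) * ?c / (r\<^sup>2 * H)"
    using H(1) r(1) by (simp add: field_simps)
  also have "\<dots> = (G' r / (r * H) - (real k)\<^sup>2 * f r / (r * H)\<^sup>2) * ?c"
    using H(1) r(1) by (simp add: field_simps power2_eq_square)
  finally show "laplace_beltrami (space_form_metric K) w (pol r t)
      = (G' r / space_form_h K r - (real k)\<^sup>2 * f r / (space_form_h K r)\<^sup>2) * cos (real k * t)"
    unfolding H(2) .
qed

lemma laplace_beltrami_cong:
  assumes "\<And>x. x \<in> space_form_domain K \<Longrightarrow> u x = w x" "x \<in> space_form_domain K"
  shows "laplace_beltrami (space_form_metric K) u x = laplace_beltrami (space_form_metric K) w x"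
proof -
  note p = partial_deriv_cong_open[OF open_space_form_domain]
  have "space_form_flux K u i y = space_form_flux K w i y" if "y \<in> space_form_domain K" for i y
    using p[OF that assms(1)] by (simp add: space_form_flux_def euler_op_def)
  from p[OF assms(2) this] show ?thesis
    unfolding laplace_beltrami_eq_flux[OF assms(2)] by simp
qed

text \<open>Polar computations leave out the pole; it is filled in along the ray of angle 0.\<close>

lemma eq_on_domain_by_continuity:
  assumes "Cinf (space_form_domain K) f" "Cinf (space_form_domain K) g"
    and eq: "\<And>r t. 0 < r \<Longrightarrow> K * r\<^sup>2 < pi\<^sup>2 \<Longrightarrow> f (pol r t) = g (pol r t)"
    and x: "x \<in> space_form_domain K"
  shows "f x = g x"
proof (cases "x = 0")
  case False
  obtain t where t: "x = pol (norm x) t" by (rule polE)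
  have "0 < norm x" "K * (norm x)\<^sup>2 < pi\<^sup>2" using False x by (auto simp: space_form_domain_def)
  from eq[OF this, of t] show ?thesis using t by simp
next
  case True
  let ?d = "\<lambda>x. f x - g x"
  have D: "open (space_form_domain K)" by (rule open_space_form_domain)
  have "continuous_on (space_form_domain K) ?d"
    using assms(1,2) by (intro continuous_on_diff Cinf_continuous_on)
  then have "isCont ?d 0" using D x True by (simp add: continuous_on_eq_continuous_at)
  then have "isCont (\<lambda>r. ?d (pol r 0)) 0"
  proof -
    assume c: "isCont ?d 0"
    have "isCont (\<lambda>r. pol r 0) 0"
      using pol_has_derivative_radius has_derivative_continuous by blast
    moreover have "pol 0 0 = 0" by (simp add: vec_eq_iff forall_2)
    ultimately show ?thesis using isCont_o2[of 0 "\<lambda>r. pol r 0" ?d] c by simp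
  qed
  then have "((\<lambda>r. ?d (pol r 0)) \<longlongrightarrow> ?d (pol 0 0)) (at_right 0)"
    using isCont_def filterlim_at_split by blast
  moreover have "eventually (\<lambda>r. ?d (pol r 0) = 0) (at_right 0)"
  proof -
    have "eventually (\<lambda>r. K * r\<^sup>2 < pi\<^sup>2) (at_right (0::real))"
    proof (rule order_tendstoD(2))
      show "((\<lambda>r. K * r\<^sup>2) \<longlongrightarrow> K * 0\<^sup>2) (at_right (0::real))" by (intro tendsto_intros)
    qed simp
    moreover have "eventually (\<lambda>r. 0 < r) (at_right (0::real))" by (rule eventually_at_right_less)
    ultimately show ?thesis by eventually_elim (use eq in auto)
  qed
  then have "((\<lambda>r. ?d (pol r 0)) \<longlongrightarrow> 0) (at_right 0)" by (rule tendsto_eventually)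
  ultimately have "?d (pol 0 0) = 0" by (rule tendsto_unique[OF trivial_limit_at_right_real])
  moreover have "pol 0 0 = 0" by (simp add: vec_eq_iff forall_2)
  ultimately show ?thesis using True by simp
qed

definition s_series :: "real \<Rightarrow> real \<Rightarrow> real" where
  "s_series K q = 2 * h_series K q / (1 + c_series K q)"

lemma s_series_eq: "r * s_series K (r\<^sup>2) = space_form_s K r"
  using series_eq_space_form[of r K] by (simp add: s_series_def space_form_s_def)

text \<open>Up to a constant, the factor b in the eigenfunction b s^k cos (k t), as a function of
  \<sigma> = s^2. The flux equation demands that h b' s^(2 k) be the integral of h s^(2 k) up to r,
  so b' = s^2 J / (2 h) with J = \<open>kint k 2 y\<close>; this is a primitive.\<close>

definition mode_amplitude :: "real \<Rightarrow> nat \<Rightarrow> real \<Rightarrow> real" where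
  "mode_amplitude K k \<sigma> = \<sigma> / 4 * kint k 1 (K * \<sigma> / 4)"

lemma Cinf_kint:
  assumes "open U" "Cinf U f" "\<And>x. x \<in> U \<Longrightarrow> -1 < f x"
  shows "Cinf U (\<lambda>x. kint k 1 (f x))"
proof -
  let ?\<phi> = "\<lambda>n y. (- 1) ^ n * fact n * kint (k + n) (Suc n) y"
  have "Cinf U (\<lambda>x. ?\<phi> 0 (f x))"
  proof (rule Cinf_compose[OF assms(1,2), where I = "{-1<..}" and \<phi> = ?\<phi>])
    fix n and t :: real assume "t \<in> {-1<..}"
    then have "(?\<phi> n has_real_derivative (- 1) ^ n * fact n * (- real (Suc n) * kint (Suc (k + n)) (Suc (Suc n)) t)) (at t)"
      by (intro DERIV_cmult kint_deriv) auto
    moreover have "(- 1) ^ n * fact n * (- real (Suc n) * x) = (- 1) ^ Suc n * fact (Suc n) * x" for x :: real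
      by (simp add: algebra_simps)
    ultimately show "(?\<phi> n has_real_derivative ?\<phi> (Suc n) t) (at t)" by simp
  qed (use assms(3) in auto)
  then show ?thesis by simp
qed

text \<open>\<open>kint_step\<close> with j = 1 merges the two terms of the product rule.\<close>

lemma mode_amplitude_deriv:
  assumes "0 < r" "K * r\<^sup>2 < pi\<^sup>2"
  shows "((\<lambda>r. mode_amplitude K k ((space_form_s K r)\<^sup>2)) has_real_derivative
    (space_form_s K r)\<^sup>2 * kint k 2 (space_form_y K r) / (2 * space_form_h K r)) (at r)"
proof -
  note d = less_imp_le[OF assms(1)] assms(2)
  note l = space_form_local[OF assms]
  let ?s = "space_form_s K r" and ?y = "space_form_y K r"
  have y: "-1 < ?y" by (rule space_form_y_gt[OF d])
  have eq: "mode_amplitude K k ((space_form_s K r)\<^sup>2) = (space_form_s K r)\<^sup>2 / 4 * kint k 1 (space_form_y K r)" for r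
    by (simp add: mode_amplitude_def space_form_y_def)
  have s2: "((\<lambda>r. (space_form_s K r)\<^sup>2 / 4) has_real_derivative ?s / 2 * (1 + ?y)) (at r)"
    by (rule DERIV_cong[OF DERIV_cdivide[OF DERIV_power[OF space_form_s_deriv[OF d]]]]) simp
  have "((\<lambda>r. (space_form_s K r)\<^sup>2 / 4 * kint k 1 (space_form_y K r)) has_real_derivative
      ?s\<^sup>2 / 4 * (- real 1 * kint (Suc k) (Suc 1) ?y * (K * ?s / 2 * (1 + ?y))) + ?s / 2 * (1 + ?y) * kint k 1 ?y) (at r)"
    by (intro DERIV_mult' s2 DERIV_chain2[OF kint_deriv[OF y] space_form_y_deriv[OF d]])
  also have "?s\<^sup>2 / 4 * (- real 1 * kint (Suc k) (Suc 1) ?y * (K * ?s / 2 * (1 + ?y))) + ?s / 2 * (1 + ?y) * kint k 1 ?y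
      = ?s / 2 * (1 + ?y) * (kint k 1 ?y - (K * ?s\<^sup>2 / 4) * kint (Suc k) (Suc 1) ?y)"
    by (simp add: power2_eq_square field_simps)
  also have "kint k 1 ?y - (K * ?s\<^sup>2 / 4) * kint (Suc k) (Suc 1) ?y = kint k 2 ?y"
    using kint_step[OF y, of k 1] by (simp add: space_form_y_def numeral_2_eq_2)
  also have "?s / 2 * (1 + ?y) * kint k 2 ?y = ?s\<^sup>2 * kint k 2 ?y / (2 * space_form_h K r)"
    unfolding l(5) by (simp add: power2_eq_square)
  finally show ?thesis unfolding eq .
qed

text \<open>The witness u solves Laplacian u = v with v = s^k cos (k t) harmonic; subtracting the
  amplitude at R makes u vanish on the boundary.\<close>

lemma steklov_value_in_disk_spectrum:
  assumes R: "0 < R" "K * R\<^sup>2 < pi\<^sup>2"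
  shows "steklov_value K R k \<in> disk_spectrum K R"
proof -
  let ?D = "space_form_domain K" and ?L = "laplace_beltrami (space_form_metric K)"
  let ?s = "space_form_s K" and ?h = "space_form_h K"
  note D = open_space_form_domain[of K]
  define b where "b r = mode_amplitude K k ((?s r)\<^sup>2) - mode_amplitude K k ((?s R)\<^sup>2)" for r
  define M where "M r = ?s r ^ (2 * k + 2) / 2 * kint k 2 (space_form_y K r)" for r
  define v where "v x = s_series K ((norm x)\<^sup>2) ^ k * harmonic_poly k x" for x :: "real^2"
  define u where "u x = (mode_amplitude K k ((norm x)\<^sup>2 * (s_series K ((norm x)\<^sup>2))\<^sup>2)
    - mode_amplitude K k ((?s R)\<^sup>2)) * v x" for x :: "real^2"
  have Sq: "(norm x)\<^sup>2 * (s_series K ((norm x)\<^sup>2))\<^sup>2 = (?s (norm x))\<^sup>2" for x :: "real^2"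
    by (simp add: s_series_eq[symmetric] power_mult_distrib)
  have cS: "Cinf ?D (\<lambda>x. s_series K ((norm x)\<^sup>2))"
    unfolding s_series_def
    by (intro Cinf_divide Cinf_mult Cinf_add Cinf_const Cinf_h_series Cinf_c_series D subset_refl)
       (use c_series_gt in force)
  have cv: "Cinf ?D v"
    unfolding v_def[abs_def] by (intro Cinf_mult Cinf_power cS Cinf_harmonic_poly D)
  have c\<sigma>: "Cinf ?D (\<lambda>x. (norm x)\<^sup>2 * (s_series K ((norm x)\<^sup>2))\<^sup>2)"
    by (intro Cinf_mult Cinf_power cS Cinf_norm_sq D)
  have cu: "Cinf ?D u"
    unfolding u_def[abs_def] mode_amplitude_def[of K k "_ * _"]
  proof (intro Cinf_mult Cinf_diff Cinf_kint cv Cinf_const D)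
    show "Cinf ?D (\<lambda>x. (norm x)\<^sup>2 * (s_series K ((norm x)\<^sup>2))\<^sup>2 / 4)"
      using Cinf_mult[OF D c\<sigma> Cinf_const[of _ "1 / 4"]] by simp
    show "Cinf ?D (\<lambda>x. K * ((norm x)\<^sup>2 * (s_series K ((norm x)\<^sup>2))\<^sup>2) / 4)"
      using Cinf_mult[OF D c\<sigma> Cinf_const[of _ "K / 4"]] by (simp add: mult.commute)
    fix x assume "x \<in> ?D"
    then show "- 1 < K * ((norm x)\<^sup>2 * (s_series K ((norm x)\<^sup>2))\<^sup>2) / 4"
      unfolding Sq using space_form_y_gt[of "norm x" K] by (simp add: space_form_domain_def space_form_y_def)
  qed
  have vp: "v (pol r t) = ?s r ^ k * cos (real k * t)" if "0 < r" for r t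
    using that by (simp add: v_def harmonic_poly_pol norm_pol_sq s_series_eq[symmetric] power_mult_distrib)
  have up: "u (pol r t) = b r * ?s r ^ k * cos (real k * t)" if "0 < r" for r t
    using that unfolding u_def Sq vp[OF that] by (simp add: b_def)
  have dsk: "((\<lambda>r. ?s r ^ k) has_real_derivative real k * ?s r ^ k / ?h r) (at r)"
    if "0 < r" "K * r\<^sup>2 < pi\<^sup>2" for r
    by (rule DERIV_cong[OF DERIV_power[OF space_form_local(6)[OF that]]])
       (use space_form_local(2)[OF that] in \<open>cases k; auto\<close>)
  have Lv: "?L v (pol r t) = 0" if r: "0 < r" "K * r\<^sup>2 < pi\<^sup>2" for r t
  proof -
    have "?L v (pol r t) = (real k * (real k * ?s r ^ k / ?h r) / ?h r - (real k)\<^sup>2 * ?s r ^ k / (?h r)\<^sup>2) * cos (real k * t)"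
      by (rule laplace_beltrami_separated(2)[OF cv vp dsk DERIV_cmult[OF dsk] r])
    then show ?thesis by (simp add: power2_eq_square)
  qed
  \<comment> \<open>\<open>G\<close> is h times the derivative of b s^k; the term M / s^k comes from
    h b' s^k.\<close>
  define G where "G r = M r / ?s r ^ k + real k * (b r * ?s r ^ k)" for r
  have Ms: "M r / ?s r ^ k = ?s r ^ k * ((?s r)\<^sup>2 * kint k 2 (space_form_y K r) / 2)" if "0 < ?s r" for r
  proof -
    have "?s r ^ (2 * k + 2) = ?s r ^ k * ?s r ^ k * (?s r)\<^sup>2" by (simp only: power_add mult_2)
    then show ?thesis using that unfolding M_def by simp
  qed
  have db: "(b has_real_derivative (?s r)\<^sup>2 * kint k 2 (space_form_y K r) / (2 * ?h r)) (at r)"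
    if "0 < r" "K * r\<^sup>2 < pi\<^sup>2" for r
    unfolding b_def[abs_def] by (rule DERIV_cong[OF DERIV_diff[OF mode_amplitude_deriv[OF that] DERIV_const]]) simp
  have df: "((\<lambda>r. b r * ?s r ^ k) has_real_derivative G r / ?h r) (at r)" if r: "0 < r" "K * r\<^sup>2 < pi\<^sup>2" for r
  proof (rule DERIV_cong[OF DERIV_mult'[OF db[OF r] dsk[OF r]]])
    note l = space_form_local[OF r]
    show "b r * (real k * ?s r ^ k / ?h r) + (?s r)\<^sup>2 * kint k 2 (space_form_y K r) / (2 * ?h r) * ?s r ^ k = G r / ?h r"
      unfolding G_def Ms[OF l(2)] using l(3) by (simp add: field_simps)
  qed
  have dG: "(G has_real_derivative ?h r * ?s r ^ k + real k * real k * (b r * ?s r ^ k) / ?h r) (at r)"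
    if r: "0 < r" "K * r\<^sup>2 < pi\<^sup>2" for r
  proof -
    note l = space_form_local[OF r]
    have dM: "(M has_real_derivative ?h r * ?s r ^ (2 * k)) (at r)"
      unfolding M_def[abs_def] by (rule space_form_mass_deriv[OF less_imp_le[OF r(1)] r(2)])
    have "(G has_real_derivative (?h r * ?s r ^ (2 * k) * ?s r ^ k - M r * (real k * ?s r ^ k / ?h r)) / (?s r ^ k * ?s r ^ k)
        + real k * (G r / ?h r)) (at r)"
    proof -
      have Ge: "G = (\<lambda>r. M r / ?s r ^ k + real k * (b r * ?s r ^ k))" by (rule ext) (rule G_def)
      have nz: "?s r ^ k \<noteq> 0" using l(2) by simp
      show ?thesis
        by (subst Ge) (rule DERIV_add[OF DERIV_divide[OF dM dsk[OF r] nz] DERIV_cmult[OF df[OF r]]])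
    qed
    moreover have "(?h r * ?s r ^ (2 * k) * ?s r ^ k - M r * (real k * ?s r ^ k / ?h r)) / (?s r ^ k * ?s r ^ k)
        + real k * (G r / ?h r) = ?h r * ?s r ^ k + real k * real k * (b r * ?s r ^ k) / ?h r"
    proof -
      have "(h * (P * P) * P - N * (real k * P / h)) / (P * P) + real k * ((N / P + real k * B) / h)
          = h * P + real k * real k * B / h" if "0 < h" "0 < P" for h P N B :: real
        using that by (simp add: field_simps)
      from this[OF l(3), of "?s r ^ k" "M r" "b r * ?s r ^ k"] show ?thesis
        unfolding G_def mult_2 power_add using l(2) by simp
    qed
    ultimately show ?thesis by simp
  qed
  have Lu: "?L u (pol r t) = v (pol r t)" and Eu: "euler_op u (pol r t) = r * (G r / ?h r) * cos (real k * t)"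
    if r: "0 < r" "K * r\<^sup>2 < pi\<^sup>2" for r t
  proof -
    show "euler_op u (pol r t) = r * (G r / ?h r) * cos (real k * t)"
      by (rule laplace_beltrami_separated(1)[OF cu up df dG r])
    have "?L u (pol r t) = ((?h r * ?s r ^ k + real k * real k * (b r * ?s r ^ k) / ?h r) / ?h r
        - (real k)\<^sup>2 * (b r * ?s r ^ k) / (?h r)\<^sup>2) * cos (real k * t)"
      by (rule laplace_beltrami_separated(2)[OF cu up df dG r])
    also have "\<dots> = ?s r ^ k * cos (real k * t)"
      using space_form_local(3)[OF r] by (simp add: add_divide_distrib power2_eq_square)
    finally show "?L u (pol r t) = v (pol r t)" using vp[OF r(1)] by simp
  qed
  have Luv: "?L u x = v x" if "x \<in> ?D" for x
    by (rule eq_on_domain_by_continuity[OF Cinf_laplace_beltrami[OF D subset_refl cu] cv Lu that])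
  have Lv0: "?L v x = 0" if "x \<in> ?D" for x
    by (rule eq_on_domain_by_continuity[OF Cinf_laplace_beltrami[OF D subset_refl cv] Cinf_const Lv that])
  have MD: "cball 0 R \<subseteq> ?D"
    using space_form_domain_mono[OF norm_ge_zero _ R(2)] by (auto simp: space_form_domain_def)
  have biharm: "?L (?L u) x = 0" if "x \<in> cball 0 R" for x
    using laplace_beltrami_cong[of K "?L u" v x] Luv Lv0 MD that by auto
  have bR: "b R = 0" by (simp add: b_def)
  have smooth: "smooth_on (cball 0 R) u"
    unfolding smooth_on_def using D MD cu by (auto simp: Cinf_def)
  have u0: "u x = 0" if "norm x = R" for x
  proof -
    obtain t where "x = pol (norm x) t" by (rule polE)
    then show ?thesis using up[OF R(1), of t] bR that by simp
  qed
  have bc: "?L u x = steklov_value K R k * frechet_derivative u (at x) (x /\<^sub>R norm x)" if x: "norm x = R" for x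
  proof -
    note l = space_form_local[OF R]
    obtain t where "x = pol (norm x) t" by (rule polE)
    then have t: "x = pol R t" using x by simp
    have xD: "x \<in> ?D" using x MD by auto
    have "frechet_derivative u (at x) (x /\<^sub>R norm x) = euler_op u x / R"
      using frechet_derivative_at[OF Cinf_has_derivative[OF D cu xD], symmetric] x R(1)
      by (simp add: euler_op_def divide_inverse algebra_simps)
    also have "\<dots> = G R / ?h R * cos (real k * t)"
      unfolding t Eu[OF R] using R(1) by simp
    also have "G R = M R / ?s R ^ k" by (simp add: G_def bR)
    finally have fd: "frechet_derivative u (at x) (x /\<^sub>R norm x) = M R / ?s R ^ k / ?h R * cos (real k * t)" .
    have N: "steklov_value K R k = ?h R * ?s R ^ (2 * k) / M R"
      unfolding steklov_value_def space_form_mass_eq[OF less_imp_le[OF R(1)] R(2)] M_def ..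
    have MR: "0 < M R"
      using l(2) kint_pos[OF space_form_y_gt[OF less_imp_le[OF R(1)] R(2)]] by (simp add: M_def)
    have "steklov_value K R k * (M R / ?s R ^ k / ?h R * cos (real k * t)) = ?s R ^ k * cos (real k * t)"
      unfolding N mult_2 power_add using MR l(2,3) by simp
    then show ?thesis unfolding fd Luv[OF xD] unfolding t vp[OF R(1)] by simp
  qed
  \<comment> \<open>As b is 0 at R and strictly increasing, u is nonzero at radius R / 2 on the ray
    of angle 0.\<close>
  have "b (R / 2) < b R"
  proof (rule DERIV_pos_imp_increasing[where f = b])
    fix r assume "R / 2 \<le> r" "r \<le> R"
    then have r: "0 < r" "K * r\<^sup>2 < pi\<^sup>2" using R space_form_domain_mono[of r R K] by auto
    have "0 < (?s r)\<^sup>2 * kint k 2 (space_form_y K r) / (2 * ?h r)"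
      using space_form_local(2,3)[OF r] kint_pos[OF space_form_y_gt[OF less_imp_le[OF r(1)] r(2)]] by simp
    then show "\<exists>d. (b has_real_derivative d) (at r) \<and> 0 < d" using db[OF r] by blast
  qed (use R in simp)
  moreover have "0 < ?s (R / 2)"
    by (rule space_form_local(2)) (use R space_form_domain_mono[of "R / 2" R K] in auto)
  ultimately have "u (pol (R / 2) 0) \<noteq> 0"
    using up[of "R / 2" 0] R(1) bR by simp
  moreover have "pol (R / 2) 0 \<in> cball 0 R" using R(1) by simp
  ultimately have nz: "\<exists>x\<in>cball 0 R. u x \<noteq> 0" by blast
  show ?thesis
    unfolding disk_spectrum_def steklov4_eigenvalue_def mem_Collect_eq
    using smooth nz biharm u0 bc by (intro exI[of _ u]) auto
qed

lemma disk_spectrum_eq: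
  assumes "0 < R" "K * R\<^sup>2 < pi\<^sup>2"
  shows "disk_spectrum K R = range (steklov_value K R)"
  using disk_spectrum_subset[OF assms] steklov_value_in_disk_spectrum[OF assms] by blast

section \<open>Monotonicity in the curvature\<close>

text \<open>Here y is only implicit in K; all comparisons pass through the increasing
  \<open>radius_curvature\<close>, by 4 y L^2 = K \<rho>^2.\<close>

lemma eta_radius_monotonicity:
  assumes \<rho>: "0 < \<rho>" and a: "-1 < a" "unimodal (radius_profile m) a"
    and k: "k = 4 * radius_curvature a / \<rho>\<^sup>2" "k \<le> (pi / \<rho>)\<^sup>2"
  shows "strict_antimono_on {..<k} (eta_radius m \<rho>) \<and> strict_mono_on {k<..<(pi / \<rho>)\<^sup>2} (eta_radius m \<rho>)"
proof (rule unimodal_transfer[OF a(2) radius_profile_pos, where C = "2 / \<rho>" and Y = "\<lambda>K. space_form_y K \<rho>"])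
  have dom: "K * \<rho>\<^sup>2 < pi\<^sup>2" if "K < (pi / \<rho>)\<^sup>2" for K
    using that \<rho> by (simp add: power_divide pos_less_divide_eq)
  have y: "-1 < space_form_y K \<rho>" if "K < (pi / \<rho>)\<^sup>2" for K
    by (rule space_form_y_gt[OF less_imp_le[OF \<rho>] dom[OF that]])
  have curv: "4 * radius_curvature (space_form_y K \<rho>) = K * \<rho>\<^sup>2" if "K < (pi / \<rho>)\<^sup>2" for K
  proof -
    have "\<rho>\<^sup>2 = (space_form_s K \<rho> * arctan_quot (space_form_y K \<rho>))\<^sup>2"
      using space_form_radius_eq[OF less_imp_le[OF \<rho>] dom[OF that]] by simp
    then show ?thesis by (simp add: radius_curvature_def space_form_y_def power_mult_distrib)
  qed
  have less_iff: "space_form_y K \<rho> < space_form_y K' \<rho> \<longleftrightarrow> K < K'"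
    if "K < (pi / \<rho>)\<^sup>2" "K' < (pi / \<rho>)\<^sup>2" for K K'
    using radius_curvature_less_iff[OF y[OF that(1)] y[OF that(2)]] curv[OF that(1)] curv[OF that(2)] \<rho>
    by (metis mult_less_cancel_left_pos mult_less_cancel_right_pos zero_less_numeral zero_less_power)
  have k': "4 * radius_curvature a = k * \<rho>\<^sup>2" using \<rho> by (simp add: k(1))
  show "-1 < space_form_y K \<rho>" if "K < (pi / \<rho>)\<^sup>2" for K using y[OF that] .
  show "space_form_y K \<rho> < space_form_y K' \<rho>" if "K < K'" "K' < (pi / \<rho>)\<^sup>2" for K K'
    using less_iff that by simp
  show "space_form_y K \<rho> < a" if "K < (pi / \<rho>)\<^sup>2" "K < k" for K
    using radius_curvature_less_iff[OF y[OF that(1)] a(1)] curv[OF that(1)] k' \<rho> that(2)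
    by (metis mult_less_cancel_left_pos mult_less_cancel_right_pos zero_less_numeral zero_less_power)
  show "a < space_form_y K \<rho>" if "K < (pi / \<rho>)\<^sup>2" "k < K" for K
    using radius_curvature_less_iff[OF a(1) y[OF that(1)]] curv[OF that(1)] k' \<rho> that(2)
    by (metis mult_less_cancel_left_pos mult_less_cancel_right_pos zero_less_numeral zero_less_power)
  show "eta_radius m \<rho> K = 2 / \<rho> / radius_profile m (space_form_y K \<rho>)" if "K < (pi / \<rho>)\<^sup>2" for K
  proof -
    let ?y = "space_form_y K \<rho>"
    have L: "0 < arctan_quot ?y" using arctan_quot_pos[OF y[OF that]] .
    have s: "space_form_s K \<rho> = \<rho> / arctan_quot ?y"
      using space_form_radius_eq[OF less_imp_le[OF \<rho>] dom[OF that]] L by (simp add: field_simps)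
    have "eta_radius m \<rho> K = steklov_value K \<rho> m"
      using disk_spectrum_eq[OF \<rho> dom[OF that]] nth_smallest_range[OF steklov_value_strict_mono[OF \<rho> dom[OF that]]]
      by (simp add: eta_radius_def)
    then show ?thesis
      unfolding steklov_value_eq[OF \<rho> dom[OF that]] unfolding s
      by (simp add: radius_profile_def)
  qed
qed (use \<rho> k(2) in auto)

text \<open>Here y is explicit: pi s^2 = A (1 + y) and 4 y = K s^2 give (1 + y) (4 pi - K A) = 4 pi,
  and k is the curvature at which y = a.\<close>

lemma eta_area_monotonicity:
  assumes A: "0 < A" and a: "-1 < a" "unimodal (area_profile m) a"
    and k: "k = 4 * pi / A * (a / (1 + a))"
  shows "strict_antimono_on {..<k} (eta_area m A) \<and> strict_mono_on {k<..<4 * pi / A} (eta_area m A)"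
proof (rule unimodal_transfer[OF a(2) area_profile_pos,
      where C = "2 * sqrt (pi / A)" and Y = "\<lambda>K. 4 * pi / (4 * pi - K * A) - 1"])
  have dom: "K * A < 4 * pi" if "K < 4 * pi / A" for K
    using that A by (simp add: pos_less_divide_eq)
  show "-1 < 4 * pi / (4 * pi - K * A) - 1" if "K < 4 * pi / A" for K using dom[OF that] by simp
  show "4 * pi / (4 * pi - K * A) - 1 < 4 * pi / (4 * pi - K' * A) - 1" if "K < K'" "K' < 4 * pi / A" for K K'
  proof -
    have "K * A < K' * A" using that A by simp
    then have "4 * pi / (4 * pi - K * A) < 4 * pi / (4 * pi - K' * A)"
      using dom[of K'] that by (intro divide_strict_left_mono mult_pos_pos) auto
    then show ?thesis by simp
  qed
  have kA: "4 * pi / (1 + a) = 4 * pi - k * A"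
  proof -
    have "k * A = 4 * pi * (a / (1 + a))" using A unfolding k by simp
    moreover have "a / (1 + a) = 1 - 1 / (1 + a)" using a(1) by (simp add: field_simps)
    ultimately show ?thesis by (simp add: right_diff_distrib)
  qed
  have k0: "0 < 4 * pi - k * A" using a(1) unfolding kA[symmetric] by simp
  have a': "a = 4 * pi / (4 * pi - k * A) - 1" unfolding kA[symmetric] using a(1) by simp
  show "4 * pi / (4 * pi - K * A) - 1 < a" if "K < 4 * pi / A" "K < k" for K
  proof -
    have "K * A < k * A" using that A by simp
    then have "4 * pi / (4 * pi - K * A) < 4 * pi / (4 * pi - k * A)"
      using k0 dom[of K] that by (intro divide_strict_left_mono mult_pos_pos) auto
    then show ?thesis using a' by simp
  qed
  show "a < 4 * pi / (4 * pi - K * A) - 1" if "K < 4 * pi / A" "k < K" for K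
  proof -
    have "k * A < K * A" using that A by simp
    then have "4 * pi / (4 * pi - k * A) < 4 * pi / (4 * pi - K * A)"
      using k0 dom[of K] that by (intro divide_strict_left_mono mult_pos_pos) auto
    then show ?thesis using a' by simp
  qed
  show "k \<le> 4 * pi / A" using k0 A by (simp add: pos_le_divide_eq)
  show "eta_area m A K = 2 * sqrt (pi / A) / area_profile m (4 * pi / (4 * pi - K * A) - 1)" if "K < 4 * pi / A" for K
  proof -
    define R where "R = disk_radius K A"
    have R: "0 < R" "K * R\<^sup>2 < pi\<^sup>2" "2 * pi * integral {0..R} (space_form_h K) = A"
      using disk_radius[OF A dom[OF that]] by (auto simp: R_def)
    note d = less_imp_le[OF R(1)] R(2)
    define y s where "y = space_form_y K R" and "s = space_form_s K R"
    have y: "-1 < y" and s: "0 < s"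
      using space_form_y_gt[OF d] space_form_s_pos[OF d R(1)] by (auto simp: y_def s_def)
    have As: "pi * s\<^sup>2 = A * (1 + y)"
      using R(3) y unfolding disk_area_eq[OF d] y_def[symmetric] s_def[symmetric] by (simp add: field_simps)
    have "4 * pi * y = K * (pi * s\<^sup>2)" by (simp add: y_def s_def space_form_y_def)
    then have "4 * pi * y = K * (A * (1 + y))" unfolding As .
    then have "(1 + y) * (4 * pi - K * A) = 4 * pi" by (simp add: algebra_simps)
    then have yK: "4 * pi / (4 * pi - K * A) - 1 = y" using dom[OF that] by (simp add: field_simps)
    have "s = sqrt (s\<^sup>2)" using s by simp
    also have "s\<^sup>2 = (1 + y) / (pi / A)" using As A by (simp add: field_simps)
    finally have sq: "s = sqrt (1 + y) / sqrt (pi / A)" by (simp only: real_sqrt_divide)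
    have "eta_area m A K = steklov_value K R m"
      using disk_spectrum_eq[OF R(1,2)] nth_smallest_range[OF steklov_value_strict_mono[OF R(1,2)]]
      by (simp add: eta_area_def R_def)
    also have "\<dots> = 2 / (s * (1 + y) * kint m 2 y)"
      unfolding steklov_value_eq[OF R(1,2)] y_def s_def ..
    also have "\<dots> = 2 * sqrt (pi / A) / area_profile m y"
      unfolding sq by (simp add: area_profile_def)
    finally show ?thesis unfolding yK .
  qed
qed (use A in auto)

theorem corollary12:
  fixes m :: nat
  assumes "m \<ge> 1"
  shows "(\<forall>A::real. A > 0 \<longrightarrow>
            (m = 1 \<longrightarrow> (\<exists>K1. 0 < K1 \<and> K1 < 4 * pi / A \<and>
               strict_antimono_on {..<K1} (eta_area m A) \<and>
               strict_mono_on {K1<..<4 * pi / A} (eta_area m A))) \<and>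
            (m = 2 \<longrightarrow>
               strict_antimono_on {..<0} (eta_area m A) \<and>
               strict_mono_on {0<..<4 * pi / A} (eta_area m A)) \<and>
            (m \<ge> 3 \<longrightarrow> (\<exists>Km<0.
               strict_antimono_on {..<Km} (eta_area m A) \<and>
               strict_mono_on {Km<..<4 * pi / A} (eta_area m A)))) \<and>
         (\<forall>\<rho>::real. \<rho> > 0 \<longrightarrow>
            (m = 1 \<longrightarrow>
               strict_antimono_on {..<0} (eta_radius m \<rho>) \<and>
               strict_mono_on {0<..<(pi / \<rho>)\<^sup>2} (eta_radius m \<rho>)) \<and>
            (m \<ge> 2 \<longrightarrow> (\<exists>Km<0.
               strict_antimono_on {..<Km} (eta_radius m \<rho>) \<and>
               strict_mono_on {Km<..<(pi / \<rho>)\<^sup>2} (eta_radius m \<rho>))))"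
proof (intro conjI allI impI)
  fix A :: real assume A: "A > 0"
  have area: "strict_antimono_on {..<k} (eta_area m A) \<and> strict_mono_on {k<..<4 * pi / A} (eta_area m A)"
    if "-1 < a" "unimodal (area_profile m) a" "k = 4 * pi / A * (a / (1 + a))" for a k
    by (rule eta_area_monotonicity[OF A that])
  show "\<exists>K1. 0 < K1 \<and> K1 < 4 * pi / A \<and> strict_antimono_on {..<K1} (eta_area m A) \<and>
      strict_mono_on {K1<..<4 * pi / A} (eta_area m A)" if m: "m = 1"
  proof -
    obtain a where a: "0 < a" "unimodal (area_profile m) a"
      using area_profile_unimodal_1 unfolding m by blast
    \<comment> \<open>For a > 0 the quotient a / (1 + a) lies in (0, 1), so the turning point is
      inside the admissible range.\<close>
    let ?k = "4 * pi / A * (a / (1 + a))"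
    have "0 < ?k" using a A by simp
    moreover have "4 * pi / A * (a / (1 + a)) < 4 * pi / A * 1"
      using a A by (intro mult_strict_left_mono) auto
    ultimately show ?thesis using area[OF _ a(2) refl] a(1) by (intro exI[of _ ?k]) auto
  qed
  show "strict_antimono_on {..<0} (eta_area m A)" "strict_mono_on {0<..<4 * pi / A} (eta_area m A)" if "m = 2"
    using area[OF _ area_profile_unimodal_2[folded that], of 0] by auto
  show "\<exists>Km<0. strict_antimono_on {..<Km} (eta_area m A) \<and>
      strict_mono_on {Km<..<4 * pi / A} (eta_area m A)" if m: "3 \<le> m"
  proof -
    obtain a where a: "-1 < a" "a < 0" "unimodal (area_profile m) a"
      using area_profile_unimodal_ge_3[OF m] by auto
    have "4 * pi / A * (a / (1 + a)) < 0"
      using a A by (intro mult_pos_neg divide_neg_pos) auto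
    then show ?thesis using area[OF a(1,3) refl] by blast
  qed
next
  fix \<rho> :: real assume \<rho>: "\<rho> > 0"
  have radius: "strict_antimono_on {..<k} (eta_radius m \<rho>) \<and> strict_mono_on {k<..<(pi / \<rho>)\<^sup>2} (eta_radius m \<rho>)"
    if "-1 < a" "unimodal (radius_profile m) a" "k = 4 * radius_curvature a / \<rho>\<^sup>2" "k \<le> (pi / \<rho>)\<^sup>2" for a k
    by (rule eta_radius_monotonicity[OF \<rho> that])
  show "strict_antimono_on {..<0} (eta_radius m \<rho>)" "strict_mono_on {0<..<(pi / \<rho>)\<^sup>2} (eta_radius m \<rho>)" if "m = 1"
    using radius[OF _ radius_profile_unimodal_1[folded that], of 0] by (auto simp: radius_curvature_def)
  show "\<exists>Km<0. strict_antimono_on {..<Km} (eta_radius m \<rho>) \<and>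
      strict_mono_on {Km<..<(pi / \<rho>)\<^sup>2} (eta_radius m \<rho>)" if m: "2 \<le> m"
  proof -
    obtain a where a: "-1 < a" "a < 0" "unimodal (radius_profile m) a"
      using radius_profile_unimodal_ge_2[OF m] by auto
    have neg: "4 * radius_curvature a / \<rho>\<^sup>2 < 0"
      using a arctan_quot_pos[OF a(1)] \<rho> by (simp add: radius_curvature_def mult_neg_pos divide_neg_pos)
    then have "4 * radius_curvature a / \<rho>\<^sup>2 \<le> (pi / \<rho>)\<^sup>2" using zero_le_power2[of "pi / \<rho>"] by linarith
    then show ?thesis using radius[OF a(1,3) refl] neg by blast
  qed
qed

end
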